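(* Let $m,n\ge 2$ be integers. The dimension of the semi-algebraic set $C(\mathcal{R}_0)=\mathbb{R}^{[m,n]}\setminus\mathcal{R}_0$ satisfies $$(n-1)^m\le\dim C(\mathcal{R}_0)\le n^m-1.$$
   Context: $\mathbb{R}^{[m,n]}\cong\mathbb{R}^{n^m}$ is the real vector space of real $m$-th order $n$-dimensional tensors $\mathcal{A}=(a_{i_1\cdots i_m})$, $i_j\in[n]=\{1,\dots,n\}$. For $x\in\mathbb{R}^n$, $\mathcal{A}x^{m-1}\in\mathbb{R}^n$ has components $(\mathcal{A}x^{m-1})_i=\sum_{i_2,\dots,i_m=1}^n a_{ii_2\cdots i_m}x_{i_2}\cdots x_{i_m}$, and $\mathcal{A}x^m=\langle x,\mathcal{A}x^{m-1}\rangle$. For $a\in\mathbb{R}^n$, $\mathrm{Sol}(\mathcal{A},a)$ is the solution set of the tensor complementarity problem $\mathrm{TCP}(\mathcal{A},a)$, i.e. the set of $x\in\mathbb{R}^n$ with $x\ge 0$, $\mathcal{A}x^{m-1}+a\ge 0$, $\mathcal{A}x^m+\langle x,a\rangle=0$ (inequalities componentwise). $\mathcal{A}$ is an R$_0$-tensor if $\mathrm{Sol}(\mathcal{A},0)=\{0\}$; $\mathcal{R}_0\subset\mathbb{R}^{[m,n]}$ is the set of all R$_0$-tensors. A subset of $\mathbb{R}^N$ is semi-algebraic if it is a finite union of sets of the form $\{x: f_1(x)=\dots=f_\ell(x)=0,\ g_{\ell+1}(x)<0,\dots,g_k(x)<0\}$ with $f_i,g_j$ real polynomials. A semi-algebraic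 set $S$ is a finite disjoint union of semi-algebraic sets $S_i$, each semi-algebraically diffeomorphic to $(0,1)^{d_i}$ (with $(0,1)^0$ a point), and $\dim S:=\max_i d_i$, which does not depend on the decomposition. *)

theory Defs
  imports "HOL-Analysis.Analysis"
begin

section \<open>Semi-algebraic sets\<close>

text \<open>On a Euclidean space the bounded linear functionals are exactly the linear forms in the
  coordinates, so \<open>real_polynomial_function\<close> is the predicate of being a real polynomial
  in the coordinates.\<close>

definition basic_semialgebraic :: "'a::euclidean_space set \<Rightarrow> bool" where
  "basic_semialgebraic S \<longleftrightarrow>
    (\<exists>F G. finite F \<and> finite G \<and>
       (\<forall>f\<in>F. real_polynomial_function f) \<and> (\<forall>g\<in>G. real_polynomial_function g) \<and>
       S = {x. (\<forall>f\<in>F. f x = 0) \<and> (\<forall>g\<in>G. g x < 0)})"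

definition semialgebraic :: "'a::euclidean_space set \<Rightarrow> bool" where
  "semialgebraic S \<longleftrightarrow> (\<exists>\<C>. finite \<C> \<and> (\<forall>T\<in>\<C>. basic_semialgebraic T) \<and> S = \<Union>\<C>)"


section \<open>Semi-algebraic diffeomorphisms\<close>

primrec k_times_differentiable_on ::
    "nat \<Rightarrow> ('a::euclidean_space \<Rightarrow> 'b::euclidean_space) \<Rightarrow> 'a set \<Rightarrow> bool" where
  "k_times_differentiable_on 0 f U \<longleftrightarrow> continuous_on U f"
| "k_times_differentiable_on (Suc k) f U \<longleftrightarrow>
     (\<forall>x\<in>U. f differentiable (at x)) \<and>
     (\<forall>v. k_times_differentiable_on k (\<lambda>x. frechet_derivative f (at x) v) U)"

text \<open>For open \<open>U\<close> the following is \<open>C\<^sup>\<infinity>\<close>-smoothness.\<close>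

definition smooth_on_open :: "('a::euclidean_space \<Rightarrow> 'b::euclidean_space) \<Rightarrow> 'a set \<Rightarrow> bool" where
  "smooth_on_open f U \<longleftrightarrow> (\<forall>k. k_times_differentiable_on k f U)"

text \<open>Smoothness on an arbitrary subset of a Euclidean space is, as usual, the existence of local
  smooth extensions to open sets of the ambient space.\<close>

definition smooth_map_on :: "('a::euclidean_space \<Rightarrow> 'b::euclidean_space) \<Rightarrow> 'a set \<Rightarrow> bool" where
  "smooth_map_on f S \<longleftrightarrow>
    (\<forall>x\<in>S. \<exists>U g. open U \<and> x \<in> U \<and> smooth_on_open g U \<and> (\<forall>y\<in>S \<inter> U. g y = f y))"

definition semialgebraic_map_on ::
    "('a::euclidean_space \<Rightarrow> 'b::euclidean_space) \<Rightarrow> 'a set \<Rightarrow> bool" where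
  "semialgebraic_map_on f S \<longleftrightarrow> semialgebraic {(x, y). x \<in> S \<and> y = f x}"

definition semialgebraically_diffeomorphic ::
    "'a::euclidean_space set \<Rightarrow> 'b::euclidean_space set \<Rightarrow> bool" where
  "semialgebraically_diffeomorphic S T \<longleftrightarrow>
    (\<exists>f g. f ` S \<subseteq> T \<and> g ` T \<subseteq> S \<and> (\<forall>x\<in>S. g (f x) = x) \<and> (\<forall>y\<in>T. f (g y) = y) \<and>
       smooth_map_on f S \<and> smooth_map_on g T \<and>
       semialgebraic_map_on f S \<and> semialgebraic_map_on g T)"


section \<open>Dimension\<close>

text \<open>As types cannot depend on \<open>d\<close>, the cube \<open>(0,1)\<^sup>d\<close> is realised inside the ambient space:
  \<open>d = card B\<close> of the coordinates range over \<open>(0,1)\<close> and the others are \<open>0\<close>. For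
  \<open>B = {}\<close> it is a point. No generality is lost, as a subset of \<open>\<real>\<^sup>N\<close> can be diffeomorphic to
  \<open>(0,1)\<^sup>d\<close> only if \<open>d \<le> N\<close>.\<close>

definition open_unit_cube :: "'a::euclidean_space set \<Rightarrow> 'a set" where
  "open_unit_cube B =
    {x. (\<forall>b\<in>B. 0 < x \<bullet> b \<and> x \<bullet> b < 1) \<and> (\<forall>b\<in>Basis - B. x \<bullet> b = 0)}"

definition semialgebraic_cell :: "'a::euclidean_space set \<Rightarrow> nat \<Rightarrow> bool" where
  "semialgebraic_cell S d \<longleftrightarrow> semialgebraic S \<and>
    (\<exists>B\<subseteq>(Basis :: 'a set). card B = d \<and> semialgebraically_diffeomorphic S (open_unit_cube B))"

definition cell_decomposition :: "'a::euclidean_space set \<Rightarrow> 'a set set \<Rightarrow> ('a set \<Rightarrow> nat) \<Rightarrow> bool" where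
  "cell_decomposition S P d \<longleftrightarrow>
    finite P \<and> disjoint P \<and> \<Union>P = S \<and> (\<forall>T\<in>P. semialgebraic_cell T (d T))"

text \<open>Meaningful for nonempty semi-algebraic \<open>S\<close>, for which a decomposition exists and the maximum
  does not depend on it.\<close>

definition semialgebraic_dim :: "'a::euclidean_space set \<Rightarrow> nat" where
  "semialgebraic_dim S = (THE k. \<exists>P d. cell_decomposition S P d \<and> k = Max (d ` P))"


section \<open>Tensors and the tensor complementarity problem\<close>

text \<open>A tensor of order \<open>m = CARD('m)\<close> and dimension \<open>n = CARD('n)\<close> has one entry for each
  multi-index \<open>j :: 'm \<Rightarrow> 'n\<close>. The linear order on \<open>'m\<close> only serves to single out the first
  index position.\<close>

type_synonym ('m, 'n) tensor = "real ^ ('m \<Rightarrow> 'n)"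

definition first_pos :: "'m::{finite,linorder}" where
  "first_pos = Min UNIV"

definition tensor_app :: "('m::{finite,linorder}, 'n::finite) tensor \<Rightarrow> real ^ 'n \<Rightarrow> real ^ 'n" where
  "tensor_app A x =
    (\<chi> i. \<Sum>j\<in>{j. j first_pos = i}. A $ j * (\<Prod>k\<in>UNIV - {first_pos}. x $ (j k)))"

definition tensor_form :: "('m::{finite,linorder}, 'n::finite) tensor \<Rightarrow> real ^ 'n \<Rightarrow> real" where
  "tensor_form A x = x \<bullet> tensor_app A x"

definition TCP_Sol ::
    "('m::{finite,linorder}, 'n::finite) tensor \<Rightarrow> real ^ 'n \<Rightarrow> (real ^ 'n) set" where
  "TCP_Sol A a =
    {x. (\<forall>i. 0 \<le> x $ i) \<and> (\<forall>i. 0 \<le> (tensor_app A x + a) $ i) \<and> tensor_form A x + x \<bullet> a = 0}"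

definition R0_tensors :: "('m::{finite,linorder}, 'n::finite) tensor set" where
  "R0_tensors = {A. TCP_Sol A 0 = {0}}"

end

(* By Hoermander's elimination the sign diagram of finitely many polynomials along a coordinate line
   depends only on the signs of finitely many polynomials in the other coordinates. This gives the
   Tarski-Seidenberg theorem, hence the semi-algebraicity of the complement C of the R0-tensors, and,
   with Thom's lemma, a cylindrical decomposition into smooth cells, so that the dimension is defined
   by some decomposition. A smooth image of a set of lower dimension is Lebesgue-null, hence a cell of
   dimension d cannot be covered by finitely many cells of smaller dimension: the dimension is unique
   and at least d as soon as the set contains a cube of dimension d. Tensors all of whose entries with
   an index i0 vanish are not R0 (take x = e_i0), which is a space of dimension (n-1)^m. Conversely C is
   Lebesgue-null: the equations satisfied by a solution with support alpha can be solved for the entries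
   a_(i,p,...,p) with i in alpha (p in alpha fixed), so C is covered by finitely many polynomial images
   of hyperplanes. *)

theory Submission
  imports Defs
begin

section \<open>Sign diagrams of univariate polynomials\<close>

text \<open>The dimension is given by a definite description, so no bound on it can be proved before
  some decomposition is known to exist and the maximum is known to be unique. This is why a full
  decomposition into smooth cells is built and not merely a measure estimate. The induction over
  coordinates stays in one Euclidean space: projections become saturations along a basis vector,
  base cells lie in the coordinate subspace spanned by a set \<open>V\<close> of basis vectors, and
  parametrisations extend to open cylinders by ignoring the other coordinates. Sign diagrams are
  compared through increasing bijections of the line rather than lists of roots, so adding one
  polynomial to a diagram means moving finitely many points. Closing a family under the derivative
  in the fibre direction has two effects: the sign classes on a fibre are points or intervals, and
  each root is a simple root of some member, which makes the sections smooth.\<close>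

lemma poly_sgn_const:
  fixes p :: "real poly"
  assumes "a < s" "s < c" "a < t" "t < c" and nz: "p = 0 \<or> (\<forall>x. a < x \<longrightarrow> x < c \<longrightarrow> poly p x \<noteq> 0)"
  shows "sgn (poly p s) = sgn (poly p t)"
proof (rule ccontr)
  assume ne: "sgn (poly p s) \<noteq> sgn (poly p t)"
  then have "p \<noteq> 0" by auto
  then have nz': "\<And>x. a < x \<Longrightarrow> x < c \<Longrightarrow> poly p x \<noteq> 0" using nz by auto
  have n: "poly p s \<noteq> 0" "poly p t \<noteq> 0" using nz' assms by auto
  then have m: "poly p s * poly p t < 0"
    using ne by (auto simp: sgn_real_def mult_less_0_iff split: if_splits)
  have "s \<noteq> t" using ne by auto
  then have "min s t < max s t" "poly p (min s t) * poly p (max s t) < 0"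
    using m by (auto simp: min_def max_def mult.commute)
  then obtain x where "min s t < x" "x < max s t" "poly p x = 0" using poly_IVT by blast
  then show False using nz'[of x] assms by linarith
qed

text \<open>The mean value theorem only looks at interior points, so \<open>a\<close> and
  \<open>c\<close> themselves may be roots of the derivative. Later they are consecutive dividing
  points.\<close>

lemma poly_diff_sgn:
  fixes p :: "real poly"
  assumes "a \<le> s" "s < t" "t \<le> c" "a < e" "e < c"
    and nz: "\<And>x. a < x \<Longrightarrow> x < c \<Longrightarrow> poly (pderiv p) x \<noteq> 0"
  shows "sgn (poly p t - poly p s) = sgn (poly (pderiv p) e)"
proof -
  obtain x where x: "s < x" "x < t" "poly p t - poly p s = (t - s) * poly (pderiv p) x"
    using poly_MVT[OF \<open>s < t\<close>] by blast
  have "sgn (poly (pderiv p) x) = sgn (poly (pderiv p) e)"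
    by (rule poly_sgn_const[of a _ c]) (use x assms in auto)
  then show ?thesis using x by (simp add: sgn_mult)
qed

lemma poly_deriv_sgn_at_top:
  fixes p :: "real poly"
  assumes "pderiv p \<noteq> 0"
  obtains U where "\<And>t. t \<ge> U \<Longrightarrow> poly p t \<noteq> 0 \<and> sgn (poly p t) = sgn (poly (pderiv p) t)"
proof -
  have d: "degree p \<noteq> 0" using assms by (simp add: pderiv_eq_0_iff)
  have pos: "\<exists>U. \<forall>t\<ge>U. poly p t > 0 \<and> poly (pderiv p) t > 0" if lc: "lead_coeff p > 0" "degree p \<noteq> 0" for p :: "real poly"
  proof -
    have "lead_coeff (pderiv p) > 0"
      using lc by (simp add: degree_pderiv coeff_pderiv)
    then obtain n1 n2 where "\<forall>x\<ge>n1. lead_coeff p \<le> poly p x" "\<forall>x\<ge>n2. lead_coeff (pderiv p) \<le> poly (pderiv p) x"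
      using poly_pinfty_gt_lc[of p] poly_pinfty_gt_lc[of "pderiv p"] lc(1) by blast
    then show ?thesis using lc(1) \<open>lead_coeff (pderiv p) > 0\<close>
      by (intro exI[of _ "max n1 n2"]) (meson less_le_trans max.bounded_iff)
  qed
  show ?thesis
  proof (cases "lead_coeff p > 0")
    case True
    then show ?thesis using pos[OF True d] that by (metis less_irrefl sgn_pos)
  next
    case False
    then have "lead_coeff (-p) > 0" using d by (auto simp: not_less le_less)
    then obtain U where "\<forall>t\<ge>U. poly (-p) t > 0 \<and> poly (pderiv (-p)) t > 0"
      using pos[of "-p"] d by auto
    then show ?thesis by (intro that[of U]) (auto simp: pderiv_minus dest: less_imp_neq)
  qed
qed

text \<open>Reflecting \<open>t\<close> to \<open>-t\<close> reduces this to the behaviour at plus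
  infinity and flips the sign of the derivative.\<close>

lemma poly_deriv_sgn_at_bot:
  fixes p :: "real poly"
  assumes "pderiv p \<noteq> 0"
  obtains L where "\<And>t. t \<le> L \<Longrightarrow> poly p t \<noteq> 0 \<and> sgn (poly p t) = - sgn (poly (pderiv p) t)"
proof -
  let ?q = "pcompose p [:0,-1:]"
  have e: "pderiv ?q = - pcompose (pderiv p) [:0,-1:]"
    by (simp add: pderiv_pcompose pderiv_pCons)
  have "pderiv ?q \<noteq> 0"
    using assms by (auto simp: e pcompose_eq_0_iff pcompose_eq_0)
  then obtain U where U: "\<And>t. t \<ge> U \<Longrightarrow> poly ?q t \<noteq> 0 \<and> sgn (poly ?q t) = sgn (poly (pderiv ?q) t)"
    using poly_deriv_sgn_at_top by blast
  show ?thesis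
  proof (rule that[of "-U"])
    fix t assume "t \<le> -U"
    then show "poly p t \<noteq> 0 \<and> sgn (poly p t) = - sgn (poly (pderiv p) t)"
      using U[of "-t"] by (simp add: e poly_pcompose sgn_minus)
  qed
qed

text \<open>Piecewise linear, with slopes \<open>k1\<close> on \<open>[A, r]\<close> and
  \<open>k2\<close> on \<open>[r, C]\<close>. It redirects a matching of two lines so that a root
  goes to a root, without disturbing anything outside \<open>(A, C)\<close>.\<close>

lemma move_point:
  fixes A C r s :: real
  assumes "A < r" "r < C" "A < s" "s < C"
  obtains \<sigma> where "strict_mono \<sigma>" "surj \<sigma>" "\<And>x. x \<le> A \<or> C \<le> x \<Longrightarrow> \<sigma> x = x" "\<sigma> r = s"
proof -
  define k1 where "k1 = (s - A) / (r - A)"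
  define k2 where "k2 = (C - s) / (C - r)"
  have k: "k1 > 0" "k2 > 0" using assms by (auto simp: k1_def k2_def)
  define \<sigma> where "\<sigma> x = (if x \<le> A then x else if x \<le> r then A + k1 * (x - A) else if x \<le> C then C - k2 * (C - x) else x)" for x
  have r: "A + k1 * (r - A) = s" "C - k2 * (C - r) = s" using assms by (auto simp: k1_def k2_def field_simps)
  have lo: "\<And>x. x \<le> r \<Longrightarrow> A + k1 * (x - A) \<le> s"
    using k mult_left_mono[of _ r k1] by (subst r(1)[symmetric]) (simp add: algebra_simps)
  have lo': "\<And>x. A < x \<Longrightarrow> A < A + k1 * (x - A)" using k by auto
  have hi: "\<And>x. r < x \<Longrightarrow> s < C - k2 * (C - x)"
    using k mult_strict_left_mono[of r _ k2] by (subst r(2)[symmetric]) (simp add: algebra_simps)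
  have hi': "\<And>x. x \<le> C \<Longrightarrow> C - k2 * (C - x) \<le> C" using k by auto
  have m: "strict_mono \<sigma>"
  proof (rule strict_monoI)
    fix x y :: real assume xy: "x < y"
    have 1: "k1 * (x - A) < k1 * (y - A)" "k2 * (C - y) < k2 * (C - x)" using k xy by auto
    show "\<sigma> x < \<sigma> y"
      using 1 xy assms lo[of x] lo'[of y] hi[of y] hi'[of x] unfolding \<sigma>_def
      by (auto split: if_splits)
  qed
  have "\<exists>x. \<sigma> x = y" for y
  proof -
    consider "y \<le> A" | "A < y" "y \<le> s" | "s < y" "y \<le> C" | "C < y" by linarith
    then show ?thesis
    proof cases
      case 1
      then show ?thesis by (intro exI[of _ y]) (auto simp: \<sigma>_def)
    next
      case 2
      let ?x = "A + (y - A) / k1"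
      have "A < ?x" using 2 k by auto
      moreover have "(y - A) / k1 \<le> r - A" using 2 r(1) k by (simp add: pos_divide_le_eq mult.commute)
      then have "?x \<le> r" by simp
      ultimately show ?thesis using k by (intro exI[of _ ?x]) (auto simp: \<sigma>_def)
    next
      case 3
      let ?x = "C - (C - y) / k2"
      have "(C - y) / k2 < C - r" using 3 r(2) k by (simp add: pos_divide_less_eq mult.commute)
      moreover have "?x \<le> C" using 3 k by auto
      ultimately show ?thesis using k assms by (intro exI[of _ ?x]) (auto simp: \<sigma>_def)
    next
      case 4
      then show ?thesis using assms by (intro exI[of _ y]) (auto simp: \<sigma>_def)
    qed
  qed
  then have "surj \<sigma>" by (metis surjI)
  moreover have "\<And>x. x \<le> A \<or> C \<le> x \<Longrightarrow> \<sigma> x = x" using assms k by (auto simp: \<sigma>_def)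
  moreover have "\<sigma> r = s" using assms r by (auto simp: \<sigma>_def)
  ultimately show ?thesis using that m by blast
qed

lemma finite_neighbours:
  fixes Z :: "real set"
  assumes "finite Z" "L \<in> Z" "U \<in> Z" "L < t" "t < U" "t \<notin> Z"
  obtains a c where "a \<in> Z" "c \<in> Z" "a < t" "t < c" "L \<le> a" "c \<le> U" "\<And>z. a < z \<Longrightarrow> z < c \<Longrightarrow> z \<notin> Z"
proof -
  let ?A = "{z\<in>Z. z < t}" and ?C = "{z\<in>Z. t < z}"
  have f: "finite ?A" "finite ?C" "?A \<noteq> {}" "?C \<noteq> {}" using assms by auto
  have "Max ?A \<in> ?A" "Min ?C \<in> ?C" using Max_in Min_in f by blast+
  moreover have "L \<le> Max ?A" "Min ?C \<le> U" using assms f by auto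
  moreover have "z \<notin> Z" if "Max ?A < z" "z < Min ?C" for z
  proof
    assume "z \<in> Z"
    then consider "z \<in> ?A" | "z \<in> ?C" using \<open>t \<notin> Z\<close> by (cases "z < t") (auto simp: not_less le_less)
    then show False
    proof cases
      case 1
      then show False using Max_ge[OF f(1) 1] that by simp
    next
      case 2
      then show False using Min_le[OF f(2) 2] that by simp
    qed
  qed
  ultimately show ?thesis using that[of "Max ?A" "Min ?C"] by blast
qed

text \<open>At \<open>t\<close> the polynomial \<open>p\<close> moves away from zero, so the left
  end decides. If \<open>p\<close> has a root before \<open>t\<close>, then \<open>q\<close> has one
  before \<open>T\<close> and leaves it with the sign of its derivative. Otherwise the value of
  \<open>p\<close> at \<open>a\<close>, and so that of \<open>q\<close> at \<open>A\<close>, is zero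
  or already has the final sign, and the increment of \<open>q\<close> has this sign too.\<close>

lemma sgn_match_right:
  fixes p q :: "real poly"
  assumes ac: "a < t" "t < c" and AC: "A < T" "T < C"
    and nzp: "\<And>x. a < x \<Longrightarrow> x < c \<Longrightarrow> poly (pderiv p) x \<noteq> 0"
    and nzq: "\<And>x. A < x \<Longrightarrow> x < C \<Longrightarrow> poly (pderiv q) x \<noteq> 0"
    and s: "sgn (poly (pderiv p) t) = sgn (poly (pderiv q) T)"
    and l: "sgn (poly p a) = sgn (poly q A)"
    and sp: "sgn (poly p t) = sgn (poly (pderiv p) t)"
    and roots: "\<And>r. a < r \<Longrightarrow> r < t \<Longrightarrow> poly p r = 0 \<Longrightarrow> \<exists>R. A < R \<and> R < T \<and> poly q R = 0"
  shows "sgn (poly q T) = sgn (poly p t)"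
proof (cases "\<exists>r. a < r \<and> r < t \<and> poly p r = 0")
  case True
  then obtain R where R: "A < R" "R < T" "poly q R = 0" using roots by blast
  have "sgn (poly q T - poly q R) = sgn (poly (pderiv q) T)"
    by (rule poly_diff_sgn[of A _ _ C]) (use R AC nzq in auto)
  then show ?thesis using R s sp by simp
next
  case False
  then have "\<not> (poly p a * poly p t < 0)" using poly_IVT[OF ac(1)] by blast
  moreover have nz: "poly (pderiv p) t \<noteq> 0" using nzp ac by blast
  ultimately have "poly p a = 0 \<or> sgn (poly p a) = sgn (poly p t)"
    using sp by (auto simp: sgn_real_def mult_less_0_iff split: if_splits)
  moreover have "sgn (poly q T - poly q A) = sgn (poly (pderiv q) T)"
    by (rule poly_diff_sgn[of A _ _ C]) (use AC nzq in auto)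
  ultimately show ?thesis using s sp l nz by (auto simp: sgn_real_def split: if_splits)
qed

text \<open>Mirror image of \<open>sgn_match_right\<close>: at \<open>t\<close> the polynomial
  \<open>p\<close> moves towards zero, so the comparison is with the right end.\<close>

lemma sgn_match_left:
  fixes p q :: "real poly"
  assumes ac: "a < t" "t < c" and AC: "A < T" "T < C"
    and nzp: "\<And>x. a < x \<Longrightarrow> x < c \<Longrightarrow> poly (pderiv p) x \<noteq> 0"
    and nzq: "\<And>x. A < x \<Longrightarrow> x < C \<Longrightarrow> poly (pderiv q) x \<noteq> 0"
    and s: "sgn (poly (pderiv p) t) = sgn (poly (pderiv q) T)"
    and l: "sgn (poly p c) = sgn (poly q C)"
    and sp: "sgn (poly p t) = - sgn (poly (pderiv p) t)"
    and roots: "\<And>r. t < r \<Longrightarrow> r < c \<Longrightarrow> poly p r = 0 \<Longrightarrow> \<exists>R. T < R \<and> R < C \<and> poly q R = 0"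
  shows "sgn (poly q T) = sgn (poly p t)"
proof (cases "\<exists>r. t < r \<and> r < c \<and> poly p r = 0")
  case True
  then obtain R where R: "T < R" "R < C" "poly q R = 0" using roots by blast
  have "sgn (poly q R - poly q T) = sgn (poly (pderiv q) T)"
    by (rule poly_diff_sgn[of A _ _ C]) (use R AC nzq in auto)
  then show ?thesis using R s sp by (simp add: sgn_minus)
next
  case False
  then have "\<not> (poly p t * poly p c < 0)" using poly_IVT[OF ac(2)] by blast
  moreover have nz: "poly (pderiv p) t \<noteq> 0" using nzp ac by blast
  ultimately have "poly p c = 0 \<or> sgn (poly p c) = sgn (poly p t)"
    using sp by (auto simp: sgn_real_def mult_less_0_iff split: if_splits)
  moreover have "sgn (poly q C - poly q T) = sgn (poly (pderiv q) T)"
    by (rule poly_diff_sgn[of A _ _ C]) (use AC nzq in auto)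
  ultimately show ?thesis using s sp l nz by (auto simp: sgn_real_def split: if_splits)
qed

text \<open>Between consecutive roots of the \<open>f i\<close> the polynomial \<open>p\<close> is
  strictly monotone, so it has a root there exactly when its signs at the two ends are opposite, and
  \<open>q\<close> behaves alike on the image interval. The \<open>f i\<close> and
  \<open>g i\<close> have constant signs on these intervals, so \<open>\<theta>\<close> can be
  altered inside them at no cost until every root of \<open>p\<close> goes to a root of
  \<open>q\<close>.\<close>

lemma extend_matching:
  fixes f g :: "'i \<Rightarrow> real poly" and p q :: "real poly" and \<theta> :: "real \<Rightarrow> real"
  assumes I: "finite I" and th: "strict_mono \<theta>" "surj \<theta>"
    and F: "\<And>i t. i \<in> I \<Longrightarrow> sgn (poly (f i) t) = sgn (poly (g i) (\<theta> t))"
    and i0: "i0 \<in> I" "f i0 = pderiv p" "g i0 = pderiv q" and nz: "pderiv p \<noteq> 0"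
    and R: "\<And>i t. i \<in> I \<Longrightarrow> f i \<noteq> 0 \<Longrightarrow> poly (f i) t = 0 \<Longrightarrow> sgn (poly p t) = sgn (poly q (\<theta> t))"
  obtains \<theta>' where "strict_mono \<theta>'" "surj \<theta>'"
    "\<And>i t. i \<in> I \<Longrightarrow> sgn (poly (f i) t) = sgn (poly (g i) (\<theta>' t))"
    "\<And>t. sgn (poly p t) = sgn (poly q (\<theta>' t))"
proof -
  define Z where "Z = {t. \<exists>i\<in>I. f i \<noteq> 0 \<and> poly (f i) t = 0}"
  have "finite (\<Union>i\<in>{i\<in>I. f i \<noteq> 0}. {t. poly (f i) t = 0})"
    using I poly_roots_finite by auto
  then have finZ: "finite Z" by (rule rev_finite_subset) (auto simp: Z_def)
  have D: "sgn (poly (pderiv p) t) = sgn (poly (pderiv q) (\<theta> t))" for t using F[OF i0(1)] i0 by simp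
  have nzq: "pderiv q \<noteq> 0"
  proof
    assume "pderiv q = 0"
    then have "\<And>t. poly (pderiv p) t = 0" using D by (simp add: sgn_zero_iff)
    then show False using nz poly_all_0_iff_0 by blast
  qed
  obtain L1 where L1: "\<And>t. t \<le> L1 \<Longrightarrow> poly p t \<noteq> 0 \<and> sgn (poly p t) = - sgn (poly (pderiv p) t)"
    using poly_deriv_sgn_at_bot[OF nz] by blast
  obtain L2 where L2: "\<And>t. t \<le> L2 \<Longrightarrow> poly q t \<noteq> 0 \<and> sgn (poly q t) = - sgn (poly (pderiv q) t)"
    using poly_deriv_sgn_at_bot[OF nzq] by blast
  obtain U1 where U1: "\<And>t. t \<ge> U1 \<Longrightarrow> poly p t \<noteq> 0 \<and> sgn (poly p t) = sgn (poly (pderiv p) t)"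
    using poly_deriv_sgn_at_top[OF nz] by blast
  obtain U2 where U2: "\<And>t. t \<ge> U2 \<Longrightarrow> poly q t \<noteq> 0 \<and> sgn (poly q t) = sgn (poly (pderiv q) t)"
    using poly_deriv_sgn_at_top[OF nzq] by blast
  obtain l2 u2 where lu: "\<theta> l2 = L2" "\<theta> u2 = U2" using th(2) by (metis surjD)
  \<comment> \<open>Up to \<open>L\<close> both polynomials have the sign opposite to that of their
    derivatives, from \<open>U\<close> on the same sign, so they already match there. The bound
    \<open>L + 1\<close> secures \<open>L < U\<close>.\<close>
  define L where "L = min L1 l2"
  define U where "U = max (max U1 u2) (L + 1)"
  have LU: "L < U" by (simp add: U_def)
  have Lm: "poly p t \<noteq> 0 \<and> sgn (poly p t) = sgn (poly q (\<theta> t))" if "t \<le> L" for t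
    using that L1[of t] L2[of "\<theta> t"] D[of t] lu th(1) by (auto simp: L_def strict_mono_less_eq)
  have Um: "poly p t \<noteq> 0 \<and> sgn (poly p t) = sgn (poly q (\<theta> t))" if "t \<ge> U" for t
    using that U1[of t] U2[of "\<theta> t"] D[of t] lu th(1) by (auto simp: U_def strict_mono_less_eq)
  define S where "S = Z \<union> {L, U}"
  have finS: "finite S" using finZ by (simp add: S_def)
  \<comment> \<open>The invariant of the modification: \<open>p\<close> and \<open>q\<close> agree
    at the dividing points and outside \<open>(L, U)\<close>, so only the open intervals in between
    remain to be repaired.\<close>
  define good where "good \<theta> \<longleftrightarrow> strict_mono \<theta> \<and> surj \<theta> \<and>
      (\<forall>i\<in>I. \<forall>t. sgn (poly (f i) t) = sgn (poly (g i) (\<theta> t))) \<and>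
      (\<forall>t. t \<in> S \<or> t \<le> L \<or> U \<le> t \<longrightarrow> sgn (poly p t) = sgn (poly q (\<theta> t)))" for \<theta> :: "real \<Rightarrow> real"
  have gm: "strict_mono \<theta>" and gs: "surj \<theta>" and
    gF: "\<And>i t. i \<in> I \<Longrightarrow> sgn (poly (f i) t) = sgn (poly (g i) (\<theta> t))" and
    gS: "\<And>t. t \<in> S \<or> t \<le> L \<or> U \<le> t \<Longrightarrow> sgn (poly p t) = sgn (poly q (\<theta> t))"
    if "good \<theta>" for \<theta>
    using that unfolding good_def by blast+
  have gD: "sgn (poly (pderiv p) t) = sgn (poly (pderiv q) (\<theta> t))" if "good \<theta>" for \<theta> t
    using gF[OF that i0(1), of t] i0 by simp
  have g0: "good \<theta>" using th F Lm Um R by (auto simp: good_def S_def Z_def)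
  \<comment> \<open>The roots of \<open>p\<close> not yet sent to roots of \<open>q\<close>; each
    repair removes at least one of them.\<close>
  define B where "B \<theta> = {t. poly p t = 0 \<and> poly q (\<theta> t) \<noteq> 0}" for \<theta> :: "real \<Rightarrow> real"
  have p0: "p \<noteq> 0" using nz by auto
  have finB: "finite (B \<theta>)" for \<theta>
    using poly_roots_finite[OF p0] by (rule rev_finite_subset) (auto simp: B_def)
  have nbh: "\<exists>a c. a \<in> S \<and> c \<in> S \<and> a < t \<and> t < c \<and> (\<forall>z. a < z \<longrightarrow> z < c \<longrightarrow> z \<notin> S \<and> L < z \<and> z < U)"
    if tS: "t \<notin> S" "L < t" "t < U" for t
  proof -
    obtain a c where "a \<in> S" "c \<in> S" "a < t" "t < c" "L \<le> a" "c \<le> U"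
      "\<And>z. a < z \<Longrightarrow> z < c \<Longrightarrow> z \<notin> S"
      by (rule finite_neighbours[OF finS, of L U t]) (use tS in \<open>auto simp: S_def\<close>)
    then show ?thesis by (intro exI[of _ a] exI[of _ c]) auto
  qed
  have pd: "poly (pderiv p) x \<noteq> 0" if "x \<notin> S" for x using that i0 nz by (auto simp: S_def Z_def)
  have inside: "\<exists>x. t = \<theta> x \<and> a < x \<and> x < c" if "good \<theta>" "\<theta> a < t" "t < \<theta> c" for \<theta> a c t
    using gs[OF that(1)] that(2,3) strict_mono_less[OF gm[OF that(1)]] by (metis surjD)
  have step: "\<exists>\<theta>'. good \<theta>' \<and> B \<theta>' \<subset> B \<theta>" if gd: "good \<theta>" and r: "r \<in> B \<theta>" for \<theta> r
  proof -
    have sm: "strict_mono \<theta>" and sj: "surj \<theta>" using gd by (auto simp: good_def)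
    have r0: "poly p r = 0" "poly q (\<theta> r) \<noteq> 0" using r by (auto simp: B_def)
    have "sgn (poly p r) \<noteq> sgn (poly q (\<theta> r))" using r0 by (metis sgn_0 sgn_zero_iff)
    then have "r \<notin> S \<and> L < r \<and> r < U" using gS[OF gd, of r] by (meson linorder_not_less)
    then obtain a c where ac: "a \<in> S" "c \<in> S" "a < r" "r < c"
      and no: "\<And>z. a < z \<Longrightarrow> z < c \<Longrightarrow> z \<notin> S \<and> L < z \<and> z < U" using nbh by blast
    have nzp: "poly (pderiv p) x \<noteq> 0" if "a < x" "x < c" for x using pd no that by blast
    \<comment> \<open>A root of the monotone \<open>p\<close> inside \<open>(a, c)\<close> forces
      opposite nonzero signs at the ends. The values of \<open>q\<close> at
      \<open>\<theta> a\<close> and \<open>\<theta> c\<close> have these signs, so \<open>q\<close>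
      has a root \<open>s\<close> in between, and the image of \<open>r\<close> is moved to
      \<open>s\<close>.\<close>
    have "sgn (poly p c - poly p r) = sgn (poly (pderiv p) r)"
      by (rule poly_diff_sgn[of a _ _ c]) (use ac nzp in auto)
    moreover have "sgn (poly p r - poly p a) = sgn (poly (pderiv p) r)"
      by (rule poly_diff_sgn[of a _ _ c]) (use ac nzp in auto)
    ultimately have "sgn (poly p a) = - sgn (poly p c)" "sgn (poly p c) \<noteq> 0"
      using r0 nzp[of r] ac by (auto simp: sgn_minus sgn_zero_iff)
    then have "sgn (poly q (\<theta> a)) = - sgn (poly q (\<theta> c))" "sgn (poly q (\<theta> c)) \<noteq> 0"
      using gS[OF gd, of a] gS[OF gd, of c] ac by simp_all
    then have "poly q (\<theta> a) * poly q (\<theta> c) < 0"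
      by (auto simp: sgn_real_def mult_less_0_iff split: if_splits)
    then obtain s where s: "\<theta> a < s" "s < \<theta> c" "poly q s = 0"
      using poly_IVT[of "\<theta> a" "\<theta> c" q] ac sm by (meson less_trans strict_mono_less)
    obtain \<sigma> where \<sigma>: "strict_mono \<sigma>" "surj \<sigma>" "\<And>x. x \<le> \<theta> a \<or> \<theta> c \<le> x \<Longrightarrow> \<sigma> x = x" "\<sigma> (\<theta> r) = s"
      using move_point[of "\<theta> a" "\<theta> r" "\<theta> c" s] s ac sm by (metis strict_mono_less)
    let ?t = "\<lambda>x. \<sigma> (\<theta> x)"
    have out: "?t x = \<theta> x" if "x \<le> a \<or> c \<le> x" for x
      using \<sigma>(3) that sm by (auto simp: strict_mono_less_eq)
    \<comment> \<open>The new image of \<open>t\<close> is the old image of another point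
      \<open>x\<close> of the same interval, on which \<open>f i\<close> has constant sign.\<close>
    have sgi: "sgn (poly (f i) t) = sgn (poly (g i) (?t t))" if i: "i \<in> I" for i t
    proof (cases "a < t \<and> t < c")
      case False
      then show ?thesis using out[of t] gd i by (auto simp: good_def not_less)
    next
      case True
      have "\<theta> a < ?t t" "?t t < \<theta> c"
        using True \<sigma>(3)[of "\<theta> a"] \<sigma>(3)[of "\<theta> c"] strict_mono_less[OF sm] strict_mono_less[OF \<sigma>(1)] by (metis order.refl)+
      then obtain x where x: "?t t = \<theta> x" "a < x" "x < c" using inside[OF gd] by blast
      have "f i = 0 \<or> (\<forall>x. a < x \<longrightarrow> x < c \<longrightarrow> poly (f i) x \<noteq> 0)" using no i by (auto simp: S_def Z_def)
      then have "sgn (poly (f i) t) = sgn (poly (f i) x)"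
        using True x by (intro poly_sgn_const) auto
      then show ?thesis using x gd i by (simp add: good_def)
    qed
    have smt: "strict_mono ?t" using sm \<sigma>(1) by (simp add: strict_mono_def)
    have "surj ?t" using comp_surj[OF sj \<sigma>(2)] by (simp add: comp_def)
    moreover have "sgn (poly p t) = sgn (poly q (?t t))" if "t \<in> S \<or> t \<le> L \<or> U \<le> t" for t
    proof -
      have "\<not> (a < t \<and> t < c)" using no[of t] that by auto
      then show ?thesis using out[of t] gd that by (auto simp: good_def not_less)
    qed
    ultimately have "good ?t" using smt sgi by (auto simp: good_def)
    moreover have "B ?t \<subseteq> B \<theta>"
    proof
      fix t assume t: "t \<in> B ?t"
      show "t \<in> B \<theta>"
      proof (cases "a < t \<and> t < c")
        case False
        then show ?thesis using out[of t] t by (auto simp: B_def not_less)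
      next
        case True
        \<comment> \<open>By strict monotonicity the interval contains no further root of
          \<open>p\<close>, so no new bad root arises.\<close>
        have "t = r"
        proof (rule ccontr)
          assume "t \<noteq> r"
          then have "sgn (poly p (max t r) - poly p (min t r)) = sgn (poly (pderiv p) r)"
            by (intro poly_diff_sgn[of a _ _ c]) (use ac True nzp in auto)
          moreover have "poly p (max t r) - poly p (min t r) = 0" using r0 t by (simp add: B_def max_def min_def)
          ultimately show False using nzp[of r] ac by (metis sgn_zero_iff)
        qed
        then show ?thesis using t \<sigma>(4) s by (auto simp: B_def)
      qed
    qed
    moreover have "r \<notin> B ?t" using \<sigma>(4) s by (auto simp: B_def)
    ultimately show ?thesis using r by blast
  qed
  have ex: "\<exists>\<theta>'. good \<theta>' \<and> B \<theta>' = {}" if "good \<theta>" for \<theta>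
    using that
  proof (induction "card (B \<theta>)" arbitrary: \<theta> rule: less_induct)
    case less
    show ?case
    proof (cases "B \<theta> = {}")
      case False
      then obtain \<theta>' where "good \<theta>'" "B \<theta>' \<subset> B \<theta>" using step less.prems by blast
      then show ?thesis using less.hyps[of \<theta>'] psubset_card_mono[OF finB] by blast
    qed (use less.prems in blast)
  qed
  from ex[OF g0] obtain \<theta>' where gd: "good \<theta>'" and B0: "B \<theta>' = {}" by blast
  have sm: "strict_mono \<theta>'" using gd by (simp add: good_def)
  have D': "sgn (poly (pderiv p) t) = sgn (poly (pderiv q) (\<theta>' t))" for t
    using gD[OF gd] .
  have root: "poly q (\<theta>' r) = 0" if "poly p r = 0" for r using B0 that by (auto simp: B_def)
  \<comment> \<open>With all roots matched, the other points are settled by the two comparison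
    lemmas, according to whether \<open>p\<close> moves away from zero or towards it.\<close>
  have "sgn (poly p t) = sgn (poly q (\<theta>' t))" for t
  proof (cases "t \<in> S \<or> t \<le> L \<or> U \<le> t")
    case True
    then show ?thesis using gd by (auto simp: good_def)
  next
    case False
    then obtain a c where ac: "a \<in> S" "c \<in> S" "a < t" "t < c"
      and no: "\<And>z. a < z \<Longrightarrow> z < c \<Longrightarrow> z \<notin> S \<and> L < z \<and> z < U" using nbh[of t] by force
    have nzp: "poly (pderiv p) x \<noteq> 0" if "a < x" "x < c" for x using pd no that by blast
    have nzq: "poly (pderiv q) x \<noteq> 0" if "\<theta>' a < x" "x < \<theta>' c" for x
      using inside[OF gd that] D' nzp sgn_zero_iff by metis
    have AC: "\<theta>' a < \<theta>' t" "\<theta>' t < \<theta>' c" using ac sm by (auto simp: strict_mono_less)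
    have e: "sgn (poly p a) = sgn (poly q (\<theta>' a))" "sgn (poly p c) = sgn (poly q (\<theta>' c))"
      using gd ac by (auto simp: good_def)
    have rootR: "\<exists>R. \<theta>' u < R \<and> R < \<theta>' v \<and> poly q R = 0" if "u < r" "r < v" "poly p r = 0" for u v r
      using strict_monoD[OF sm that(1)] strict_monoD[OF sm that(2)] root[OF that(3)] by blast
    have "poly (pderiv p) t \<noteq> 0" using nzp ac by blast
    then have "poly p t = 0 \<or> sgn (poly p t) = sgn (poly (pderiv p) t) \<or>
        sgn (poly p t) = - sgn (poly (pderiv p) t)"
      by (auto simp: sgn_real_def)
    then consider "poly p t = 0" | "sgn (poly p t) = sgn (poly (pderiv p) t)"
      | "sgn (poly p t) = - sgn (poly (pderiv p) t)"
      by blast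
    then show ?thesis
    proof cases
      case 1
      then show ?thesis using root by simp
    next
      case 2
      show ?thesis
        by (rule sgn_match_right[symmetric, OF ac(3,4) AC nzp nzq D' e(1) 2])
          (assumption | rule rootR)+
    next
      case 3
      show ?thesis
        by (rule sgn_match_left[symmetric, OF ac(3,4) AC nzp nzq D' e(2) 3])
          (assumption | rule rootR)+
    qed
  qed
  then show ?thesis using that[of \<theta>'] gd by (auto simp: good_def)
qed

text \<open>Thom's lemma. By induction the derivative keeps its sign on \<open>[a, c]\<close>, so
  \<open>p\<close> is strictly monotone or constant there, and equal signs at the ends leave no room
  for another sign in between.\<close>

lemma thom_sign_between:
  fixes p :: "real poly"
  assumes "\<And>i. sgn (poly ((pderiv ^^ i) p) a) = sgn (poly ((pderiv ^^ i) p) c)" "a \<le> t" "t \<le> c"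
  shows "sgn (poly p t) = sgn (poly p a)"
  using assms
proof (induction "degree p" arbitrary: p t)
  case 0
  then obtain k where "p = [:k:]" by (metis degree_eq_zeroE)
  then show ?case by simp
next
  case (Suc n)
  have IH: "sgn (poly (pderiv p) s) = sgn (poly (pderiv p) a)" if "a \<le> s" "s \<le> c" for s
  proof (rule Suc.hyps(1))
    show "n = degree (pderiv p)" using Suc.hyps(2) by (simp add: degree_pderiv)
    show "sgn (poly ((pderiv ^^ i) (pderiv p)) a) = sgn (poly ((pderiv ^^ i) (pderiv p)) c)" for i
      using Suc.prems(1)[of "Suc i"] by (simp only: funpow_Suc_right o_def)
  qed (use that in auto)
  have e: "sgn (poly p a) = sgn (poly p c)" using Suc.prems(1)[of 0] by simp
  have d: "sgn (poly p v - poly p u) = sgn (poly (pderiv p) a)" if uv: "a \<le> u" "u < v" "v \<le> c" for u v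
  proof -
    obtain x where x: "u < x" "x < v" "poly p v - poly p u = (v - u) * poly (pderiv p) x"
      using poly_MVT[OF uv(2)] by blast
    then show ?thesis using IH[of x] uv by (simp add: sgn_mult)
  qed
  consider "t = a" | "t = c" | "a < t" "t < c" using Suc.prems by linarith
  then show ?case
  proof cases
    case 3
    then show ?thesis using d[of a t] d[of t c] e by (auto simp: sgn_real_def split: if_splits)
  qed (use e in auto)
qed

section \<open>Parametrised families of univariate polynomials\<close>

text \<open>The degree of a single \<open>P x\<close> may drop where coefficients vanish; the
  uniform bound keeps the number of relevant coefficients finite.\<close>

definition poly_family :: "('a::euclidean_space \<Rightarrow> real poly) \<Rightarrow> bool" where
  "poly_family P \<longleftrightarrow> (\<exists>d. \<forall>x. degree (P x) \<le> d) \<and> (\<forall>i. real_polynomial_function (\<lambda>x. coeff (P x) i))"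

text \<open>The increasing bijection \<open>\<theta>\<close> encodes that the two fibres have the same sign diagram.\<close>

definition sign_equiv :: "('a \<Rightarrow> real poly) set \<Rightarrow> 'a \<Rightarrow> 'a \<Rightarrow> bool" where
  "sign_equiv \<Phi> x y \<longleftrightarrow> (\<exists>\<theta>. strict_mono \<theta> \<and> surj \<theta> \<and>
     (\<forall>P\<in>\<Phi>. \<forall>t. sgn (poly (P x) t) = sgn (poly (P y) (\<theta> t))))"

text \<open>The polynomials in \<open>H\<close> live on the whole space while the claim is
  restricted to \<open>W\<close>, because the elimination works on strata where all degrees are
  fixed.\<close>

definition sign_determined :: "'a::euclidean_space set \<Rightarrow> ('a \<Rightarrow> real poly) set \<Rightarrow> bool" where
  "sign_determined W \<Phi> \<longleftrightarrow> (\<exists>H. finite H \<and> (\<forall>h\<in>H. real_polynomial_function h) \<and>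
     (\<forall>x\<in>W. \<forall>y\<in>W. (\<forall>h\<in>H. sgn (h x) = sgn (h y)) \<longrightarrow> sign_equiv \<Phi> x y))"

lemma sign_equiv_mono: "sign_equiv \<Phi> x y \<Longrightarrow> \<Psi> \<subseteq> \<Phi> \<Longrightarrow> sign_equiv \<Psi> x y"
  unfolding sign_equiv_def by blast

lemma sign_determined_mono: "sign_determined W \<Phi> \<Longrightarrow> \<Psi> \<subseteq> \<Phi> \<Longrightarrow> sign_determined W \<Psi>"
  unfolding sign_determined_def by (meson sign_equiv_mono)

lemma poly_family_degree_bound:
  assumes "finite \<Psi>" "\<forall>P\<in>\<Psi>. poly_family P"
  obtains d where "\<And>P x. P \<in> \<Psi> \<Longrightarrow> degree (P x) \<le> d"
proof -
  have "\<exists>D. \<forall>P\<in>\<Psi>. \<forall>x. degree (P x) \<le> D P"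
    by (rule bchoice) (use assms(2) in \<open>auto simp: poly_family_def\<close>)
  then obtain D where D: "\<forall>P\<in>\<Psi>. \<forall>x. degree (P x) \<le> D P" by blast
  have "degree (P x) \<le> Max (insert 0 (D ` \<Psi>))" if "P \<in> \<Psi>" for P x
    using D that assms(1) by (meson Max_ge finite_imageI finite_insert imageI insertI2 order_trans)
  then show ?thesis using that by blast
qed

section \<open>Closure properties of polynomial families\<close>

lemma poly_family_pderiv:
  assumes "poly_family P" shows "poly_family (\<lambda>x. pderiv (P x))"
proof -
  obtain d where "\<And>x. degree (P x) \<le> d" using assms by (auto simp: poly_family_def)
  then have "\<forall>x. degree (pderiv (P x)) \<le> d" by (metis degree_pderiv diff_le_self order_trans)
  then show ?thesis using assms by (auto simp: poly_family_def coeff_pderiv)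
qed

lemma poly_family_add:
  assumes "poly_family P" "poly_family Q" shows "poly_family (\<lambda>x. P x + Q x)"
proof -
  obtain d e where "\<And>x. degree (P x) \<le> d" "\<And>x. degree (Q x) \<le> e"
    using assms by (auto simp: poly_family_def)
  then have "\<forall>x. degree (P x + Q x) \<le> max d e"
    by (meson degree_add_le max.coboundedI1 max.coboundedI2)
  then show ?thesis using assms by (auto simp: poly_family_def)
qed

lemma poly_family_smult:
  assumes "poly_family P" "real_polynomial_function a" shows "poly_family (\<lambda>x. smult (a x) (P x))"
proof -
  obtain d where "\<And>x. degree (P x) \<le> d" using assms by (auto simp: poly_family_def)
  then have "\<forall>x. degree (smult (a x) (P x)) \<le> d" by simp
  then show ?thesis using assms by (auto simp: poly_family_def)
qed

lemma poly_family_monom_mult: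
  assumes "poly_family P" shows "poly_family (\<lambda>x. monom 1 k * P x)"
proof -
  obtain d where d: "\<And>x. degree (P x) \<le> d" using assms by (auto simp: poly_family_def)
  have "degree (monom 1 k * P x) \<le> k + d" for x
    by (rule order_trans[OF degree_mult_le]) (use d degree_monom_le[of "1::real" k] in \<open>meson add_mono\<close>)
  moreover have "real_polynomial_function (\<lambda>x. coeff (monom 1 k * P x) i)" for i
    using assms by (cases "k \<le> i") (auto simp: poly_family_def coeff_monom_mult)
  ultimately show ?thesis by (auto simp: poly_family_def)
qed

lemma poly_family_const: "real_polynomial_function a \<Longrightarrow> poly_family (\<lambda>x. [:a x:])"
  unfolding poly_family_def
proof (intro conjI allI)
  show "real_polynomial_function (\<lambda>x. coeff [:a x:] i)" if "real_polynomial_function a" for i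
    using that by (cases i) auto
qed auto

lemma poly_family_sum: "finite I \<Longrightarrow> (\<And>i. i \<in> I \<Longrightarrow> poly_family (\<lambda>x. P x i)) \<Longrightarrow> poly_family (\<lambda>x. \<Sum>i\<in>I. P x i)"
proof (induction I rule: finite_induct)
  case empty
  then show ?case by (auto simp: poly_family_def)
next
  case (insert i I)
  then show ?case by (simp add: poly_family_add)
qed

lemma poly_family_mult:
  assumes P: "poly_family P" and Q: "poly_family Q" shows "poly_family (\<lambda>x. P x * Q x)"
proof -
  obtain d where d: "\<And>x. degree (P x) \<le> d" using P by (auto simp: poly_family_def)
  have "P x * Q x = (\<Sum>i\<le>d. smult (coeff (P x) i) (monom 1 i * Q x))" for x
  proof -
    have "P x = (\<Sum>i\<le>d. monom (coeff (P x) i) i)"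
      by (rule poly_as_sum_of_monoms'[symmetric]) (rule d)
    then have "P x * Q x = (\<Sum>i\<le>d. monom (coeff (P x) i) i * Q x)"
      by (metis sum_distrib_right)
    also have "\<dots> = (\<Sum>i\<le>d. smult (coeff (P x) i) (monom 1 i * Q x))"
      by (intro sum.cong refl) (metis mult.right_neutral mult_smult_left smult_monom)
    finally show ?thesis .
  qed
  moreover have "poly_family (\<lambda>x. \<Sum>i\<le>d. smult (coeff (P x) i) (monom 1 i * Q x))"
    by (intro poly_family_sum poly_family_smult poly_family_monom_mult Q)
      (use P in \<open>auto simp: poly_family_def\<close>)
  ultimately show ?thesis by presburger
qed

text \<open>The base point \<open>x\<close> runs through the whole space, not a hyperplane
  transversal to \<open>b\<close>; this keeps parameters and fibres in one type.\<close>

lemma poly_family_along: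
  fixes f :: "'a::euclidean_space \<Rightarrow> real"
  assumes "real_polynomial_function f"
  shows "\<exists>P. poly_family P \<and> (\<forall>x t. f (x + t *\<^sub>R b) = poly (P x) t)"
  using assms
proof (induction f rule: real_polynomial_function.induct)
  case (linear f)
  note bl = linear
  interpret bounded_linear f by fact
  have "poly_family (\<lambda>x. [:f x:] + monom 1 1 * [:f b:])"
    by (intro poly_family_add poly_family_monom_mult poly_family_const)
      (use bl in \<open>auto intro: real_polynomial_function.intros(1)\<close>)
  then show ?case
    by (intro exI[of _ "\<lambda>x. [:f x:] + monom 1 1 * [:f b:]"]) (auto simp: add scaleR poly_monom)
next
  case (const c)
  then show ?case by (intro exI[of _ "\<lambda>x. [:c:]"]) (auto intro: poly_family_const)
next
  case (add f g)
  then obtain P Q where "poly_family P" "\<forall>x t. f (x + t *\<^sub>R b) = poly (P x) t"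
    "poly_family Q" "\<forall>x t. g (x + t *\<^sub>R b) = poly (Q x) t" by blast
  then show ?case by (intro exI[of _ "\<lambda>x. P x + Q x"]) (auto intro: poly_family_add)
next
  case (mult f g)
  then obtain P Q where "poly_family P" "\<forall>x t. f (x + t *\<^sub>R b) = poly (P x) t"
    "poly_family Q" "\<forall>x t. g (x + t *\<^sub>R b) = poly (Q x) t" by blast
  then show ?case by (intro exI[of _ "\<lambda>x. P x * Q x"]) (auto intro: poly_family_mult)
qed

text \<open>Degrees can be read off from the vanishing of coefficients, and the uniform bound leaves
  finitely many degree patterns. The coefficients together with the polynomials for each pattern
  therefore suffice on \<open>W\<close>.\<close>

lemma sign_determined_split_degrees:
  fixes \<Phi> :: "('a::euclidean_space \<Rightarrow> real poly) set"
  assumes \<Psi>: "finite \<Psi>" "\<forall>P\<in>\<Psi>. poly_family P"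
    and det: "\<And>\<delta>. sign_determined {x\<in>W. \<forall>P\<in>\<Psi>. degree (P x) = \<delta> P} \<Phi>"
  shows "sign_determined W \<Phi>"
proof -
  obtain d where d: "\<And>P x. P \<in> \<Psi> \<Longrightarrow> degree (P x) \<le> d" using poly_family_degree_bound[OF \<Psi>] by blast
  have "\<exists>H. \<forall>\<delta>. finite (H \<delta>) \<and> (\<forall>h\<in>H \<delta>. real_polynomial_function h) \<and>
     (\<forall>x\<in>{x\<in>W. \<forall>P\<in>\<Psi>. degree (P x) = \<delta> P}. \<forall>y\<in>{x\<in>W. \<forall>P\<in>\<Psi>. degree (P x) = \<delta> P}.
       (\<forall>h\<in>H \<delta>. sgn (h x) = sgn (h y)) \<longrightarrow> sign_equiv \<Phi> x y)"
    by (intro choice allI det[unfolded sign_determined_def])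
  then obtain H where H': "\<forall>\<delta>. finite (H \<delta>) \<and> (\<forall>h\<in>H \<delta>. real_polynomial_function h) \<and>
     (\<forall>x\<in>{x\<in>W. \<forall>P\<in>\<Psi>. degree (P x) = \<delta> P}. \<forall>y\<in>{x\<in>W. \<forall>P\<in>\<Psi>. degree (P x) = \<delta> P}.
       (\<forall>h\<in>H \<delta>. sgn (h x) = sgn (h y)) \<longrightarrow> sign_equiv \<Phi> x y)" by blast
  have H: "\<And>\<delta>. finite (H \<delta>)" "\<And>\<delta> h. h \<in> H \<delta> \<Longrightarrow> real_polynomial_function h"
    "\<And>\<delta> x y. x \<in> W \<Longrightarrow> y \<in> W \<Longrightarrow> \<forall>P\<in>\<Psi>. degree (P x) = \<delta> P \<Longrightarrow> \<forall>P\<in>\<Psi>. degree (P y) = \<delta> P \<Longrightarrow>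
      \<forall>h\<in>H \<delta>. sgn (h x) = sgn (h y) \<Longrightarrow> sign_equiv \<Phi> x y"
    using H' by blast+
  define K where "K = (\<lambda>(P, i) x. coeff (P x) i) ` (\<Psi> \<times> {..d})"
  define H' where "H' = K \<union> (\<Union>\<delta>\<in>PiE \<Psi> (\<lambda>_. {..d}). H \<delta>)"
  have "finite H'" using \<Psi>(1) H(1) by (auto simp: H'_def K_def intro: finite_PiE)
  moreover have "\<forall>h\<in>H'. real_polynomial_function h"
    using \<Psi>(2) H(2) by (auto simp: H'_def K_def poly_family_def)
  moreover have "sign_equiv \<Phi> x y" if xy: "x \<in> W" "y \<in> W" and s: "\<forall>h\<in>H'. sgn (h x) = sgn (h y)" for x y
  proof -
    \<comment> \<open>The restriction to \<open>\<Psi>\<close> puts the pattern into the finite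
      function space that indexes the union in \<open>H'\<close>.\<close>
    define \<delta> where "\<delta> = restrict (\<lambda>P. degree (P x)) \<Psi>"
    have \<delta>: "\<delta> \<in> PiE \<Psi> (\<lambda>_. {..d})" using d by (auto simp: \<delta>_def)
    have "degree (P y) = degree (P x)" if P: "P \<in> \<Psi>" for P
    proof -
      have "(coeff (P x) i = 0) = (coeff (P y) i = 0)" for i
      proof (cases "i \<le> d")
        case True
        then have "(\<lambda>x. coeff (P x) i) \<in> H'" using P by (auto simp: H'_def K_def)
        then have "sgn (coeff (P x) i) = sgn (coeff (P y) i)"
          using bspec[OF s, of "\<lambda>x. coeff (P x) i"] by simp
        then show ?thesis by (metis sgn_zero_iff)
      next
        case False
        then show ?thesis using d[OF P] by (metis coeff_eq_0 linorder_not_le order.strict_trans1)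
      qed
      then show ?thesis by (simp add: degree_def)
    qed
    moreover have "H \<delta> \<subseteq> H'" using \<delta> by (auto simp: H'_def)
    ultimately show ?thesis using H(3)[OF xy, of \<delta>] s by (auto simp: \<delta>_def)
  qed
  ultimately show ?thesis unfolding sign_determined_def by blast
qed


text \<open>At a root of \<open>Q\<close> the reduction takes the value of \<open>P\<close> times
  the leading coefficient of \<open>Q\<close>. The signs of reductions and leading coefficients thus
  fix the sign of \<open>P\<close> at all roots of the other members, which is the root condition of
  \<open>extend_matching\<close>.\<close>

lemma sign_determined_insert:
  fixes P :: "'a::euclidean_space \<Rightarrow> real poly"
  assumes A: "finite A" and deg: "\<And>x Q. x \<in> W \<Longrightarrow> Q \<in> insert P A \<Longrightarrow> degree (Q x) = \<delta> Q"
    and fam: "\<And>Q. Q \<in> insert P A \<Longrightarrow> poly_family Q"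
    and P': "(\<lambda>x. pderiv (P x)) \<in> A" and d: "\<delta> P = Suc d"
    and det: "sign_determined W (A \<union> (\<lambda>Q x. smult (coeff (Q x) (\<delta> Q)) (P x) -
        smult (coeff (P x) (\<delta> P)) (monom 1 (\<delta> P - \<delta> Q) * Q x)) ` A)"
      (is "sign_determined W (A \<union> ?R ` A)")
  shows "sign_determined W (insert P A)"
proof -
  define R where "R = ?R"
  obtain H where H: "finite H" "\<forall>h\<in>H. real_polynomial_function h"
    "\<And>x y. x \<in> W \<Longrightarrow> y \<in> W \<Longrightarrow> \<forall>h\<in>H. sgn (h x) = sgn (h y) \<Longrightarrow> sign_equiv (A \<union> R ` A) x y"
    using det unfolding sign_determined_def R_def[symmetric] by blast
  define H' where "H' = H \<union> (\<lambda>Q x. coeff (Q x) (\<delta> Q)) ` A"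
  have "finite H'" "\<forall>h\<in>H'. real_polynomial_function h"
    using H A fam by (auto simp: H'_def poly_family_def)
  moreover have "sign_equiv (insert P A) x y"
    if xy: "x \<in> W" "y \<in> W" and s: "\<forall>h\<in>H'. sgn (h x) = sgn (h y)" for x y
  proof -
    have "sign_equiv (A \<union> R ` A) x y" using H(3)[OF xy] s by (simp add: H'_def)
    then obtain \<theta> where th: "strict_mono \<theta>" "surj \<theta>"
      and m': "\<forall>Q\<in>A \<union> R ` A. \<forall>t. sgn (poly (Q x) t) = sgn (poly (Q y) (\<theta> t))"
      unfolding sign_equiv_def by blast
    have m: "sgn (poly (Q x) t) = sgn (poly (Q y) (\<theta> t))" if "Q \<in> A \<union> R ` A" for Q t
      using bspec[OF m' that] by blast
    have nz: "pderiv (P x) \<noteq> 0" using deg[OF xy(1), of P] d by (simp add: pderiv_eq_0_iff)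
    have root: "sgn (poly (P x) t) = sgn (poly (P y) (\<theta> t))"
      if Q: "Q \<in> A" "Q x \<noteq> 0" "poly (Q x) t = 0" for Q t
    proof -
      have q0: "poly (Q y) (\<theta> t) = 0" using m[of Q t] Q by (metis UnI1 sgn_zero_iff)
      have "R Q \<in> A \<union> R ` A" using Q(1) by (intro UnI2 imageI)
      then have "sgn (poly (R Q x) t) = sgn (poly (R Q y) (\<theta> t))" by (rule m)
      then have "sgn (coeff (Q x) (\<delta> Q)) * sgn (poly (P x) t) = sgn (coeff (Q y) (\<delta> Q)) * sgn (poly (P y) (\<theta> t))"
        using q0 Q by (simp add: sgn_mult R_def)
      moreover have "(\<lambda>x. coeff (Q x) (\<delta> Q)) \<in> H'" using Q(1) by (simp add: H'_def)
      then have "sgn (coeff (Q x) (\<delta> Q)) = sgn (coeff (Q y) (\<delta> Q))" using s by (rule bspec[rotated])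
      moreover have "coeff (Q x) (\<delta> Q) \<noteq> 0" using Q deg[OF xy(1), of Q] by (metis insertI2 leading_coeff_0_iff)
      ultimately show ?thesis by (metis mult_left_cancel sgn_zero_iff)
    qed
    show ?thesis
    proof (rule extend_matching[OF A th _ P', of "\<lambda>Q. Q x" "\<lambda>Q. Q y" "P x" "P y"])
      show "sgn (poly (Q x) t) = sgn (poly (Q y) (\<theta> t))" if "Q \<in> A" for Q t by (rule m) (use that in blast)
      show "sgn (poly (P x) t) = sgn (poly (P y) (\<theta> t))" if "Q \<in> A" "Q x \<noteq> 0" "poly (Q x) t = 0" for Q t
        by (rule root[OF that])
    next
      fix \<theta>' assume "strict_mono \<theta>'" "surj \<theta>'"
        "\<And>Q t. Q \<in> A \<Longrightarrow> sgn (poly (Q x) t) = sgn (poly (Q y) (\<theta>' t))"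
        "\<And>t. sgn (poly (P x) t) = sgn (poly (P y) (\<theta>' t))"
      then show "sign_equiv (insert P A) x y" unfolding sign_equiv_def by (intro exI[of _ \<theta>']) simp
    qed (rule refl refl nz)+
  qed
  ultimately show ?thesis unfolding sign_determined_def by blast
qed

text \<open>As in Hoermander's proof of quantifier elimination, a family member of maximal degree is traded
  for its derivative and its one-step reductions modulo the other members, all of smaller degree.\<close>

lemma sign_determined_bounded:
  fixes \<Phi> :: "('a::euclidean_space \<Rightarrow> real poly) set"
  assumes "finite \<Phi>" "\<forall>P\<in>\<Phi>. poly_family P" "\<forall>P\<in>\<Phi>. \<forall>x\<in>W. degree (P x) \<le> d"
  shows "sign_determined W \<Phi>"
  using assms
proof (induction d arbitrary: W \<Phi>)
  case 0
  define H where "H = (\<lambda>P x. coeff (P x) 0) ` \<Phi>"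
  have "finite H" "\<forall>h\<in>H. real_polynomial_function h" using 0 by (auto simp: poly_family_def H_def)
  moreover have "sign_equiv \<Phi> x y" if xy: "x \<in> W" "y \<in> W" and s: "\<forall>h\<in>H. sgn (h x) = sgn (h y)" for x y
  proof -
    have c: "poly (P x) t = coeff (P x) 0" if "x \<in> W" "P \<in> \<Phi>" for P x t
    proof -
      have "degree (P x) = 0" using 0 that by auto
      then obtain k where "P x = [:k:]" by (metis degree_eq_zeroE)
      then show ?thesis by simp
    qed
    have "sgn (poly (P x) t) = sgn (poly (P y) t)" if "P \<in> \<Phi>" for P t
      using bspec[OF s, of "\<lambda>x. coeff (P x) 0"] that c[OF xy(1) that] c[OF xy(2) that] by (simp add: H_def)
    then show ?thesis unfolding sign_equiv_def
      by (intro exI[of _ "\<lambda>t. t"]) (simp add: strict_mono_def surj_def)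
  qed
  ultimately show ?case unfolding sign_determined_def by blast
next
  case (Suc d)
  \<comment> \<open>Inner induction on the set \<open>E\<close> of members that may have degree
    \<open>Suc d\<close>; those in \<open>\<Phi>\<close> have degree at most \<open>d\<close>. Both
    \<open>\<Phi>\<close> and \<open>W\<close> vary, as reductions enlarge the former and degree
    splitting shrinks the latter.\<close>
  have "sign_determined W (\<Phi> \<union> E)"
    if "finite E" "finite \<Phi>" "\<forall>P\<in>\<Phi> \<union> E. poly_family P" "\<forall>P\<in>\<Phi>. \<forall>x\<in>W. degree (P x) \<le> d"
      "\<forall>P\<in>E. \<forall>x\<in>W. degree (P x) \<le> Suc d" for E \<Phi> :: "('a \<Rightarrow> real poly) set" and W
    using that
  proof (induction E arbitrary: \<Phi> W rule: finite_induct)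
    case empty
    then show ?case using Suc.IH[of \<Phi> W] by simp
  next
    case (insert P E)
    let ?P' = "\<lambda>x. pderiv (P x)"
    let ?A = "insert ?P' (\<Phi> \<union> E)"
    show ?case
    proof (rule sign_determined_split_degrees[of "insert P ?A"])
      fix \<delta>
      let ?W = "{x\<in>W. \<forall>Q\<in>insert P ?A. degree (Q x) = \<delta> Q}"
      show "sign_determined ?W (\<Phi> \<union> insert P E)"
      \<comment> \<open>On a stratum where the degree of \<open>P\<close> drops, \<open>P\<close>
        joins the low-degree members.\<close>
      proof (cases "\<delta> P \<le> d")
        case True
        have "sign_determined ?W (insert P \<Phi> \<union> E)"
        proof (rule insert.IH)
          show "finite (insert P \<Phi>)" using insert.prems(1) by simp
          show "\<forall>Q\<in>insert P \<Phi> \<union> E. poly_family Q" using insert.prems(2) by blast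
          have "degree (P x) \<le> d" if "x \<in> ?W" for x using that True by simp
          then show "\<forall>Q\<in>insert P \<Phi>. \<forall>x\<in>?W. degree (Q x) \<le> d" using insert.prems(3) by blast
          show "\<forall>Q\<in>E. \<forall>x\<in>?W. degree (Q x) \<le> Suc d" using insert.prems(4) by blast
        qed
        then show ?thesis by simp
      next
        case False
        show ?thesis
        \<comment> \<open>The pattern \<open>\<delta>\<close> is arbitrary; a nonempty stratum is
          what forces \<open>\<delta> P = Suc d\<close>.\<close>
        proof (cases "?W = {}")
          case True
          show ?thesis unfolding True sign_determined_def by (intro exI[of _ "{}"]) simp
        next
          case ne: False
          then obtain z where "z \<in> ?W" by blast
          then have "degree (P z) = \<delta> P" "degree (P z) \<le> Suc d" using insert.prems(4) by auto
          then have dP: "\<delta> P = Suc d" using False by auto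
          define R where "R = (\<lambda>Q x. smult (coeff (Q x) (\<delta> Q)) (P x) -
            smult (coeff (P x) (\<delta> P)) (monom 1 (\<delta> P - \<delta> Q) * Q x))"
          have le: "degree (Q x) \<le> Suc d" if Q0: "Q \<in> insert P ?A" "x \<in> ?W" for Q x
          proof -
            have xW: "x \<in> W" "degree (P x) \<le> Suc d" using Q0(2) insert.prems(4) by auto
            consider "Q = P" | "Q = ?P'" | "Q \<in> \<Phi>" | "Q \<in> E" using Q0(1) by blast
            then show ?thesis
              by cases (use xW insert.prems(3,4) in \<open>auto simp: degree_pderiv intro: le_SucI\<close>)
          qed
          have degR: "degree (R Q x) \<le> d" if Q: "Q \<in> ?A" and x: "x \<in> ?W" for Q x
          proof -
            have q: "degree (Q x) = \<delta> Q" "degree (P x) = Suc d" using x Q dP by auto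
            have ql: "\<delta> Q \<le> Suc d" using le[of Q x] Q x q by auto
            have "degree (monom 1 (\<delta> P - \<delta> Q) * Q x) \<le> (Suc d - \<delta> Q) + \<delta> Q"
              by (rule order_trans[OF degree_mult_le]) (use q dP degree_monom_le[of "1::real" "Suc d - \<delta> Q"] in auto)
            then have l: "degree (R Q x) \<le> Suc d"
              unfolding R_def using ql q by (intro degree_diff_le order_trans[OF degree_smult_le]) auto
            \<comment> \<open>The monomial lifts the leading term of \<open>Q x\<close> to degree
              \<open>Suc d\<close>, where the cross-multiplied leading coefficients cancel.\<close>
            have "coeff (R Q x) (Suc d) = 0"
              using ql dP by (simp add: coeff_monom_mult R_def)
            then show ?thesis using l
              by (metis degree_0 le_Suc_eq leading_coeff_0_iff zero_le)
          qed
          have famP': "poly_family ?P'" using insert.prems by (intro poly_family_pderiv) auto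
          have famR: "poly_family (R Q)" if "Q \<in> ?A" for Q
          proof -
            have f: "poly_family Q" "poly_family P" using that insert.prems famP' by auto
            then have c: "real_polynomial_function (\<lambda>x. coeff (Q x) (\<delta> Q))"
              "real_polynomial_function (\<lambda>x. - coeff (P x) (\<delta> P))" by (auto simp: poly_family_def)
            have "poly_family (\<lambda>x. smult (coeff (Q x) (\<delta> Q)) (P x) +
               smult (- coeff (P x) (\<delta> P)) (monom 1 (\<delta> P - \<delta> Q) * Q x))"
              by (intro poly_family_add poly_family_smult poly_family_monom_mult c f)
            then show ?thesis by (simp add: R_def)
          qed
          have dP': "degree (?P' x) \<le> d" if "x \<in> ?W" for x
            using that dP by (simp add: degree_pderiv)
          have "sign_determined ?W (({?P'} \<union> \<Phi> \<union> R ` ?A) \<union> E)"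
          proof (rule insert.IH)
            show "finite ({?P'} \<union> \<Phi> \<union> R ` ?A)" using insert.prems insert.hyps by simp
            show "\<forall>Q\<in>({?P'} \<union> \<Phi> \<union> R ` ?A) \<union> E. poly_family Q"
              using insert.prems(2) famR famP' by blast
            show "\<forall>Q\<in>{?P'} \<union> \<Phi> \<union> R ` ?A. \<forall>x\<in>?W. degree (Q x) \<le> d"
              using insert.prems(3) degR dP' by blast
            show "\<forall>Q\<in>E. \<forall>x\<in>?W. degree (Q x) \<le> Suc d"
              using insert.prems(4) by blast
          qed
          then have "sign_determined ?W (?A \<union> R ` ?A)"
            by (rule sign_determined_mono) auto
          then have "sign_determined ?W (insert P ?A)"
            unfolding R_def
          proof (intro sign_determined_insert[where \<delta>=\<delta> and d=d])
            show "poly_family Q" if "Q \<in> insert P ?A" for Q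
              using that insert.prems(2) famP' by blast
          qed (use insert.prems(1) insert.hyps(1) dP in auto)
          then show ?thesis by (rule sign_determined_mono) auto
        qed
      qed
    qed (use insert.prems insert.hyps poly_family_pderiv in auto)
  qed
  from this[of \<Phi> "{}" W] show ?case using Suc.prems by auto
qed

theorem sign_determined_finite:
  fixes \<Phi> :: "('a::euclidean_space \<Rightarrow> real poly) set"
  assumes "finite \<Phi>" "\<forall>P\<in>\<Phi>. poly_family P"
  shows "sign_determined UNIV \<Phi>"
  using sign_determined_bounded[OF assms] poly_family_degree_bound[OF assms] by metis

section \<open>Semi-algebraic sets and maps\<close>

text \<open>Finitely many polynomials have finitely many sign vectors, each of which defines a basic
  set. Saturation under equality of sign vectors is symmetric under complement, and it is the form
  in which the elimination delivers its result.\<close>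

lemma semialgebraic_iff_sign:
  fixes S :: "'a::euclidean_space set"
  shows "semialgebraic S \<longleftrightarrow> (\<exists>H. finite H \<and> (\<forall>h\<in>H. real_polynomial_function h) \<and>
    (\<forall>x y. (\<forall>h\<in>H. sgn (h x) = sgn (h y)) \<longrightarrow> x \<in> S \<longrightarrow> y \<in> S))" (is "_ = ?R")
proof
  assume "semialgebraic S"
  then obtain \<C> where C: "finite \<C>" "\<forall>T\<in>\<C>. basic_semialgebraic T" "S = \<Union>\<C>"
    by (auto simp: semialgebraic_def)
  have "\<forall>T\<in>\<C>. \<exists>H. finite H \<and> (\<forall>h\<in>H. real_polynomial_function h) \<and>
    (\<forall>x y. (\<forall>h\<in>H. sgn (h x) = sgn (h y)) \<longrightarrow> x \<in> T \<longrightarrow> y \<in> T)"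
  proof
    fix T assume "T \<in> \<C>"
    then obtain F G where FG: "finite F" "finite G" "\<forall>f\<in>F. real_polynomial_function f"
      "\<forall>g\<in>G. real_polynomial_function g" "T = {x. (\<forall>f\<in>F. f x = 0) \<and> (\<forall>g\<in>G. g x < 0)}"
      using C(2) by (force simp: basic_semialgebraic_def)
    have "y \<in> T" if s: "\<forall>h\<in>F \<union> G. sgn (h x) = sgn (h y)" and x: "x \<in> T" for x y
    proof -
      have "f y = 0" if "f \<in> F" for f
      proof -
        have "f x = 0" "sgn (f x) = sgn (f y)" using that x FG(5) s by auto
        then show ?thesis by (metis sgn_0 sgn_zero_iff)
      qed
      moreover have "g y < 0" if "g \<in> G" for g
      proof -
        have "g x < 0" using that x FG(5) by blast
        moreover have "sgn (g x) = sgn (g y)" using that s by blast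
        ultimately have "sgn (g y) = -1" by simp
        then show ?thesis by (simp add: sgn_1_neg)
      qed
      ultimately show ?thesis using FG(5) by simp
    qed
    then show "\<exists>H. finite H \<and> (\<forall>h\<in>H. real_polynomial_function h) \<and>
      (\<forall>x y. (\<forall>h\<in>H. sgn (h x) = sgn (h y)) \<longrightarrow> x \<in> T \<longrightarrow> y \<in> T)"
      using FG by (intro exI[of _ "F \<union> G"]) blast
  qed
  then have "\<exists>H. \<forall>T\<in>\<C>. finite (H T) \<and> (\<forall>h\<in>H T. real_polynomial_function h) \<and>
    (\<forall>x y. (\<forall>h\<in>H T. sgn (h x) = sgn (h y)) \<longrightarrow> x \<in> T \<longrightarrow> y \<in> T)" by (rule bchoice)
  then obtain H where H: "\<forall>T\<in>\<C>. finite (H T) \<and> (\<forall>h\<in>H T. real_polynomial_function h) \<and>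
    (\<forall>x y. (\<forall>h\<in>H T. sgn (h x) = sgn (h y)) \<longrightarrow> x \<in> T \<longrightarrow> y \<in> T)" by blast
  have HT: "y \<in> T" if "T \<in> \<C>" "\<forall>h\<in>H T. sgn (h x) = sgn (h y)" "x \<in> T" for T x y
    using bspec[OF H that(1)] that(2,3) by simp
  show ?R
  proof (intro exI[of _ "\<Union>T\<in>\<C>. H T"] conjI allI impI)
    fix x y assume s: "\<forall>h\<in>\<Union>T\<in>\<C>. H T. sgn (h x) = sgn (h y)" and "x \<in> S"
    then obtain T where T: "T \<in> \<C>" "x \<in> T" using C(3) by blast
    have "\<forall>h\<in>H T. sgn (h x) = sgn (h y)" using s T(1) by simp
    then show "y \<in> S" unfolding C(3) using HT[OF T(1) _ T(2)] T(1) by blast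
  qed (use H C in auto)
next
  assume ?R
  then obtain H where H: "finite H" "\<forall>h\<in>H. real_polynomial_function h"
    "\<And>x y. (\<forall>h\<in>H. sgn (h x) = sgn (h y)) \<Longrightarrow> x \<in> S \<Longrightarrow> y \<in> S" by blast
  define cls where "cls \<sigma> = {x. \<forall>h\<in>H. sgn (h x) = \<sigma> h}" for \<sigma> :: "('a \<Rightarrow> real) \<Rightarrow> real"
  define \<Sigma> where "\<Sigma> = {\<sigma> \<in> PiE H (\<lambda>_. {-1, 0, 1}). cls \<sigma> \<subseteq> S}"
  have fin: "finite \<Sigma>" using H(1) by (auto simp: \<Sigma>_def intro: finite_PiE finite_subset)
  have basic: "basic_semialgebraic (cls \<sigma>)" if s: "\<sigma> \<in> \<Sigma>" for \<sigma>
  proof -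
    \<comment> \<open>Basic sets admit only equations and negativity conditions, so a positive sign
      is expressed through \<open>- h\<close>.\<close>
    let ?F = "{h\<in>H. \<sigma> h = 0}" and ?G = "{h\<in>H. \<sigma> h = -1} \<union> (\<lambda>h x. - h x) ` {h\<in>H. \<sigma> h = 1}"
    have \<sigma>: "\<sigma> h = -1 \<or> \<sigma> h = 0 \<or> \<sigma> h = 1" if "h \<in> H" for h using s that by (auto simp: \<Sigma>_def)
    have "(\<forall>h\<in>H. sgn (h x) = \<sigma> h) \<longleftrightarrow> (\<forall>f\<in>?F. f x = 0) \<and> (\<forall>g\<in>?G. g x < 0)" for x
    proof
      assume "\<forall>h\<in>H. sgn (h x) = \<sigma> h"
      then show "(\<forall>f\<in>?F. f x = 0) \<and> (\<forall>g\<in>?G. g x < 0)"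
        by (auto simp: sgn_real_def split: if_splits)
    next
      assume r: "(\<forall>f\<in>?F. f x = 0) \<and> (\<forall>g\<in>?G. g x < 0)"
      show "\<forall>h\<in>H. sgn (h x) = \<sigma> h"
      proof
        fix h assume h: "h \<in> H"
        have "h x < 0" if "\<sigma> h = -1" using r h that by blast
        moreover have "- h x < 0" if "\<sigma> h = 1"
        proof -
          have "(\<lambda>x. - h x) \<in> ?G" using h that by blast
          from bspec[OF conjunct2[OF r] this] show ?thesis .
        qed
        moreover have "h x = 0" if "\<sigma> h = 0" using r h that by blast
        ultimately show "sgn (h x) = \<sigma> h" using \<sigma>[OF h] by auto
      qed
    qed
    then have "cls \<sigma> = {x. (\<forall>f\<in>?F. f x = 0) \<and> (\<forall>g\<in>?G. g x < 0)}" by (simp add: cls_def)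
    moreover have "finite ?F" "finite ?G" using H(1) by auto
    moreover have "\<forall>f\<in>?F. real_polynomial_function f" "\<forall>f\<in>?G. real_polynomial_function f" using H(2) by auto
    ultimately show ?thesis unfolding basic_semialgebraic_def by blast
  qed
  have "S = \<Union>(cls ` \<Sigma>)"
  proof
    show "S \<subseteq> \<Union>(cls ` \<Sigma>)"
    proof
      fix x assume x: "x \<in> S"
      let ?s = "restrict (\<lambda>h. sgn (h x)) H"
      have "x \<in> cls ?s" by (simp add: cls_def)
      moreover have "cls ?s \<subseteq> S" using H(3)[OF _ x] by (auto simp: cls_def)
      then have "?s \<in> \<Sigma>" by (auto simp: \<Sigma>_def sgn_real_def)
      ultimately show "x \<in> \<Union>(cls ` \<Sigma>)" by blast
    qed
  qed (auto simp: \<Sigma>_def)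
  then show "semialgebraic S"
    unfolding semialgebraic_def using fin basic by (intro exI[of _ "cls ` \<Sigma>"]) blast
qed

section \<open>Boolean operations and elementary semi-algebraic sets\<close>

lemma semialgebraic_Compl: "semialgebraic S \<Longrightarrow> semialgebraic (- S)"
  unfolding semialgebraic_iff_sign by (metis ComplI ComplD)

lemma semialgebraic_Un:
  assumes "semialgebraic S" "semialgebraic T" shows "semialgebraic (S \<union> T)"
proof -
  obtain A B where "finite A" "finite B" "\<forall>T\<in>A. basic_semialgebraic T" "\<forall>T\<in>B. basic_semialgebraic T"
    "S = \<Union>A" "T = \<Union>B" using assms by (auto simp: semialgebraic_def)
  then show ?thesis unfolding semialgebraic_def by (intro exI[of _ "A \<union> B"]) auto
qed

lemma semialgebraic_Int: "semialgebraic S \<Longrightarrow> semialgebraic T \<Longrightarrow> semialgebraic (S \<inter> T)"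
  using semialgebraic_Compl[OF semialgebraic_Un[OF semialgebraic_Compl semialgebraic_Compl], of S T]
  by (simp add: Compl_Un)

lemma semialgebraic_Collect_conj:
  "semialgebraic {x. P x} \<Longrightarrow> semialgebraic {x. Q x} \<Longrightarrow> semialgebraic {x. P x \<and> Q x}"
  by (simp add: Collect_conj_eq semialgebraic_Int)

lemma semialgebraic_UNIV: "semialgebraic UNIV"
  unfolding semialgebraic_iff_sign by auto

lemma semialgebraic_sgn: "real_polynomial_function f \<Longrightarrow> semialgebraic {x. sgn (f x) \<in> A}"
  unfolding semialgebraic_iff_sign by (intro exI[of _ "{f}"]) auto

lemma semialgebraic_eq0: "real_polynomial_function f \<Longrightarrow> semialgebraic {x. f x = 0}"
  using semialgebraic_sgn[of f "{0}"] by (simp add: sgn_zero_iff)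

lemma semialgebraic_gt0: "real_polynomial_function f \<Longrightarrow> semialgebraic {x. 0 < f x}"
  using semialgebraic_sgn[of f "{1}"] by (simp add: sgn_1_pos)

lemma semialgebraic_ge0: "real_polynomial_function f \<Longrightarrow> semialgebraic {x. 0 \<le> f x}"
  using semialgebraic_Compl[OF semialgebraic_gt0[of "\<lambda>x. - f x"]] by (simp add: Compl_eq not_less real_polynomial_function_minus)

lemma semialgebraic_Collect_ball:
  assumes "finite I" "\<And>i. i \<in> I \<Longrightarrow> semialgebraic {x. P i x}"
  shows "semialgebraic {x. \<forall>i\<in>I. P i x}"
  using assms
proof (induction I rule: finite_induct)
  case empty
  then show ?case by (simp add: semialgebraic_UNIV)
next
  case (insert i I)
  then show ?case by (simp add: semialgebraic_Collect_conj)
qed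

lemma semialgebraic_vimage:
  fixes p :: "'a::euclidean_space \<Rightarrow> 'b::euclidean_space"
  assumes S: "semialgebraic S" and p: "polynomial_function p" shows "semialgebraic {x. p x \<in> S}"
proof -
  obtain H where H: "finite H" "\<forall>h\<in>H. real_polynomial_function h"
    "\<And>x y. (\<forall>h\<in>H. sgn (h x) = sgn (h y)) \<Longrightarrow> x \<in> S \<Longrightarrow> y \<in> S"
    using S unfolding semialgebraic_iff_sign by blast
  show ?thesis unfolding semialgebraic_iff_sign
  proof (intro exI[of _ "(\<lambda>h. h \<circ> p) ` H"] conjI allI impI ballI)
    fix x y assume "\<forall>h\<in>(\<lambda>h. h \<circ> p) ` H. sgn (h x) = sgn (h y)" "x \<in> {x. p x \<in> S}"
    then show "y \<in> {x. p x \<in> S}" using H(3)[of "p x" "p y"] by simp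
  qed (use H p real_polynomial_function_compose in auto)
qed

lemma semialgebraic_singleton: "semialgebraic {a :: 'a::euclidean_space}"
proof -
  have "semialgebraic {x. \<forall>b\<in>Basis. (x - a) \<bullet> b = 0}"
    by (intro semialgebraic_Collect_ball semialgebraic_eq0)
      (simp_all only: finite_Basis inner_diff_left real_polynomial_function_diff[OF
         real_polynomial_function.intros(1)[OF bounded_linear_inner_left] real_polynomial_function.intros(2)])
  also have "{x. \<forall>b\<in>Basis. (x - a) \<bullet> b = 0} = {a}"
    unfolding euclidean_all_zero_iff by auto
  finally show ?thesis .
qed

text \<open>The elimination result, translated from polynomial families to restrictions to parallel
  lines. It serves both the projection theorem and the cylindrical decomposition.\<close>

lemma fibre_equiv_determined:
  fixes F :: "('a::euclidean_space \<Rightarrow> real) set"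
  assumes "finite F" "\<forall>f\<in>F. real_polynomial_function f"
  obtains K where "finite K" "\<forall>h\<in>K. real_polynomial_function h"
    "\<And>x y. \<forall>h\<in>K. sgn (h x) = sgn (h y) \<Longrightarrow> \<exists>\<theta>. strict_mono \<theta> \<and> surj \<theta> \<and>
      (\<forall>f\<in>F. \<forall>t. sgn (f (x + t *\<^sub>R b)) = sgn (f (y + \<theta> t *\<^sub>R b)))"
proof -
  have "\<forall>f\<in>F. \<exists>P. poly_family P \<and> (\<forall>x t. f (x + t *\<^sub>R b) = poly (P x) t)"
    using poly_family_along assms(2) by blast
  then have "\<exists>P. \<forall>f\<in>F. poly_family (P f) \<and> (\<forall>x t. f (x + t *\<^sub>R b) = poly (P f x) t)" by (rule bchoice)
  then obtain P where P: "\<forall>f\<in>F. poly_family (P f) \<and> (\<forall>x t. f (x + t *\<^sub>R b) = poly (P f x) t)" by blast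
  define \<Phi> where "\<Phi> = P ` F"
  have "sign_determined UNIV \<Phi>" using P assms(1) by (intro sign_determined_finite) (auto simp: \<Phi>_def)
  then obtain K where K: "finite K" "\<forall>h\<in>K. real_polynomial_function h"
    "\<And>x y. \<forall>h\<in>K. sgn (h x) = sgn (h y) \<Longrightarrow> sign_equiv \<Phi> x y"
    by (auto simp: sign_determined_def)
  show ?thesis
  proof (rule that[OF K(1,2)])
    fix x y assume "\<forall>h\<in>K. sgn (h x) = sgn (h y)"
    then obtain \<theta> where \<theta>: "strict_mono \<theta>" "surj \<theta>" "\<forall>Q\<in>\<Phi>. \<forall>t. sgn (poly (Q x) t) = sgn (poly (Q y) (\<theta> t))"
      using K(3) unfolding sign_equiv_def by blast
    have "sgn (f (x + t *\<^sub>R b)) = sgn (f (y + \<theta> t *\<^sub>R b))" if "f \<in> F" for f t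
      using \<theta>(3) P that by (simp add: \<Phi>_def)
    then show "\<exists>\<theta>. strict_mono \<theta> \<and> surj \<theta> \<and>
      (\<forall>f\<in>F. \<forall>t. sgn (f (x + t *\<^sub>R b)) = sgn (f (y + \<theta> t *\<^sub>R b)))" using \<theta>(1,2) by blast
  qed
qed

text \<open>Projection in the form of saturation along \<open>b\<close>, which stays in the same
  space. If the fibre of \<open>x\<close> meets \<open>S\<close> at height \<open>t\<close>, a fibre
  with the same sign diagram meets it at height \<open>\<theta> t\<close>.\<close>

lemma semialgebraic_proj_direction:
  fixes S :: "'a::euclidean_space set"
  assumes "semialgebraic S" shows "semialgebraic {x. \<exists>t. x + t *\<^sub>R b \<in> S}"
proof -
  obtain H where H: "finite H" "\<forall>h\<in>H. real_polynomial_function h"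
    "\<And>x y. (\<forall>h\<in>H. sgn (h x) = sgn (h y)) \<Longrightarrow> x \<in> S \<Longrightarrow> y \<in> S"
    using assms unfolding semialgebraic_iff_sign by blast
  obtain K where K: "finite K" "\<forall>h\<in>K. real_polynomial_function h"
    "\<And>x y. \<forall>h\<in>K. sgn (h x) = sgn (h y) \<Longrightarrow> \<exists>\<theta>. strict_mono \<theta> \<and> surj \<theta> \<and>
      (\<forall>f\<in>H. \<forall>t. sgn (f (x + t *\<^sub>R b)) = sgn (f (y + \<theta> t *\<^sub>R b)))"
    using fibre_equiv_determined[OF H(1,2), of b] by metis
  show ?thesis unfolding semialgebraic_iff_sign
  proof (intro exI[of _ K] conjI K allI impI)
    fix x y assume s: "\<forall>h\<in>K. sgn (h x) = sgn (h y)" and "x \<in> {x. \<exists>t. x + t *\<^sub>R b \<in> S}"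
    then obtain t where t: "x + t *\<^sub>R b \<in> S" by blast
    obtain \<theta> where "\<forall>f\<in>H. \<forall>t. sgn (f (x + t *\<^sub>R b)) = sgn (f (y + \<theta> t *\<^sub>R b))"
      using K(3)[OF s] by blast
    then have "y + \<theta> t *\<^sub>R b \<in> S" by (intro H(3)[OF _ t]) simp
    then show "y \<in> {x. \<exists>t. x + t *\<^sub>R b \<in> S}" by blast
  qed
qed

lemma semialgebraic_proj_span:
  fixes S :: "'a::euclidean_space set"
  assumes S: "semialgebraic S" and V: "V \<subseteq> Basis"
  shows "semialgebraic {x. \<exists>w. (\<forall>b\<in>Basis - V. w \<bullet> b = 0) \<and> x + w \<in> S}"
proof -
  have "finite V" using V finite_Basis finite_subset by blast
  then show ?thesis using V
  proof (induction V rule: finite_induct)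
    case empty
    have "{x. \<exists>w. (\<forall>b\<in>Basis - {}. w \<bullet> b = 0) \<and> x + w \<in> S} = S"
      by (auto simp: euclidean_all_zero_iff)
    then show ?case using S by simp
  next
    case (insert c V)
    let ?T = "{x. \<exists>w. (\<forall>b\<in>Basis - V. w \<bullet> b = 0) \<and> x + w \<in> S}"
    have "{x. \<exists>w. (\<forall>b\<in>Basis - insert c V. w \<bullet> b = 0) \<and> x + w \<in> S} = {x. \<exists>t. x + t *\<^sub>R c \<in> ?T}"
    proof (intro equalityI subsetI)
      fix x assume "x \<in> {x. \<exists>w. (\<forall>b\<in>Basis - insert c V. w \<bullet> b = 0) \<and> x + w \<in> S}"
      then obtain w where w: "\<forall>b\<in>Basis - insert c V. w \<bullet> b = 0" "x + w \<in> S" by blast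
      have "(w - (w \<bullet> c) *\<^sub>R c) \<bullet> b = 0" if "b \<in> Basis - V" for b
        using w(1) insert.prems that by (cases "b = c") (auto simp: inner_diff_left inner_Basis)
      then have "x + (w \<bullet> c) *\<^sub>R c \<in> ?T" using w(2) by (intro CollectI exI[of _ "w - (w \<bullet> c) *\<^sub>R c"]) simp
      then show "x \<in> {x. \<exists>t. x + t *\<^sub>R c \<in> ?T}" by blast
    next
      fix x assume "x \<in> {x. \<exists>t. x + t *\<^sub>R c \<in> ?T}"
      then obtain t w where w: "\<forall>b\<in>Basis - V. w \<bullet> b = 0" "x + t *\<^sub>R c + w \<in> S" by blast
      have "\<forall>b\<in>Basis - insert c V. (t *\<^sub>R c + w) \<bullet> b = 0"
        using w(1) insert.prems by (auto simp: inner_add_left inner_Basis)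
      then show "x \<in> {x. \<exists>w. (\<forall>b\<in>Basis - insert c V. w \<bullet> b = 0) \<and> x + w \<in> S}"
        using w(2) by (auto simp: add.assoc intro!: exI[of _ "t *\<^sub>R c + w"])
    qed
    then show ?case using semialgebraic_proj_direction[OF insert.IH] insert.prems by simp
  qed
qed

text \<open>Saturate along all basis directions of the second factor, then restrict to the slice
  where the second component is \<open>0\<close>.\<close>

theorem tarski_seidenberg:
  fixes S :: "('a::euclidean_space \<times> 'b::euclidean_space) set"
  assumes "semialgebraic S" shows "semialgebraic {x. \<exists>y. (x, y) \<in> S}"
proof -
  let ?V = "Pair 0 ` Basis :: ('a \<times> 'b) set"
  have "semialgebraic {x. \<exists>w. (\<forall>b\<in>Basis - ?V. w \<bullet> b = 0) \<and> x + w \<in> S}"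
    by (rule semialgebraic_proj_span[OF assms]) (auto simp: Basis_prod_def)
  moreover have "polynomial_function (\<lambda>x :: 'a. (x, 0 :: 'b))"
    by (intro polynomial_function_bounded_linear bounded_linear_Pair bounded_linear_ident bounded_linear_zero)
  ultimately have "semialgebraic {x. (x, 0) \<in> {x. \<exists>w. (\<forall>b\<in>Basis - ?V. w \<bullet> b = 0) \<and> x + w \<in> S}}"
    by (intro semialgebraic_vimage)
  moreover have "(\<exists>w. (\<forall>b\<in>Basis - ?V. w \<bullet> b = 0) \<and> (x, 0) + w \<in> S) \<longleftrightarrow> (\<exists>y. (x, y) \<in> S)" for x
  proof
    assume "\<exists>w. (\<forall>b\<in>Basis - ?V. w \<bullet> b = 0) \<and> (x, 0) + w \<in> S"
    then obtain u v where w: "\<forall>b\<in>Basis - ?V. (u, v) \<bullet> b = 0" "(x + u, v) \<in> S" by fastforce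
    have "u \<bullet> b = 0" if "b \<in> Basis" for b
      using bspec[OF w(1), of "(b, 0)"] that nonzero_Basis by (force simp: Basis_prod_def)
    then have "u = 0" using euclidean_all_zero_iff by blast
    then show "\<exists>y. (x, y) \<in> S" using w(2) by auto
  next
    assume "\<exists>y. (x, y) \<in> S"
    then obtain y where "(x, y) \<in> S" by blast
    then show "\<exists>w. (\<forall>b\<in>Basis - ?V. w \<bullet> b = 0) \<and> (x, 0) + w \<in> S"
      by (intro exI[of _ "(0, y)"]) (auto simp: Basis_prod_def)
  qed
  ultimately show ?thesis by simp
qed

section \<open>Closure properties of semi-algebraic maps\<close>

lemma polynomial_function_Pair:
  fixes f :: "'a::real_normed_vector \<Rightarrow> 'b::euclidean_space" and g :: "'a \<Rightarrow> 'c::euclidean_space"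
  assumes "polynomial_function f" "polynomial_function g"
  shows "polynomial_function (\<lambda>x. (f x, g x))"
proof -
  have "polynomial_function (\<lambda>x. (f x, 0 :: 'c) + (0 :: 'b, g x))"
    using polynomial_function_compose[OF assms(1) polynomial_function_bounded_linear[of "\<lambda>y. (y, 0 :: 'c)"]]
      polynomial_function_compose[OF assms(2) polynomial_function_bounded_linear[of "\<lambda>y. (0 :: 'b, y)"]]
    by (intro polynomial_function_add)
      (simp_all add: o_def bounded_linear_Pair bounded_linear_ident bounded_linear_zero)
  then show ?thesis by simp
qed

lemma polynomial_function_fst: "polynomial_function (fst :: 'a::euclidean_space \<times> 'b::euclidean_space \<Rightarrow> 'a)"
  by (rule polynomial_function_bounded_linear[OF bounded_linear_fst])

lemma polynomial_function_snd: "polynomial_function (snd :: 'a::euclidean_space \<times> 'b::euclidean_space \<Rightarrow> 'b)"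
  by (rule polynomial_function_bounded_linear[OF bounded_linear_snd])

lemma polynomial_function_fst': "polynomial_function p \<Longrightarrow> polynomial_function (\<lambda>x. fst (p x))"
  for p :: "'a::real_normed_vector \<Rightarrow> 'b::euclidean_space \<times> 'c::euclidean_space"
  using polynomial_function_compose[OF _ polynomial_function_fst] by (simp add: o_def)

lemma polynomial_function_snd': "polynomial_function p \<Longrightarrow> polynomial_function (\<lambda>x. snd (p x))"
  for p :: "'a::real_normed_vector \<Rightarrow> 'b::euclidean_space \<times> 'c::euclidean_space"
  using polynomial_function_compose[OF _ polynomial_function_snd] by (simp add: o_def)

lemmas polynomial_intros = polynomial_function_Pair polynomial_function_fst polynomial_function_snd
  polynomial_function_fst' polynomial_function_snd' polynomial_function_id polynomial_function_const
  polynomial_function_add polynomial_function_diff polynomial_function_mult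

lemma semialgebraic_Collect_eq:
  fixes p q :: "'a::euclidean_space \<Rightarrow> 'b::euclidean_space"
  assumes "polynomial_function p" "polynomial_function q"
  shows "semialgebraic {x. p x = q x}"
  using semialgebraic_vimage[OF semialgebraic_singleton[of 0] polynomial_function_diff[OF assms]] by simp

lemma semialgebraic_map_onI:
  "semialgebraic {z. fst z \<in> S \<and> snd z = f (fst z)} \<Longrightarrow> semialgebraic_map_on f S"
  unfolding semialgebraic_map_on_def by (simp only: case_prod_beta')

lemma semialgebraic_map_onD:
  "semialgebraic_map_on f S \<Longrightarrow> semialgebraic {z. fst z \<in> S \<and> snd z = f (fst z)}"
  unfolding semialgebraic_map_on_def by (simp only: case_prod_beta')

lemma semialgebraic_map_graph_vimage:
  assumes "semialgebraic_map_on f S" "polynomial_function p" "polynomial_function q"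
  shows "semialgebraic {x. p x \<in> S \<and> q x = f (p x)}"
  using semialgebraic_vimage[OF semialgebraic_map_onD[OF assms(1)] polynomial_function_Pair[OF assms(2,3)]]
  by simp

lemma semialgebraic_map_on_cong:
  "semialgebraic_map_on f S \<Longrightarrow> (\<And>x. x \<in> S \<Longrightarrow> f x = g x) \<Longrightarrow> semialgebraic_map_on g S"
  using semialgebraic_map_onD[of f S] by (intro semialgebraic_map_onI) (simp cong: conj_cong)

lemma semialgebraic_map_on_poly:
  assumes "semialgebraic S" "polynomial_function p"
  shows "semialgebraic_map_on p S"
  by (intro semialgebraic_map_onI semialgebraic_Collect_conj semialgebraic_vimage[OF assms(1)]
      semialgebraic_Collect_eq polynomial_intros
      polynomial_function_compose[OF polynomial_function_fst assms(2), unfolded o_def])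

lemma semialgebraic_map_on_compose:
  fixes f :: "'a::euclidean_space \<Rightarrow> 'b::euclidean_space" and g :: "'b \<Rightarrow> 'c::euclidean_space"
  assumes f: "semialgebraic_map_on f S" and g: "semialgebraic_map_on g T" and sub: "f ` S \<subseteq> T"
  shows "semialgebraic_map_on (\<lambda>x. g (f x)) S"
proof (rule semialgebraic_map_onI)
  \<comment> \<open>The intermediate value \<open>f x\<close> becomes an extra variable, placed last
    so that it is the one projected away.\<close>
  have "semialgebraic {w :: ('a \<times> 'c) \<times> 'b. (fst (fst w) \<in> S \<and> snd w = f (fst (fst w))) \<and>
      (snd w \<in> T \<and> snd (fst w) = g (snd w))}"
    by (intro semialgebraic_Collect_conj semialgebraic_map_graph_vimage f g
        polynomial_intros)
  from tarski_seidenberg[OF this]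
  have "semialgebraic {z. fst z \<in> S \<and> f (fst z) \<in> T \<and> snd z = g (f (fst z))}" by simp
  also have "{z. fst z \<in> S \<and> f (fst z) \<in> T \<and> snd z = g (f (fst z))} = {z. fst z \<in> S \<and> snd z = g (f (fst z))}"
    using sub by auto
  finally show "semialgebraic {z. fst z \<in> S \<and> snd z = g (f (fst z))}" .
qed

lemma semialgebraic_map_on_Pair:
  fixes f :: "'a::euclidean_space \<Rightarrow> 'b::euclidean_space" and g :: "'a \<Rightarrow> 'c::euclidean_space"
  assumes f: "semialgebraic_map_on f S" and g: "semialgebraic_map_on g S"
  shows "semialgebraic_map_on (\<lambda>x. (f x, g x)) S"
proof (rule semialgebraic_map_onI)
  have "semialgebraic {z :: 'a \<times> 'b \<times> 'c. (fst z \<in> S \<and> fst (snd z) = f (fst z)) \<and> (fst z \<in> S \<and> snd (snd z) = g (fst z))}"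
    by (intro semialgebraic_Collect_conj semialgebraic_map_graph_vimage f g polynomial_intros)
  also have "\<dots> = {z. fst z \<in> S \<and> snd z = (f (fst z), g (fst z))}" by (auto simp: prod_eq_iff)
  finally show "semialgebraic {z. fst z \<in> S \<and> snd z = (f (fst z), g (fst z))}" .
qed

lemma semialgebraic_map_on_poly_compose:
  assumes "semialgebraic_map_on f S" "polynomial_function p"
  shows "semialgebraic_map_on (\<lambda>x. p (f x)) S"
  by (rule semialgebraic_map_on_compose[OF assms(1) semialgebraic_map_on_poly[OF semialgebraic_UNIV assms(2)]]) simp

lemma semialgebraic_map_on_add:
  assumes "semialgebraic_map_on f S" "semialgebraic_map_on g S"
  shows "semialgebraic_map_on (\<lambda>x. f x + g x) S"
  using semialgebraic_map_on_poly_compose[OF semialgebraic_map_on_Pair[OF assms], of "\<lambda>z. fst z + snd z"]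
  by (simp add: polynomial_intros)

lemma semialgebraic_map_on_diff:
  assumes "semialgebraic_map_on f S" "semialgebraic_map_on g S"
  shows "semialgebraic_map_on (\<lambda>x. f x - g x) S"
  using semialgebraic_map_on_poly_compose[OF semialgebraic_map_on_Pair[OF assms], of "\<lambda>z. fst z - snd z"]
  by (simp add: polynomial_intros)

lemma semialgebraic_map_on_scaleR:
  assumes "semialgebraic_map_on f S" "semialgebraic_map_on g S"
  shows "semialgebraic_map_on (\<lambda>x. f x *\<^sub>R g x) S"
  using semialgebraic_map_on_poly_compose[OF semialgebraic_map_on_Pair[OF assms], of "\<lambda>z. fst z *\<^sub>R snd z"]
  by (simp add: polynomial_intros)

lemma semialgebraic_map_on_mult:
  fixes f g :: "'a::euclidean_space \<Rightarrow> real"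
  assumes "semialgebraic_map_on f S" "semialgebraic_map_on g S"
  shows "semialgebraic_map_on (\<lambda>x. f x * g x) S"
  using semialgebraic_map_on_scaleR[OF assms] by simp

lemma semialgebraic_map_on_const: "semialgebraic S \<Longrightarrow> semialgebraic_map_on (\<lambda>x. c) S"
  by (intro semialgebraic_map_on_poly polynomial_intros)

lemma semialgebraic_map_on_linear: "semialgebraic S \<Longrightarrow> bounded_linear f \<Longrightarrow> semialgebraic_map_on f S"
  by (intro semialgebraic_map_on_poly polynomial_function_bounded_linear)

lemma semialgebraic_map_on_divide:
  fixes f g :: "'a::euclidean_space \<Rightarrow> real"
  assumes f: "semialgebraic_map_on f S" and g: "semialgebraic_map_on g S" and nz: "\<And>x. x \<in> S \<Longrightarrow> g x \<noteq> 0"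
  shows "semialgebraic_map_on (\<lambda>x. f x / g x) S"
proof (rule semialgebraic_map_onI)
  \<comment> \<open>The values of \<open>f\<close> and \<open>g\<close> become extra variables;
    clearing the denominator gives a polynomial equation between them and the quotient.\<close>
  have 1: "semialgebraic {w :: ('a \<times> real) \<times> real \<times> real. fst (fst w) \<in> S \<and> snd w = (f (fst (fst w)), g (fst (fst w)))}"
    by (rule semialgebraic_map_graph_vimage[where f="\<lambda>x. (f x, g x)"])
      (intro semialgebraic_map_on_Pair f g polynomial_intros)+
  have "polynomial_function (\<lambda>w :: ('a \<times> real) \<times> real \<times> real. snd (fst w) *\<^sub>R snd (snd w))"
    by (intro polynomial_intros)
  then have 2: "semialgebraic {w :: ('a \<times> real) \<times> real \<times> real. snd (fst w) * snd (snd w) = fst (snd w)}"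
    by (intro semialgebraic_Collect_eq) (simp_all add: polynomial_intros)
  from tarski_seidenberg[OF semialgebraic_Collect_conj[OF 1 2]]
  have "semialgebraic {z. fst z \<in> S \<and> snd z * g (fst z) = f (fst z)}" by simp
  also have "{z. fst z \<in> S \<and> snd z * g (fst z) = f (fst z)} = {z. fst z \<in> S \<and> snd z = f (fst z) / g (fst z)}"
    using nz by (auto simp: field_simps)
  finally show "semialgebraic {z. fst z \<in> S \<and> snd z = f (fst z) / g (fst z)}" .
qed

section \<open>Smooth maps\<close>

abbreviation "kdiff \<equiv> k_times_differentiable_on"

text \<open>Derivatives are taken in the full space; agreement on \<open>U\<close> determines them
  because \<open>U\<close> is open.\<close>

lemma kdiff_cong:
  assumes "open U" "\<And>x. x \<in> U \<Longrightarrow> f x = g x" "kdiff k f U"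
  shows "kdiff k g U"
  using assms(2,3)
proof (induction k arbitrary: f g)
  case 0
  then show ?case using continuous_on_cong by fastforce
next
  case (Suc k)
  have hd: "(g has_derivative frechet_derivative f (at x)) (at x)" if "x \<in> U" for x
  proof -
    have "(f has_derivative frechet_derivative f (at x)) (at x)"
      using Suc.prems(2) that by (simp add: frechet_derivative_works)
    then show ?thesis
      by (rule has_derivative_transform_within_open[OF _ assms(1) that]) (rule Suc.prems(1))
  qed
  have "kdiff k (\<lambda>x. frechet_derivative g (at x) v) U" for v
  proof (rule Suc.IH)
    show "kdiff k (\<lambda>x. frechet_derivative f (at x) v) U" using Suc.prems(2) by simp
    show "frechet_derivative f (at x) v = frechet_derivative g (at x) v" if "x \<in> U" for x
      using frechet_derivative_at[OF hd[OF that]] by simp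
  qed
  then show ?case using hd by (auto simp: differentiable_def)
qed

lemma kdiff_SucI:
  assumes "open U" "\<And>x. x \<in> U \<Longrightarrow> (f has_derivative f' x) (at x)"
    "\<And>v. kdiff k (\<lambda>x. f' x v) U"
  shows "kdiff (Suc k) f U"
proof -
  have "kdiff k (\<lambda>x. frechet_derivative f (at x) v) U" for v
    by (rule kdiff_cong[OF assms(1) _ assms(3)[of v]]) (use frechet_derivative_at assms(2) in metis)
  then show ?thesis using assms(2) by (auto simp: differentiable_def)
qed

lemma kdiff_SucD:
  assumes "kdiff (Suc k) f U" "x \<in> U"
  shows "(f has_derivative frechet_derivative f (at x)) (at x)"
  using assms by (simp add: frechet_derivative_works)

lemma kdiff_SucD': "kdiff (Suc k) f U \<Longrightarrow> kdiff k (\<lambda>x. frechet_derivative f (at x) v) U"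
  by simp

lemma kdiff_subset: "kdiff k f U \<Longrightarrow> V \<subseteq> U \<Longrightarrow> kdiff k f V"
  by (induction k arbitrary: f) (auto intro: continuous_on_subset)

lemma kdiff_mono: "kdiff (Suc k) f U \<Longrightarrow> kdiff k f U"
proof (induction k arbitrary: f)
  case 0
  then show ?case by (auto intro!: continuous_at_imp_continuous_on differentiable_imp_continuous_within)
next
  case (Suc k)
  then show ?case by (metis k_times_differentiable_on.simps(2))
qed

lemma kdiff_continuous_on: "kdiff k f U \<Longrightarrow> continuous_on U f"
  by (induction k) (auto dest: kdiff_mono simp del: k_times_differentiable_on.simps(2))

lemma kdiff_const: "kdiff k (\<lambda>x. c) U"
proof (induction k arbitrary: c)
  case (Suc k)
  have "frechet_derivative (\<lambda>x. c) (at x) = (\<lambda>v. 0)" for x :: 'a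
    by (rule frechet_derivative_at[symmetric]) simp
  then show ?case using Suc by simp
qed simp

lemma kdiff_linear_compose:
  assumes "open U" "bounded_linear L" "kdiff k f U" shows "kdiff k (\<lambda>x. L (f x)) U"
  using assms(3)
proof (induction k arbitrary: f)
  case 0
  then show ?case using bounded_linear.continuous_on[OF assms(2)] by simp
next
  case (Suc k)
  show ?case
    by (rule kdiff_SucI[OF assms(1) bounded_linear.has_derivative[OF assms(2) kdiff_SucD[OF Suc.prems]]])
      (auto intro: Suc.IH kdiff_SucD'[OF Suc.prems])
qed

lemma kdiff_ident: "kdiff k (\<lambda>x. x) U"
proof (cases k)
  case (Suc j)
  have "frechet_derivative (\<lambda>x. x) (at x) = (\<lambda>v. v)" for x :: 'a
    by (rule frechet_derivative_at[symmetric]) simp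
  then show ?thesis by (simp add: Suc kdiff_const)
qed simp

lemma kdiff_linear: "open U \<Longrightarrow> bounded_linear L \<Longrightarrow> kdiff k L U"
  by (rule kdiff_linear_compose[OF _ _ kdiff_ident])

lemma kdiff_add:
  assumes "open U" "kdiff k f U" "kdiff k g U" shows "kdiff k (\<lambda>x. f x + g x) U"
  using assms(2,3)
proof (induction k arbitrary: f g)
  case 0
  then show ?case by (auto intro: continuous_on_add)
next
  case (Suc k)
  show ?case
    by (rule kdiff_SucI[OF assms(1) has_derivative_add[OF kdiff_SucD[OF Suc.prems(1)] kdiff_SucD[OF Suc.prems(2)]]])
      (auto intro: Suc.IH kdiff_SucD'[OF Suc.prems(1)] kdiff_SucD'[OF Suc.prems(2)])
qed

lemma kdiff_minus: "open U \<Longrightarrow> kdiff k f U \<Longrightarrow> kdiff k (\<lambda>x. - f x) U"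
  by (rule kdiff_linear_compose[OF _ bounded_linear_minus[OF bounded_linear_ident]])

lemma kdiff_diff: "open U \<Longrightarrow> kdiff k f U \<Longrightarrow> kdiff k g U \<Longrightarrow> kdiff k (\<lambda>x. f x - g x) U"
  using kdiff_add[OF _ _ kdiff_minus, of U k f g] by simp

lemma kdiff_sum:
  assumes "open U" "finite I" "\<And>i. i \<in> I \<Longrightarrow> kdiff k (f i) U" shows "kdiff k (\<lambda>x. \<Sum>i\<in>I. f i x) U"
  using assms(2,3) by (induction I rule: finite_induct) (auto intro: kdiff_const kdiff_add[OF assms(1)])

lemma kdiff_scaleR:
  assumes "open U" "kdiff k a U" "kdiff k f U" shows "kdiff k (\<lambda>x. a x *\<^sub>R f x) U"
  using assms(2,3)
proof (induction k arbitrary: a f)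
  case 0
  then show ?case by (auto intro: continuous_on_scaleR)
next
  case (Suc k)
  show ?case
    by (rule kdiff_SucI[OF assms(1) has_derivative_scaleR[OF kdiff_SucD[OF Suc.prems(1)] kdiff_SucD[OF Suc.prems(2)]]])
      (auto intro!: Suc.IH kdiff_add[OF assms(1)] kdiff_mono[OF Suc.prems(1)] kdiff_mono[OF Suc.prems(2)]
        kdiff_SucD'[OF Suc.prems(1)] kdiff_SucD'[OF Suc.prems(2)])
qed

lemma kdiff_mult:
  fixes a f :: "'a::euclidean_space \<Rightarrow> real"
  shows "open U \<Longrightarrow> kdiff k a U \<Longrightarrow> kdiff k f U \<Longrightarrow> kdiff k (\<lambda>x. a x * f x) U"
  using kdiff_scaleR[of U k a f] by simp

lemma kdiff_inverse:
  fixes f :: "'a::euclidean_space \<Rightarrow> real"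
  assumes U: "open U" and nz: "\<And>x. x \<in> U \<Longrightarrow> f x \<noteq> 0" and f: "kdiff k f U"
  shows "kdiff k (\<lambda>x. inverse (f x)) U"
  using f
proof (induction k)
  case 0
  then show ?case using nz by (auto intro: continuous_on_inverse)
next
  case (Suc k)
  show ?case
  proof (rule kdiff_SucI[OF U])
    show "((\<lambda>x. inverse (f x)) has_derivative
      (\<lambda>v. - (inverse (f x) * frechet_derivative f (at x) v * inverse (f x)))) (at x)" if "x \<in> U" for x
      by (rule Deriv.has_derivative_inverse[OF nz[OF that] kdiff_SucD[OF Suc.prems that]])
    show "kdiff k (\<lambda>x. - (inverse (f x) * frechet_derivative f (at x) v * inverse (f x))) U" for v
      by (intro kdiff_minus kdiff_mult U Suc.IH kdiff_mono[OF Suc.prems] kdiff_SucD'[OF Suc.prems])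
  qed
qed

lemma kdiff_divide:
  fixes f g :: "'a::euclidean_space \<Rightarrow> real"
  assumes "open U" "\<And>x. x \<in> U \<Longrightarrow> g x \<noteq> 0" "kdiff k f U" "kdiff k g U"
  shows "kdiff k (\<lambda>x. f x / g x) U"
  using kdiff_mult[OF assms(1,3) kdiff_inverse[OF assms(1,2,4)]] by (simp add: divide_inverse)

lemma kdiff_compose:
  fixes g :: "'a::euclidean_space \<Rightarrow> 'b::euclidean_space" and f :: "'b \<Rightarrow> 'c::euclidean_space"
  assumes U: "open U" and V: "open V" and sub: "g ` U \<subseteq> V" and "kdiff k g U" "kdiff k f V"
  shows "kdiff k (\<lambda>x. f (g x)) U"
  using assms(4,5)
proof (induction k arbitrary: f)
  case 0
  then show ?case using continuous_on_compose2[of V f U g] sub by auto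
next
  case (Suc k)
  show ?case
  proof (rule kdiff_SucI[OF U])
    fix x assume x: "x \<in> U"
    then have gx: "g x \<in> V" using sub by blast
    let ?F = "frechet_derivative f (at (g x))"
    have F: "(f has_derivative ?F) (at (g x))" by (rule kdiff_SucD[OF Suc.prems(2) gx])
    then interpret F: bounded_linear ?F by (rule has_derivative_bounded_linear)
    have fd: "((\<lambda>x. f (g x)) has_derivative (\<lambda>v. ?F (frechet_derivative g (at x) v))) (at x)"
      by (rule has_derivative_compose[OF kdiff_SucD[OF Suc.prems(1) x] F])
    \<comment> \<open>The direction in which \<open>f\<close> is differentiated varies with the
      point, whereas \<open>kdiff\<close> speaks of fixed directions; hence the expansion along the
      basis.\<close>
    have rep: "?F w = (\<Sum>b\<in>Basis. (w \<bullet> b) *\<^sub>R ?F b)" for w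
      by (subst (1) euclidean_representation[of w, symmetric]) (simp only: F.sum F.scaleR)
    have "(\<lambda>v. ?F (frechet_derivative g (at x) v)) =
        (\<lambda>v. \<Sum>b\<in>Basis. (frechet_derivative g (at x) v \<bullet> b) *\<^sub>R ?F b)"
      by (rule ext) (rule rep)
    from fd[unfolded this] show "((\<lambda>x. f (g x)) has_derivative
        (\<lambda>v. \<Sum>b\<in>Basis. (frechet_derivative g (at x) v \<bullet> b) *\<^sub>R ?F b)) (at x)" .
  next
    fix v
    show "kdiff k (\<lambda>x. \<Sum>b\<in>Basis. (frechet_derivative g (at x) v \<bullet> b) *\<^sub>R frechet_derivative f (at (g x)) b) U"
      by (intro kdiff_sum[OF U] kdiff_scaleR[OF U] kdiff_linear_compose[OF U bounded_linear_inner_left]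
          kdiff_SucD'[OF Suc.prems(1)] Suc.IH kdiff_mono[OF Suc.prems(1)] kdiff_SucD'[OF Suc.prems(2)] finite_Basis)
  qed
qed

lemma kdiff_polynomial:
  assumes "real_polynomial_function p" "open U" shows "kdiff k p U"
  using assms(1)
  by (induction p rule: real_polynomial_function.induct)
    (auto intro: kdiff_const kdiff_linear kdiff_add kdiff_mult assms(2))

text \<open>A product rule with a merely continuous factor: since \<open>N x = 0\<close>, the
  variation of \<open>c\<close> is multiplied by a quantity of order \<open>norm h\<close>. This
  permits a factor that contains the very function whose differentiability is being shown.\<close>

lemma has_derivative_mult_vanishing:
  fixes N c :: "'a::real_normed_vector \<Rightarrow> real"
  assumes N: "(N has_derivative N') (at x)" and N0: "N x = 0" and c: "isCont c x"
  shows "((\<lambda>y. N y * c y) has_derivative (\<lambda>v. N' v * c x)) (at x)"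
proof -
  interpret bounded_linear N' by (rule has_derivative_bounded_linear[OF N])
  have l: "((\<lambda>h. norm (N (x + h) - N x - N' h) / norm h) \<longlongrightarrow> 0) (at 0)"
    using N by (simp add: has_derivative_at)
  obtain K where K: "K > 0" "\<And>h. norm (N' h) \<le> norm h * K" using pos_bounded by blast
  have cc: "((\<lambda>h. c (x + h)) \<longlongrightarrow> c x) (at 0)" using c by (simp add: isCont_def LIM_offset_zero_iff)
  then have c0: "((\<lambda>h. \<bar>c (x + h) - c x\<bar>) \<longlongrightarrow> 0) (at 0)" by (simp add: tendsto_rabs_zero_iff LIM_zero)
  have u: "((\<lambda>h. norm (N (x + h) - N x - N' h) / norm h * \<bar>c (x + h)\<bar> + K * \<bar>c (x + h) - c x\<bar>) \<longlongrightarrow> 0 * \<bar>c x\<bar> + K * 0) (at 0)"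
    by (intro tendsto_add tendsto_mult l tendsto_rabs cc c0 tendsto_const)
  have "((\<lambda>h. norm (N (x + h) * c (x + h) - N x * c x - N' h * c x) / norm h) \<longlongrightarrow> 0) (at 0)"
  proof (rule tendsto_sandwich[OF _ _ tendsto_const])
    show "\<forall>\<^sub>F h in at 0. norm (N (x + h) * c (x + h) - N x * c x - N' h * c x) / norm h
      \<le> norm (N (x + h) - N x - N' h) / norm h * \<bar>c (x + h)\<bar> + K * \<bar>c (x + h) - c x\<bar>"
    proof (rule always_eventually, rule allI)
      fix h :: 'a
      have "norm (N (x + h) * c (x + h) - N x * c x - N' h * c x) =
          norm ((N (x + h) - N x - N' h) * c (x + h) + N' h * (c (x + h) - c x))"
        by (simp add: N0 algebra_simps)
      also have "\<dots> \<le> norm (N (x + h) - N x - N' h) * \<bar>c (x + h)\<bar> + norm (N' h) * \<bar>c (x + h) - c x\<bar>"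
        by (rule order_trans[OF norm_triangle_ineq]) (simp add: abs_mult)
      also have "\<dots> \<le> norm (N (x + h) - N x - N' h) * \<bar>c (x + h)\<bar> + (norm h * K) * \<bar>c (x + h) - c x\<bar>"
        using K(2)[of h] by (intro add_left_mono mult_right_mono) auto
      finally show "norm (N (x + h) * c (x + h) - N x * c x - N' h * c x) / norm h
        \<le> norm (N (x + h) - N x - N' h) / norm h * \<bar>c (x + h)\<bar> + K * \<bar>c (x + h) - c x\<bar>"
        by (cases "h = 0") (auto simp: divide_simps mult_ac)
    qed
  qed (use u in auto)
  moreover have "bounded_linear (\<lambda>v. N' v * c x)"
    by (rule bounded_linear_compose[OF bounded_linear_mult_left]) (rule bounded_linear)
  ultimately show ?thesis by (simp add: has_derivative_at)
qed

text \<open>The direction comes first, so that \<open>dird b\<close> is an operator on functions and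
  can be iterated.\<close>

definition dird :: "'a::euclidean_space \<Rightarrow> ('a \<Rightarrow> real) \<Rightarrow> 'a \<Rightarrow> real" where
  "dird b f x = frechet_derivative f (at x) b"

lemma polynomial_has_derivative:
  fixes f :: "'a::euclidean_space \<Rightarrow> real"
  assumes "real_polynomial_function f" shows "(f has_derivative (\<lambda>v. dird v f x)) (at x)"
  using kdiff_SucD[OF kdiff_polynomial[OF assms open_UNIV, of "Suc 0"], of x] by (simp add: dird_def)

lemma dird_along:
  assumes f: "real_polynomial_function f" and P: "\<And>x t. f (x + t *\<^sub>R b) = poly (P x) t"
  shows "dird b f (x + t *\<^sub>R b) = poly (pderiv (P x)) t"
proof -
  have "((\<lambda>t. x + t *\<^sub>R b) has_derivative (\<lambda>s. s *\<^sub>R b)) (at t)"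
    by (auto intro!: derivative_eq_intros)
  from has_derivative_compose[OF this polynomial_has_derivative[OF f]]
  have 1: "((\<lambda>t. poly (P x) t) has_derivative (\<lambda>s. dird (s *\<^sub>R b) f (x + t *\<^sub>R b))) (at t)"
    by (simp add: P)
  have "linear (\<lambda>v. dird v f (x + t *\<^sub>R b))"
    using has_derivative_linear[OF polynomial_has_derivative[OF f]] .
  from linear_scale[OF this]
  have "(\<lambda>s. dird (s *\<^sub>R b) f (x + t *\<^sub>R b)) = (*) (dird b f (x + t *\<^sub>R b))"
    by (simp add: fun_eq_iff)
  then have "(poly (P x) has_real_derivative dird b f (x + t *\<^sub>R b)) (at t)"
    using 1 by (simp add: has_field_derivative_def)
  then show ?thesis using poly_DERIV DERIV_unique by blast
qed

text \<open>The derivative along \<open>b\<close> is the linear coefficient of the fibre polynomial,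
  and this coefficient is a polynomial in the base point.\<close>

lemma dird_polynomial:
  assumes f: "real_polynomial_function f" shows "real_polynomial_function (dird b f)"
proof -
  obtain P where P: "poly_family P" "\<And>x t. f (x + t *\<^sub>R b) = poly (P x) t" using poly_family_along[OF f] by blast
  have "dird b f = (\<lambda>x. coeff (P x) 1)"
    using dird_along[OF f P(2), of _ 0] by (simp add: fun_eq_iff poly_0_coeff_0 coeff_pderiv)
  then show ?thesis using P(1) by (simp add: poly_family_def)
qed

lemma poly_continuous_on_param:
  assumes "poly_family P" shows "continuous_on UNIV (\<lambda>z :: 'a::euclidean_space \<times> real. poly (P (fst z)) (snd z))"
proof -
  obtain d where d: "\<And>x. degree (P x) \<le> d" using assms by (auto simp: poly_family_def)
  have c: "continuous_on UNIV (\<lambda>x. coeff (P x) i)" for i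
    using assms kdiff_continuous_on[OF kdiff_polynomial[OF _ open_UNIV]] by (auto simp: poly_family_def)
  have "poly (P x) t = (\<Sum>i\<le>d. coeff (P x) i * t ^ i)" for x t
    using poly_as_sum_of_monoms'[OF d[of x]] by (metis (no_types, lifting) poly_monom poly_sum sum.cong)
  then show ?thesis
    by (simp, intro continuous_intros continuous_on_compose2[OF c]) auto
qed

text \<open>Since \<open>q\<close> is a polynomial, \<open>q (w + s e) = q w + s r (w, s)\<close> with \<open>r\<close> continuous. Hence
  \<open>\<psi> y = \<psi> u - q (g y + \<psi> u e) / r (g y + \<psi> u e, \<psi> y - \<psi> u)\<close> for \<open>y\<close> near \<open>u\<close>, which is
  differentiable at \<open>u\<close> because the numerator vanishes there.\<close>

lemma kdiff_implicit:
  fixes q :: "'b::euclidean_space \<Rightarrow> real" and g :: "'a::euclidean_space \<Rightarrow> 'b" and \<psi> :: "'a \<Rightarrow> real"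
  assumes U: "open U" and q: "real_polynomial_function q" and g: "\<And>k. kdiff k g U"
    and cont: "continuous_on U \<psi>" and zero: "\<And>u. u \<in> U \<Longrightarrow> q (g u + \<psi> u *\<^sub>R e) = 0"
    and nz: "\<And>u. u \<in> U \<Longrightarrow> dird e q (g u + \<psi> u *\<^sub>R e) \<noteq> 0"
  shows "kdiff k \<psi> U"
proof -
  define w where "w u = g u + \<psi> u *\<^sub>R e" for u
  \<comment> \<open>The formula obtained by differentiating the equation \<open>zero\<close>
    implicitly.\<close>
  define \<psi>' where "\<psi>' u v = - dird (frechet_derivative g (at u) v) q (w u) / dird e q (w u)" for u v
  obtain P where P: "poly_family P" "\<And>x t. q (x + t *\<^sub>R e) = poly (P x) t" using poly_family_along[OF q] by blast
  \<comment> \<open>The fibre polynomial without its constant term, divided by the variable: a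
    difference quotient whose value at \<open>0\<close> is the derivative along
    \<open>e\<close>.\<close>
  define R where "R x = poly_shift 1 (P x)" for x
  have fR: "poly_family R" 
  proof -
    obtain d where d: "\<And>x. degree (P x) \<le> d" using P(1) by (auto simp: poly_family_def)
    have "degree (R x) \<le> d" for x unfolding R_def
      by (rule degree_le) (use d[of x] in \<open>auto simp: coeff_poly_shift intro!: coeff_eq_0\<close>)
    then show ?thesis using P(1) by (auto simp: poly_family_def R_def coeff_poly_shift)
  qed
  have R: "poly (P x) t = poly (P x) 0 + t * poly (R x) t" for x t
  proof -
    have "P x = pCons (coeff (P x) 0) (R x)"
      by (rule poly_eqI) (simp add: R_def coeff_poly_shift coeff_pCons split: nat.splits)
    then have "poly (P x) t = coeff (P x) 0 + t * poly (R x) t" by (metis poly_pCons)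
    then show ?thesis by (simp add: poly_0_coeff_0)
  qed
  have R0: "poly (R x) 0 = dird e q x" for x
    using dird_along[OF q P(2), of x 0] by (simp add: poly_0_coeff_0 coeff_pderiv R_def coeff_poly_shift)
  have der: "(\<psi> has_derivative \<psi>' u) (at u)" if u: "u \<in> U" for u
  proof -
    define N where "N y = q (g y + \<psi> u *\<^sub>R e)" for y
    define r where "r y = poly (R (g y + \<psi> u *\<^sub>R e)) (\<psi> y - \<psi> u)" for y
    have gd: "(g has_derivative frechet_derivative g (at u)) (at u)" by (rule kdiff_SucD[OF g u])
    have "((\<lambda>y. g y + \<psi> u *\<^sub>R e) has_derivative frechet_derivative g (at u)) (at u)"
      using has_derivative_add[OF gd has_derivative_const] by simp
    from has_derivative_compose[OF this polynomial_has_derivative[OF q]]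
    have N': "(N has_derivative (\<lambda>v. dird (frechet_derivative g (at u) v) q (w u))) (at u)"
      by (simp add: N_def[abs_def] w_def)
    have N0: "N u = 0" using zero[OF u] by (simp add: N_def)
    have rel: "(\<psi> y - \<psi> u) * r y = - N y" if "y \<in> U" for y
    proof -
      have "0 = q ((g y + \<psi> u *\<^sub>R e) + (\<psi> y - \<psi> u) *\<^sub>R e)" using zero[OF that] by (simp add: algebra_simps)
      also have "\<dots> = N y + (\<psi> y - \<psi> u) * r y"
        unfolding P(2) R[of _ "\<psi> y - \<psi> u"] using P(2)[of "g y + \<psi> u *\<^sub>R e" 0] by (simp add: N_def r_def)
      finally show ?thesis by simp
    qed
    have "continuous_on U (\<lambda>y. (g y + \<psi> u *\<^sub>R e, \<psi> y - \<psi> u))"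
      by (intro continuous_intros kdiff_continuous_on[OF g] cont)
    from continuous_on_compose2[OF poly_continuous_on_param[OF fR] this]
    have cr: "continuous_on U r" by (simp add: r_def[abs_def])
    have ru: "r u = dird e q (w u)" by (simp add: r_def R0 w_def)
    then have ru0: "r u \<noteq> 0" using nz[OF u] by (simp add: w_def)
    have icr: "isCont r u" using cr U u continuous_on_eq_continuous_at by blast
    then have "isCont (\<lambda>y. inverse (r y)) u" using ru0 by (intro continuous_intros) auto
    from has_derivative_diff[OF has_derivative_const[of "\<psi> u"] has_derivative_mult_vanishing[OF N' N0 this]]
    have dN: "((\<lambda>y. \<psi> u - N y * inverse (r y)) has_derivative \<psi>' u) (at u)"
      by (simp add: \<psi>'_def[abs_def] ru divide_inverse)
    obtain d where d: "d > 0" "\<And>y. dist u y < d \<Longrightarrow> r y \<noteq> 0"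
      using continuous_at_avoid[OF icr ru0] by blast
    show ?thesis
    proof (rule has_derivative_transform_within_open[OF dN])
      show "open (U \<inter> ball u d)" "u \<in> U \<inter> ball u d" using U u d(1) by auto
      show "\<psi> u - N y * inverse (r y) = \<psi> y" if y: "y \<in> U \<inter> ball u d" for y
      proof -
        have "r y \<noteq> 0" using y d(2) by simp
        moreover have "(\<psi> y - \<psi> u) * r y = - N y" using rel y by blast
        ultimately show ?thesis by (simp add: field_simps)
      qed
    qed
  qed
  show ?thesis
  \<comment> \<open>The derivative of \<open>\<psi>\<close> is a quotient of expressions in
    \<open>w\<close> and the derivative of \<open>g\<close>. So \<open>k\<close> derivatives of
    \<open>\<psi>\<close> yield \<open>k\<close> derivatives of \<open>\<psi>'\<close>, and
    smoothness is bootstrapped from continuity.\<close>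
  proof (induction k)
    case 0
    then show ?case using cont by simp
  next
    case (Suc k)
    have kw: "kdiff k w U" unfolding w_def[abs_def]
      by (intro kdiff_add kdiff_scaleR U g Suc kdiff_const)
    have dw: "kdiff k (\<lambda>u. dird c q (w u)) U" for c
      by (rule kdiff_compose[OF U open_UNIV _ kw kdiff_polynomial[OF dird_polynomial[OF q] open_UNIV]]) simp
    show ?case
    proof (rule kdiff_SucI[OF U der])
      fix v
      have rep: "dird z q x = (\<Sum>b\<in>Basis. (z \<bullet> b) * dird b q x)" for z x
      proof -
        interpret L: bounded_linear "\<lambda>v. dird v q x"
          by (rule has_derivative_bounded_linear[OF polynomial_has_derivative[OF q]])
        have "dird (\<Sum>b\<in>Basis. (z \<bullet> b) *\<^sub>R b) q x = (\<Sum>b\<in>Basis. (z \<bullet> b) * dird b q x)"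
          by (simp only: L.sum L.scaleR real_scaleR_def)
        then show ?thesis by (simp only: euclidean_representation)
      qed
      have "\<psi>' u v = - (\<Sum>b\<in>Basis. (frechet_derivative g (at u) v \<bullet> b) * dird b q (w u)) / dird e q (w u)" for u
        unfolding \<psi>'_def by (subst rep) (rule refl)
      then show "kdiff k (\<lambda>u. \<psi>' u v) U"
        by (simp only:, intro kdiff_divide kdiff_minus kdiff_sum kdiff_mult U dw finite_Basis
            kdiff_linear_compose[OF U bounded_linear_inner_left] kdiff_SucD'[OF g])
          (simp add: nz w_def)
    qed
  qed
qed

section \<open>Cells and their charts\<close>

definition coord_proj :: "'a::euclidean_space set \<Rightarrow> 'a \<Rightarrow> 'a" where
  "coord_proj B u = (\<Sum>b\<in>B. (u \<bullet> b) *\<^sub>R b)"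

text \<open>The open cylinder over the cube: the coordinates outside \<open>B\<close> are free, so
  that derivatives in the ambient space make sense.\<close>

definition slab :: "'a::euclidean_space set \<Rightarrow> 'a set" where
  "slab B = {u. \<forall>b\<in>B. 0 < u \<bullet> b \<and> u \<bullet> b < 1}"

lemma coord_proj_inner:
  assumes "B \<subseteq> Basis" "c \<in> Basis"
  shows "coord_proj B u \<bullet> c = (if c \<in> B then u \<bullet> c else 0)"
proof -
  have "finite B" using assms(1) finite_Basis finite_subset by blast
  have "coord_proj B u \<bullet> c = (\<Sum>b\<in>B. (u \<bullet> b) * (b \<bullet> c))"
    by (simp add: coord_proj_def inner_sum_left)
  also have "\<dots> = (\<Sum>b\<in>B. if b = c then u \<bullet> c else 0)"
    by (intro sum.cong refl) (use assms in \<open>auto simp: inner_Basis\<close>)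
  also have "\<dots> = (if c \<in> B then u \<bullet> c else 0)" using \<open>finite B\<close> by simp
  finally show ?thesis .
qed

lemma bounded_linear_coord_proj: "bounded_linear (coord_proj B)"
  unfolding coord_proj_def[abs_def]
  by (intro bounded_linear_sum bounded_linear_scaleR_left[THEN bounded_linear_compose] bounded_linear_inner_left)

lemma coord_proj_id:
  assumes "B \<subseteq> Basis" "\<And>c. c \<in> Basis - B \<Longrightarrow> u \<bullet> c = 0"
  shows "coord_proj B u = u"
  by (rule euclidean_eqI) (use assms in \<open>simp add: coord_proj_inner\<close>)

lemma open_slab: "B \<subseteq> Basis \<Longrightarrow> open (slab B)"
proof -
  assume "B \<subseteq> Basis"
  then have "finite B" using finite_Basis finite_subset by blast
  moreover have "slab B = (\<Inter>b\<in>B. {u. 0 < u \<bullet> b} \<inter> {u. u \<bullet> b < 1})" by (auto simp: slab_def)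
  ultimately show ?thesis
    by (auto intro!: open_INT open_Int open_Collect_less continuous_intros)
qed

lemma cube_subset_slab: "open_unit_cube B \<subseteq> slab B"
  by (auto simp: open_unit_cube_def slab_def)

lemma coord_proj_slab: "B \<subseteq> Basis \<Longrightarrow> u \<in> slab B \<Longrightarrow> coord_proj B u \<in> open_unit_cube B"
  by (auto simp: open_unit_cube_def slab_def coord_proj_inner subset_iff)

lemma real_polynomial_inner: "real_polynomial_function (\<lambda>x. x \<bullet> b)"
  by (intro real_polynomial_function.intros(1) bounded_linear_inner_left)

lemma semialgebraic_open_unit_cube:
  assumes "B \<subseteq> Basis" shows "semialgebraic (open_unit_cube B)"
proof -
  have f: "finite B" using assms finite_Basis finite_subset by blast
  have 1: "semialgebraic {x. \<forall>b\<in>B. 0 < x \<bullet> b \<and> 0 < 1 - x \<bullet> b}"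
    by (intro semialgebraic_Collect_ball f semialgebraic_Collect_conj semialgebraic_gt0 real_polynomial_inner
        real_polynomial_function_diff real_polynomial_function.intros(2))
  have 2: "semialgebraic {x. \<forall>b\<in>Basis - B. x \<bullet> b = 0}"
    by (intro semialgebraic_Collect_ball semialgebraic_eq0 real_polynomial_inner) simp
  show ?thesis using semialgebraic_Collect_conj[OF 1 2] by (simp add: open_unit_cube_def)
qed

lemma open_unit_cube_nonempty: "B \<subseteq> Basis \<Longrightarrow> open_unit_cube B \<noteq> {}"
proof -
  assume B: "B \<subseteq> Basis"
  have "coord_proj B ((1/2) *\<^sub>R One) \<in> open_unit_cube B"
    by (rule coord_proj_slab[OF B]) (use B in \<open>auto simp: slab_def inner_sum_left inner_Basis subset_iff\<close>)
  then show ?thesis by blast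
qed

text \<open>The parametrisation \<open>g\<close> ignores the coordinates outside \<open>B\<close>, so that its smoothness on the cube can be
  stated on the open set \<open>slab B\<close>.\<close>

definition cell_chart ::
    "'a::euclidean_space set \<Rightarrow> ('a \<Rightarrow> 'a) \<Rightarrow> ('a \<Rightarrow> 'a) \<Rightarrow> 'a set \<Rightarrow> 'a set \<Rightarrow> bool" where
  "cell_chart B f g \<Omega> T \<longleftrightarrow> B \<subseteq> Basis \<and> semialgebraic T \<and> open \<Omega> \<and> T \<subseteq> \<Omega> \<and>
     f ` T \<subseteq> open_unit_cube B \<and> f ` \<Omega> \<subseteq> slab B \<and> g ` open_unit_cube B \<subseteq> T \<and>
     (\<forall>x\<in>T. g (f x) = x) \<and> (\<forall>u\<in>open_unit_cube B. f (g u) = u) \<and>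
     (\<forall>k. kdiff k f \<Omega>) \<and> (\<forall>k. kdiff k g (slab B)) \<and> (\<forall>u. g u = g (coord_proj B u)) \<and>
     semialgebraic_map_on f T \<and> semialgebraic_map_on g (open_unit_cube B)"

lemma cell_chartD:
  assumes "cell_chart B f g \<Omega> T"
  shows "B \<subseteq> Basis" "semialgebraic T" "open \<Omega>" "T \<subseteq> \<Omega>" "\<And>x. x \<in> T \<Longrightarrow> f x \<in> open_unit_cube B"
    "\<And>x. x \<in> \<Omega> \<Longrightarrow> f x \<in> slab B" "\<And>u. u \<in> open_unit_cube B \<Longrightarrow> g u \<in> T" "\<And>x. x \<in> T \<Longrightarrow> g (f x) = x"
    "\<And>u. u \<in> open_unit_cube B \<Longrightarrow> f (g u) = u" "\<And>k. kdiff k f \<Omega>" "\<And>k. kdiff k g (slab B)"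
    "\<And>u. g u = g (coord_proj B u)" "semialgebraic_map_on f T" "semialgebraic_map_on g (open_unit_cube B)"
    "\<And>u. u \<in> slab B \<Longrightarrow> g u \<in> T"
proof -
  note c = assms[unfolded cell_chart_def]
  show B: "B \<subseteq> Basis" and "semialgebraic T" "open \<Omega>" "T \<subseteq> \<Omega>" "\<And>x. x \<in> T \<Longrightarrow> f x \<in> open_unit_cube B"
    "\<And>x. x \<in> \<Omega> \<Longrightarrow> f x \<in> slab B" and g: "\<And>u. u \<in> open_unit_cube B \<Longrightarrow> g u \<in> T" and "\<And>x. x \<in> T \<Longrightarrow> g (f x) = x"
    "\<And>u. u \<in> open_unit_cube B \<Longrightarrow> f (g u) = u" "\<And>k. kdiff k f \<Omega>" "\<And>k. kdiff k g (slab B)"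
    "semialgebraic_map_on f T" "semialgebraic_map_on g (open_unit_cube B)"
    using c by (auto simp: image_subset_iff)
  show e: "g u = g (coord_proj B u)" for u using c by (elim conjE) (erule allE)
  show "g u \<in> T" if "u \<in> slab B" for u
    using g[OF coord_proj_slab[OF B that]] e[of u] by simp
qed

lemma cell_chart_semialgebraic_cell:
  assumes "cell_chart B f g \<Omega> T" shows "semialgebraic_cell T (card B)"
proof -
  note c = cell_chartD[OF assms]
  have "smooth_map_on f T"
    unfolding smooth_map_on_def smooth_on_open_def using c(3,4,10) by (intro ballI exI[of _ \<Omega>] exI[of _ f]) auto
  moreover have "smooth_map_on g (open_unit_cube B)"
    unfolding smooth_map_on_def smooth_on_open_def using c(11) open_slab[OF c(1)] cube_subset_slab
    by (intro ballI exI[of _ "slab B"] exI[of _ g]) auto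
  ultimately have "semialgebraically_diffeomorphic T (open_unit_cube B)"
    unfolding semialgebraically_diffeomorphic_def using c(5,7,8,9,13,14)
    by (intro exI[of _ f] exI[of _ g]) auto
  then show ?thesis unfolding semialgebraic_cell_def using c(1,2) by blast
qed

section \<open>Graphs and bands over a base cell\<close>

definition drop_coord :: "'a::euclidean_space \<Rightarrow> 'a \<Rightarrow> 'a" where
  "drop_coord b y = y - (y \<bullet> b) *\<^sub>R b"

lemma bounded_linear_drop_coord: "bounded_linear (drop_coord b)"
  unfolding drop_coord_def[abs_def]
  by (intro bounded_linear_sub bounded_linear_ident bounded_linear_scaleR_left[THEN bounded_linear_compose]
      bounded_linear_inner_left)

lemma drop_coord_inner: "b \<in> Basis \<Longrightarrow> c \<in> Basis \<Longrightarrow> drop_coord b y \<bullet> c = (if c = b then 0 else y \<bullet> c)"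
  by (auto simp: drop_coord_def inner_diff_left inner_Basis)

lemma drop_coord_add: "b \<in> Basis \<Longrightarrow> x \<bullet> b = 0 \<Longrightarrow> drop_coord b (x + t *\<^sub>R b) = x"
  by (simp add: drop_coord_def inner_add_left)

lemma drop_coord_split: "drop_coord b y + (y \<bullet> b) *\<^sub>R b = y"
  by (simp add: drop_coord_def)

lemma open_drop_coord_vimage: "open \<Omega> \<Longrightarrow> open {y. drop_coord b y \<in> \<Omega>}"
  using continuous_open_vimage[OF _ linear_continuous_at[OF bounded_linear_drop_coord]]
  by (simp add: vimage_def)

lemma kdiff_drop_coord_compose:
  assumes "open \<Omega>" "kdiff k f \<Omega>" shows "kdiff k (\<lambda>y. f (drop_coord b y)) {y. drop_coord b y \<in> \<Omega>}"
  by (rule kdiff_compose[OF open_drop_coord_vimage[OF assms(1)] assms(1) _ _ assms(2)])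
    (auto intro!: kdiff_linear bounded_linear_drop_coord open_drop_coord_vimage assms(1))

text \<open>The base \<open>D\<close> need not be open, so smoothness of \<open>\<xi>\<close> is
  expressed through the parametrisation \<open>g\<close> on the open set
  \<open>slab B\<close>.\<close>

definition cell_section :: "'a::euclidean_space set \<Rightarrow> ('a \<Rightarrow> 'a) \<Rightarrow> 'a set \<Rightarrow> ('a \<Rightarrow> real) \<Rightarrow> bool" where
  "cell_section B g D \<xi> \<longleftrightarrow> semialgebraic_map_on \<xi> D \<and> (\<forall>k. kdiff k (\<lambda>u. \<xi> (g u)) (slab B))"

lemma cell_chart_graph:
  assumes c: "cell_chart B f g \<Omega> D" and b: "b \<in> Basis" and D: "\<And>x. x \<in> D \<Longrightarrow> x \<bullet> b = 0"
    and \<xi>: "cell_section B g D \<xi>"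
  obtains f' g' \<Omega>' where "cell_chart B f' g' \<Omega>' {y. drop_coord b y \<in> D \<and> y \<bullet> b = \<xi> (drop_coord b y)}"
proof
  note c = cell_chartD[OF c]
  let ?T = "{y. drop_coord b y \<in> D \<and> y \<bullet> b = \<xi> (drop_coord b y)}"
  let ?f = "\<lambda>y. f (drop_coord b y)" and ?g = "\<lambda>u. g u + \<xi> (g u) *\<^sub>R b"
  have sx: "semialgebraic_map_on \<xi> D" and kx: "\<And>k. kdiff k (\<lambda>u. \<xi> (g u)) (slab B)"
    using \<xi> by (auto simp: cell_section_def)
  have sT: "semialgebraic ?T"
    by (intro semialgebraic_map_graph_vimage[OF sx] polynomial_function_bounded_linear
        bounded_linear_drop_coord bounded_linear_inner_left)
  have d: "drop_coord b (?g u) = g u" "?g u \<bullet> b = \<xi> (g u)" if "u \<in> open_unit_cube B" for u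
    using D[OF c(7)[OF that]] b by (auto simp: drop_coord_add inner_add_left)
  have "semialgebraic_map_on ?f ?T"
    by (rule semialgebraic_map_on_compose[OF semialgebraic_map_on_linear[OF sT bounded_linear_drop_coord] c(13)]) auto
  moreover have "semialgebraic_map_on (\<lambda>u. \<xi> (g u)) (open_unit_cube B)"
    by (rule semialgebraic_map_on_compose[OF c(14) sx]) (use c(7) in auto)
  then have "semialgebraic_map_on ?g (open_unit_cube B)"
    by (intro semialgebraic_map_on_add semialgebraic_map_on_scaleR c(14) semialgebraic_map_on_const
      semialgebraic_open_unit_cube c(1))
  moreover have "kdiff k ?g (slab B)" for k
    by (intro kdiff_add kdiff_scaleR kdiff_const open_slab c(1,11) kx)
  moreover have "?g u = ?g (coord_proj B u)" for u using c(12)[of u] by simp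
  moreover have "?g (?f y) = y" if "y \<in> ?T" for y
    using that c(8)[of "drop_coord b y"] drop_coord_split[of b y] by simp
  ultimately show "cell_chart B ?f ?g {y. drop_coord b y \<in> \<Omega>} ?T"
    unfolding cell_chart_def using c(4,5,6,7,9) d sT c(1)
    by (auto intro!: open_drop_coord_vimage kdiff_drop_coord_compose c(3,10))
qed

text \<open>Since \<open>g\<close> ignores the coordinate \<open>b\<close>, it serves unchanged on
  the cube with one more side.\<close>

lemma cell_chart_inverse_insert:
  assumes ch: "cell_chart B f g \<Omega> D" and b: "b \<in> Basis" "b \<notin> B"
  shows "g (v + r *\<^sub>R b) = g v" "g (drop_coord b v) = g v" "g (coord_proj (insert b B) u) = g u"
    "u \<in> slab (insert b B) \<Longrightarrow> g u \<in> D" "u \<in> open_unit_cube (insert b B) \<Longrightarrow> g u \<in> D"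
    "semialgebraic_map_on g (open_unit_cube (insert b B))"
proof -
  note c = cell_chartD[OF ch]
  have B': "insert b B \<subseteq> Basis" using b c(1) by auto
  have eq: "g v = g w" if "coord_proj B v = coord_proj B w" for v w
    using c(12)[of v] c(12)[of w] that by metis
  show "g (v + r *\<^sub>R b) = g v"
    by (rule eq, rule euclidean_eqI) (use b in \<open>auto simp: coord_proj_inner[OF c(1)] inner_add_left inner_Basis\<close>)
  show "g (drop_coord b v) = g v"
    by (rule eq, rule euclidean_eqI) (use b in \<open>auto simp: coord_proj_inner[OF c(1)] drop_coord_inner\<close>)
  show "g (coord_proj (insert b B) u) = g u"
    by (rule eq, rule euclidean_eqI) (simp add: coord_proj_inner[OF c(1)] coord_proj_inner[OF B'])
  show gD: "g u \<in> D" if "u \<in> slab (insert b B)" for u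
    using c(15)[of u] that by (auto simp: slab_def)
  then show "u \<in> open_unit_cube (insert b B) \<Longrightarrow> g u \<in> D" using cube_subset_slab by blast
  have "coord_proj B u \<in> open_unit_cube B" if "u \<in> open_unit_cube (insert b B)" for u
    using that cube_subset_slab[of "insert b B"] coord_proj_slab[OF c(1), of u] by (auto simp: slab_def)
  then have "semialgebraic_map_on (\<lambda>u. g (coord_proj B u)) (open_unit_cube (insert b B))"
    by (intro semialgebraic_map_on_compose[OF semialgebraic_map_on_linear[OF semialgebraic_open_unit_cube[OF B']
      bounded_linear_coord_proj] c(14)]) auto
  then show "semialgebraic_map_on g (open_unit_cube (insert b B))"
    by (rule semialgebraic_map_on_cong) (rule c(12)[symmetric])
qed

text \<open>The map \<open>s\<close> turns the height of a point of the band into the new cube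
  coordinate, and \<open>t\<close> recovers the height from a point of the larger cube; the rest
  comes from the chart of the base.\<close>

lemma cell_chart_band:
  assumes ch: "cell_chart B f g \<Omega> D" and b: "b \<in> Basis" "b \<notin> B" and D: "\<And>x. x \<in> D \<Longrightarrow> x \<bullet> b = 0"
    and T: "semialgebraic T" "\<And>y. y \<in> T \<Longrightarrow> drop_coord b y \<in> D"
    and O2: "open \<Omega>2" "T \<subseteq> \<Omega>2"
    and s: "semialgebraic_map_on s T" "\<And>k. kdiff k s \<Omega>2" "\<And>y. y \<in> T \<Longrightarrow> 0 < s y \<and> s y < 1"
    and t: "semialgebraic_map_on t (open_unit_cube (insert b B))" "\<And>k. kdiff k t (slab (insert b B))"
      "\<And>u. t u = t (coord_proj (insert b B) u)"
    and ts: "\<And>y. y \<in> T \<Longrightarrow> t (f (drop_coord b y) + s y *\<^sub>R b) = y \<bullet> b"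
    and st: "\<And>u. u \<in> open_unit_cube (insert b B) \<Longrightarrow> g u + t u *\<^sub>R b \<in> T \<and> s (g u + t u *\<^sub>R b) = u \<bullet> b"
  obtains f' g' \<Omega>' where "cell_chart (insert b B) f' g' \<Omega>' T"
proof
  note c = cell_chartD[OF ch]
  let ?B = "insert b B"
  \<comment> \<open>Off the base cell \<open>f\<close> may have a component along \<open>b\<close>.
    It is removed so that \<open>s y\<close> alone is the new coordinate on
    \<open>\<Omega>'\<close>, which is cut down to where \<open>s\<close> lies in
    \<open>(0, 1)\<close>.\<close>
  let ?f = "\<lambda>y. drop_coord b (f (drop_coord b y)) + s y *\<^sub>R b" and ?g = "\<lambda>u. g u + t u *\<^sub>R b"
  define \<Omega>' where "\<Omega>' = {y. drop_coord b y \<in> \<Omega>} \<inter> (\<Omega>2 \<inter> s -` {0<..<1})"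
  have B': "?B \<subseteq> Basis" using b c(1) by auto
  have oO: "open \<Omega>'" unfolding \<Omega>'_def
    by (intro open_Int open_drop_coord_vimage c(3) continuous_open_preimage kdiff_continuous_on[OF s(2)] O2(1)) auto
  have f0: "f x \<bullet> b = 0" if "x \<in> D" for x using c(5)[OF that] b by (auto simp: open_unit_cube_def)
  have fe: "?f y = f (drop_coord b y) + s y *\<^sub>R b" if "y \<in> T" for y
    using f0[OF T(2)[OF that]] by (simp add: drop_coord_def)
  have fi: "?f y \<bullet> c = (if c = b then s y else f (drop_coord b y) \<bullet> c)" if "c \<in> Basis" for c y
    using that b by (auto simp: inner_add_left drop_coord_inner inner_Basis)
  have TO: "T \<subseteq> \<Omega>'" using T(2) O2(2) s(3) c(4) by (auto simp: \<Omega>'_def)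
  note gi = cell_chart_inverse_insert[OF ch b]
  have sub: "slab ?B \<subseteq> slab B" by (auto simp: slab_def)
  have pc: "coord_proj B u \<in> open_unit_cube B" if "u \<in> open_unit_cube ?B" for u
    using that sub cube_subset_slab coord_proj_slab[OF c(1)] by blast
  have fg: "?f (?g u) = u" if u: "u \<in> open_unit_cube ?B" for u
  proof -
    have gu: "g u = g (coord_proj B u)" by (rule c(12))
    have gD: "g u \<in> D" unfolding gu using pc[OF u] by (rule c(7))
    have "drop_coord b (?g u) = g u" using D[OF gD] b by (simp add: drop_coord_add)
    moreover have "f (g u) = coord_proj B u" unfolding gu by (rule c(9)[OF pc[OF u]])
    ultimately have fe: "?f (?g u) = drop_coord b (coord_proj B u) + (u \<bullet> b) *\<^sub>R b" using st[OF u] by simp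
    show ?thesis unfolding fe
      by (rule euclidean_eqI) (use b u c(1) in \<open>auto simp: inner_add_left drop_coord_inner coord_proj_inner inner_Basis open_unit_cube_def\<close>)
  qed
  have saf: "semialgebraic_map_on ?f T"
    by (intro semialgebraic_map_on_add semialgebraic_map_on_scaleR s(1) semialgebraic_map_on_const T(1)
      semialgebraic_map_on_poly_compose[where p="drop_coord b"] polynomial_function_bounded_linear bounded_linear_drop_coord
      semialgebraic_map_on_compose[OF semialgebraic_map_on_linear[OF T(1) bounded_linear_drop_coord] c(13)])
      (use T(2) in auto)
  from gi(6) have sag: "semialgebraic_map_on ?g (open_unit_cube ?B)"
    by (intro semialgebraic_map_on_add semialgebraic_map_on_scaleR t(1) semialgebraic_map_on_const
      semialgebraic_open_unit_cube B')
  have kf: "kdiff k ?f \<Omega>'" for k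
  proof (intro kdiff_add kdiff_scaleR oO kdiff_const)
    have "kdiff k (\<lambda>y. f (drop_coord b y)) \<Omega>'"
      by (rule kdiff_subset[OF kdiff_drop_coord_compose[OF c(3,10)]]) (auto simp: \<Omega>'_def)
    then show "kdiff k (\<lambda>y. drop_coord b (f (drop_coord b y))) \<Omega>'"
      by (rule kdiff_linear_compose[OF oO bounded_linear_drop_coord])
    show "kdiff k s \<Omega>'" by (rule kdiff_subset[OF s(2)]) (auto simp: \<Omega>'_def)
  qed
  have kg: "kdiff k ?g (slab ?B)" for k
    by (intro kdiff_add kdiff_scaleR kdiff_const open_slab B' t(2) kdiff_subset[OF c(11) sub])
  have fT: "?f ` T \<subseteq> open_unit_cube ?B"
  proof (intro image_subsetI)
    fix y assume y: "y \<in> T"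
    then have "f (drop_coord b y) \<in> open_unit_cube B" using T(2) c(5) by blast
    then show "?f y \<in> open_unit_cube ?B" unfolding open_unit_cube_def
      using fi s(3)[OF y] B' by (auto simp: open_unit_cube_def subset_iff)
  qed
  have fO: "?f ` \<Omega>' \<subseteq> slab ?B"
  proof (intro image_subsetI)
    fix y assume y: "y \<in> \<Omega>'"
    then have "f (drop_coord b y) \<in> slab B" "0 < s y" "s y < 1" using c(6) by (auto simp: \<Omega>'_def)
    then show "?f y \<in> slab ?B" unfolding slab_def using fi B' by (auto simp: slab_def subset_iff)
  qed
  have gf: "?g (?f y) = y" if y: "y \<in> T" for y
  proof -
    have "g (?f y) = g (f (drop_coord b y))" by (simp only: gi)
    also have "\<dots> = drop_coord b y" using c(8)[OF T(2)[OF y]] .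
    finally show ?thesis using ts[OF y] fe[OF y] drop_coord_split[of b y] by simp
  qed
  have gT: "?g ` open_unit_cube ?B \<subseteq> T" using st by blast
  have "?g u = ?g (coord_proj ?B u)" for u using gi(3)[of u] t(3)[of u] by simp
  then show "cell_chart ?B ?f ?g \<Omega>' T"
    unfolding cell_chart_def using B' T(1) oO TO fT fO gT gf fg kf kg saf sag by blast
qed

text \<open>The fibre of the band is \<open>0 < w < 1 / \<kappa>\<close>, a half-line if \<open>\<kappa> = 0\<close>. It is mapped to \<open>(0, 1)\<close> by
  \<open>s = w / (1 + w - \<kappa> w)\<close> with inverse \<open>w = s / (1 - s + \<kappa> s)\<close>.\<close>

lemma cell_chart_band_scaled:
  fixes \<epsilon> :: real
  assumes ch: "cell_chart B f g \<Omega> D" and b: "b \<in> Basis" "b \<notin> B" and D: "\<And>x. x \<in> D \<Longrightarrow> x \<bullet> b = 0"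
    and \<xi>: "cell_section B g D \<xi>" and \<kappa>: "cell_section B g D \<kappa>" "\<And>x. x \<in> D \<Longrightarrow> 0 \<le> \<kappa> x" and \<epsilon>: "\<epsilon> = 1 \<or> \<epsilon> = -1"
    and T: "T = {y. drop_coord b y \<in> D \<and> 0 < \<epsilon> * (y \<bullet> b - \<xi> (drop_coord b y)) \<and>
      \<kappa> (drop_coord b y) * (\<epsilon> * (y \<bullet> b - \<xi> (drop_coord b y))) < 1}" "semialgebraic T"
  obtains f' g' \<Omega>' where "cell_chart (insert b B) f' g' \<Omega>' T"
proof -
  note c = cell_chartD[OF ch]
  let ?B = "insert b B" and ?\<pi> = "drop_coord b"
  have B': "?B \<subseteq> Basis" using b c(1) by auto
  note sx = \<xi>[unfolded cell_section_def] \<kappa>(1)[unfolded cell_section_def]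
  have \<epsilon>\<epsilon>: "\<epsilon> * (\<epsilon> * z) = z" for z using \<epsilon> by auto
  \<comment> \<open>Nothing is known about \<open>\<xi>\<close> and \<open>\<kappa>\<close> off
    \<open>D\<close>. Read through \<open>g\<close> they become smooth on the slab, so that
    \<open>w\<close>, \<open>den\<close> and \<open>s\<close> can be differentiated on an open
    neighbourhood of \<open>T\<close>.\<close>
  define p where "p u = \<xi> (g u)" for u
  define q where "q u = \<kappa> (g u)" for u
  have kp: "kdiff k p (slab B)" and kq: "kdiff k q (slab B)" for k
    using sx by (auto simp: p_def[abs_def] q_def[abs_def])
  have pf: "p (f x) = \<xi> x" "q (f x) = \<kappa> x" if "x \<in> D" for x using c(8)[OF that] by (auto simp: p_def q_def)
  define w where "w y = \<epsilon> * (y \<bullet> b - p (f (?\<pi> y)))" for y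
  define den where "den y = 1 + w y - q (f (?\<pi> y)) * w y" for y
  define s where "s y = w y / den y" for y
  define e where "e u = 1 - u \<bullet> b + q u * (u \<bullet> b)" for u
  define t where "t u = p u + \<epsilon> * ((u \<bullet> b) / e u)" for u
  let ?O1 = "{y. ?\<pi> y \<in> \<Omega>}"
  have O1: "open ?O1" by (rule open_drop_coord_vimage[OF c(3)])
  have kpf: "kdiff k (\<lambda>y. p (f (?\<pi> y))) ?O1" "kdiff k (\<lambda>y. q (f (?\<pi> y))) ?O1" for k
    by (rule kdiff_compose[OF O1 open_slab[OF c(1)] _ kdiff_drop_coord_compose[OF c(3,10)]],
        use c(6) kp kq in auto)+
  have kw: "kdiff k w ?O1" for k unfolding w_def[abs_def]
    by (intro kdiff_mult O1 kdiff_const kdiff_diff kpf kdiff_linear bounded_linear_inner_left)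
  have kden: "kdiff k den ?O1" for k unfolding den_def[abs_def]
    by (intro kdiff_diff kdiff_add kdiff_mult O1 kdiff_const kw kpf)
  define \<Omega>2 where "\<Omega>2 = ?O1 \<inter> den -` (- {0})"
  have O2: "open \<Omega>2" unfolding \<Omega>2_def
    by (intro continuous_open_preimage O1 kdiff_continuous_on[OF kden]) auto
  have sub: "slab ?B \<subseteq> slab B" by (auto simp: slab_def)
  note gi = cell_chart_inverse_insert[OF ch b]
  note gD = gi(5)
  have sp: "semialgebraic_map_on p (open_unit_cube ?B)" "semialgebraic_map_on q (open_unit_cube ?B)"
    unfolding p_def[abs_def] q_def[abs_def]
    by (rule semialgebraic_map_on_compose[OF gi(6), of _ D]; use sx gD in auto)+
  have TD: "?\<pi> y \<in> D" if "y \<in> T" for y using that T(1) by auto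
  have wT: "w y = \<epsilon> * (y \<bullet> b - \<xi> (?\<pi> y))" "den y = 1 + w y - \<kappa> (?\<pi> y) * w y" "0 < w y" "w y < den y"
    if "y \<in> T" for y
    using that by (auto simp: w_def pf T(1) den_def)
  have ub: "0 < u \<bullet> b" "u \<bullet> b < 1" "0 < e u" if "u \<in> slab ?B" for u
  proof -
    show b: "0 < u \<bullet> b" "u \<bullet> b < 1" using that by (auto simp: slab_def)
    have "0 \<le> q u * (u \<bullet> b)" using \<kappa>(2)[OF gi(4)[OF that]] b by (simp add: q_def)
    then show "0 < e u" using b by (simp add: e_def)
  qed
  have ub': "0 < e u" if "u \<in> open_unit_cube ?B" for u using ub(3) that cube_subset_slab by blast
  show ?thesis
  proof (rule cell_chart_band[OF ch b D T(2) TD O2, of s t])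
    show "T \<subseteq> \<Omega>2"
    proof
      fix y assume y: "y \<in> T"
      then show "y \<in> \<Omega>2" using wT(3,4)[OF y] TD[OF y] c(4) by (auto simp: \<Omega>2_def)
    qed
    have s\<xi>: "semialgebraic_map_on (\<lambda>y. \<xi> (?\<pi> y)) T" "semialgebraic_map_on (\<lambda>y. \<kappa> (?\<pi> y)) T"
      by (rule semialgebraic_map_on_compose[OF semialgebraic_map_on_linear[OF T(2) bounded_linear_drop_coord], of _ D];
          use sx TD in auto)+
    have "semialgebraic_map_on (\<lambda>y. \<epsilon> * (y \<bullet> b - \<xi> (?\<pi> y))) T"
      by (intro semialgebraic_map_on_mult semialgebraic_map_on_diff s\<xi> semialgebraic_map_on_const[OF T(2)]
          semialgebraic_map_on_linear[OF T(2)] bounded_linear_inner_left)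
    then have sw: "semialgebraic_map_on w T" by (rule semialgebraic_map_on_cong) (simp add: wT(1))
    have "semialgebraic_map_on (\<lambda>y. 1 + w y - \<kappa> (?\<pi> y) * w y) T"
      by (intro semialgebraic_map_on_mult semialgebraic_map_on_add semialgebraic_map_on_diff s\<xi> sw
          semialgebraic_map_on_const[OF T(2)])
    then have "semialgebraic_map_on den T" by (rule semialgebraic_map_on_cong) (simp add: wT(2))
    then show "semialgebraic_map_on s T" unfolding s_def[abs_def]
    proof (intro semialgebraic_map_on_divide sw)
      show "den y \<noteq> 0" if "y \<in> T" for y using wT(3,4)[OF that] by simp
    qed
    show "kdiff k s \<Omega>2" for k
      unfolding s_def[abs_def]
      by (intro kdiff_divide O2 kdiff_subset[OF kw] kdiff_subset[OF kden]) (auto simp: \<Omega>2_def)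
    show "0 < s y \<and> s y < 1" if "y \<in> T" for y
      using wT(3,4)[OF that] by (auto simp: s_def)
    show "semialgebraic_map_on t (open_unit_cube ?B)"
      unfolding t_def[abs_def] e_def
      by (intro semialgebraic_map_on_add semialgebraic_map_on_mult semialgebraic_map_on_divide semialgebraic_map_on_diff sp
          semialgebraic_map_on_linear semialgebraic_map_on_const semialgebraic_open_unit_cube B' bounded_linear_inner_left)
        (use ub' in \<open>force simp: e_def\<close>)
    show "kdiff k t (slab ?B)" for k
      unfolding t_def[abs_def] e_def
      by (intro kdiff_add kdiff_mult kdiff_divide kdiff_diff open_slab B' kdiff_subset[OF kp sub]
          kdiff_subset[OF kq sub] kdiff_linear kdiff_const bounded_linear_inner_left)
        (use ub(3) in \<open>force simp: e_def\<close>)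
    show "t u = t (coord_proj ?B u)" for u
      using b by (simp add: t_def e_def p_def q_def gi(3) coord_proj_inner[OF B'])
    show "t (f (?\<pi> y) + s y *\<^sub>R b) = y \<bullet> b" if y: "y \<in> T" for y
    proof -
      have f: "f (?\<pi> y) \<in> open_unit_cube B" using c(5)[OF TD[OF y]] .
      then have "f (?\<pi> y) \<bullet> b = 0" using b by (auto simp: open_unit_cube_def)
      then have "t (f (?\<pi> y) + s y *\<^sub>R b) = \<xi> (?\<pi> y) + \<epsilon> * (s y / (1 - s y + \<kappa> (?\<pi> y) * s y))"
        using b c(8)[OF TD[OF y]] by (simp add: t_def e_def p_def q_def inner_add_left gi(1))
      also have "1 - s y + \<kappa> (?\<pi> y) * s y = (den y - w y + \<kappa> (?\<pi> y) * w y) / den y"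
        using wT(3,4)[OF y] by (simp add: s_def diff_divide_distrib add_divide_distrib)
      also have "den y - w y + \<kappa> (?\<pi> y) * w y = 1" using wT(2)[OF y] by simp
      also have "s y / (1 / den y) = w y" using wT(3,4)[OF y] by (simp add: s_def)
      finally show ?thesis using wT(1)[OF y] by (simp add: \<epsilon>\<epsilon>)
    qed
    show "g u + t u *\<^sub>R b \<in> T \<and> s (g u + t u *\<^sub>R b) = u \<bullet> b" if u: "u \<in> open_unit_cube ?B" for u
    proof -
      have u': "u \<in> slab ?B" using u cube_subset_slab by blast
      note ub = ub[OF u']
      have d: "?\<pi> (g u + t u *\<^sub>R b) = g u" "(g u + t u *\<^sub>R b) \<bullet> b = t u"
        using D[OF gD[OF u]] b by (auto simp: drop_coord_add inner_add_left)
      have r: "\<epsilon> * (t u - \<xi> (g u)) = (u \<bullet> b) / e u" by (simp add: t_def p_def \<epsilon>\<epsilon>)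
      have "q u * (u \<bullet> b) < e u" using ub by (simp add: e_def)
      then have "\<kappa> (g u) * ((u \<bullet> b) / e u) < 1" using ub by (simp add: q_def)
      then have gT: "g u + t u *\<^sub>R b \<in> T" using d r gD[OF u] ub by (simp add: T(1))
      have w: "w (g u + t u *\<^sub>R b) = (u \<bullet> b) / e u"
        using r d pf[OF gD[OF u]] by (simp add: w_def)
      have "den (g u + t u *\<^sub>R b) = 1 / e u"
        using ub(3) unfolding wT(2)[OF gT] w d by (simp add: e_def q_def field_simps)
      then have "s (g u + t u *\<^sub>R b) = u \<bullet> b" using ub w by (simp add: s_def)
      with gT show ?thesis by blast
    qed
  qed (assumption | rule that)+
qed

text \<open>The scaled band with \<open>\<epsilon> = 1\<close> and with \<open>\<kappa>\<close> the
  reciprocal of the length of the fibre.\<close>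

lemma cell_chart_band_between:
  assumes ch: "cell_chart B f g \<Omega> D" and b: "b \<in> Basis" "b \<notin> B" and D: "\<And>x. x \<in> D \<Longrightarrow> x \<bullet> b = 0"
    and \<xi>: "cell_section B g D \<xi>" and \<zeta>: "cell_section B g D \<zeta>" and lt: "\<And>x. x \<in> D \<Longrightarrow> \<xi> x < \<zeta> x"
    and T: "T = {y. drop_coord b y \<in> D \<and> \<xi> (drop_coord b y) < y \<bullet> b \<and> y \<bullet> b < \<zeta> (drop_coord b y)}"
      "semialgebraic T"
  obtains f' g' \<Omega>' where "cell_chart (insert b B) f' g' \<Omega>' T"
proof -
  note c = cell_chartD[OF ch]
  let ?\<kappa> = "\<lambda>x. 1 / (\<zeta> x - \<xi> x)"
  have "semialgebraic_map_on ?\<kappa> D"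
    using \<xi> \<zeta> lt unfolding cell_section_def
    by (intro semialgebraic_map_on_divide semialgebraic_map_on_diff semialgebraic_map_on_const c(2)) force+
  moreover have "kdiff k (\<lambda>u. ?\<kappa> (g u)) (slab B)" for k
    using \<xi> \<zeta> lt[OF c(15)] unfolding cell_section_def
    by (intro kdiff_divide kdiff_diff kdiff_const open_slab c(1)) force+
  ultimately have \<kappa>: "cell_section B g D ?\<kappa>" by (simp add: cell_section_def)
  have "?\<kappa> x * (1 * (r - \<xi> x)) < 1 \<longleftrightarrow> r < \<zeta> x" "0 \<le> ?\<kappa> x" if "x \<in> D" for r x
    using lt[OF that] by (simp_all add: pos_divide_less_eq)
  then have "T = {y. drop_coord b y \<in> D \<and> 0 < 1 * (y \<bullet> b - \<xi> (drop_coord b y)) \<and>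
      ?\<kappa> (drop_coord b y) * (1 * (y \<bullet> b - \<xi> (drop_coord b y))) < 1}"
    unfolding T(1) by (auto simp del: mult_1_left)
  from cell_chart_band_scaled[OF ch b D \<xi> \<kappa> _ disjI1[OF refl] this T(2)] lt that
  show ?thesis by (metis diff_ge_0_iff_ge less_imp_le zero_le_divide_1_iff)
qed

text \<open>The scaled band with \<open>\<kappa> = 0\<close>, whose fibres are half-lines, upward or
  downward according to \<open>\<epsilon>\<close>.\<close>

lemma cell_chart_band_beyond:
  fixes \<epsilon> :: real
  assumes ch: "cell_chart B f g \<Omega> D" and b: "b \<in> Basis" "b \<notin> B" and D: "\<And>x. x \<in> D \<Longrightarrow> x \<bullet> b = 0"
    and \<xi>: "cell_section B g D \<xi>" and \<epsilon>: "\<epsilon> = 1 \<or> \<epsilon> = -1"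
    and T: "T = {y. drop_coord b y \<in> D \<and> 0 < \<epsilon> * (y \<bullet> b - \<xi> (drop_coord b y))}" "semialgebraic T"
  obtains f' g' \<Omega>' where "cell_chart (insert b B) f' g' \<Omega>' T"
proof (rule cell_chart_band_scaled[OF ch b D \<xi> _ _ \<epsilon> _ T(2)])
  show "cell_section B g D (\<lambda>x. 0)"
    by (simp add: cell_section_def kdiff_const semialgebraic_map_on_const cell_chartD(2)[OF ch])
qed (use T(1) that in auto)

text \<open>A continuous section through simple zeros is smooth: \<open>kdiff_implicit\<close>
  applies to its pullback to the slab.\<close>

lemma cell_sectionI:
  assumes ch: "cell_chart B f g \<Omega> D" and \<xi>: "continuous_on D \<xi>" "semialgebraic_map_on \<xi> D"
    and q: "real_polynomial_function q" "\<And>x. x \<in> D \<Longrightarrow> q (x + \<xi> x *\<^sub>R b) = 0"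
      "\<And>x. x \<in> D \<Longrightarrow> dird b q (x + \<xi> x *\<^sub>R b) \<noteq> 0"
  shows "cell_section B g D \<xi>"
proof -
  note c = cell_chartD[OF ch]
  have "continuous_on (slab B) (\<lambda>u. \<xi> (g u))"
    by (rule continuous_on_compose2[OF \<xi>(1) kdiff_continuous_on[OF c(11)]]) (use c(15) in auto)
  then have "kdiff k (\<lambda>u. \<xi> (g u)) (slab B)" for k
    by (intro kdiff_implicit[OF open_slab[OF c(1)] q(1) c(11)]) (use q c(15) in auto)
  then show ?thesis using \<xi>(2) by (simp add: cell_section_def)
qed

section \<open>Cylindrical decomposition\<close>

lemma pderiv_funpow_eq_0: "degree p < i \<Longrightarrow> (pderiv ^^ i) p = (0 :: real poly)"
proof (induction i arbitrary: p)
  case (Suc i)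
  show ?case
  proof (cases "degree p = 0")
    case True
    then have "pderiv p = 0" by (simp add: pderiv_eq_0_iff)
    moreover have "(pderiv ^^ i) (0 :: real poly) = 0" by (induction i) auto
    ultimately show ?thesis by (simp only: funpow_Suc_right o_def)
  next
    case False
    then have "(pderiv ^^ i) (pderiv p) = 0" using Suc by (intro Suc.IH) (simp add: degree_pderiv)
    then show ?thesis by (simp only: funpow_Suc_right o_def)
  qed
qed simp

lemma poly_all_derivs_0:
  fixes p :: "real poly"
  assumes "\<And>i. poly ((pderiv ^^ i) p) t = 0" shows "p = 0"
  using assms
proof (induction "degree p" arbitrary: p)
  case 0
  then obtain k where "p = [:k:]" by (metis degree_eq_zeroE)
  then show ?case using 0(2)[of 0] by simp
next
  case (Suc n)
  have "pderiv p = 0"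
  proof (rule Suc.hyps(1))
    show "n = degree (pderiv p)" using Suc.hyps(2) by (simp add: degree_pderiv)
    show "poly ((pderiv ^^ i) (pderiv p)) t = 0" for i
      using Suc.prems[of "Suc i"] by (simp only: funpow_Suc_right o_def)
  qed
  then show ?case using Suc.hyps(2) by (simp add: pderiv_eq_0_iff)
qed

lemma dird_funpow_polynomial:
  "real_polynomial_function f \<Longrightarrow> real_polynomial_function ((dird b ^^ i) f)"
  by (induction i) (auto intro: dird_polynomial)

lemma dird_funpow_along:
  assumes "real_polynomial_function f" "\<And>x t. f (x + t *\<^sub>R b) = poly (P x) t"
  shows "(dird b ^^ i) f (x + t *\<^sub>R b) = poly ((pderiv ^^ i) (P x)) t"
proof (induction i arbitrary: x t)
  case 0
  then show ?case using assms(2) by simp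
next
  case (Suc i)
  show ?case
    using dird_along[OF dird_funpow_polynomial[OF assms(1)] Suc.IH] by simp
qed

lemma ex_between_notin_finite:
  fixes a c :: real assumes "a < c" "finite Z" shows "\<exists>t. a < t \<and> t < c \<and> t \<notin> Z"
proof -
  have "infinite {a<..<c}" using assms(1) by (simp add: infinite_Ioo)
  then have "\<not> {a<..<c} \<subseteq> Z" using assms(2) finite_subset by blast
  then show ?thesis by auto
qed

text \<open>Closure under \<open>dird b\<close> makes Thom's lemma applicable and supplies simple
  roots. The coordinate along \<open>b\<close> is a member so that every fibre has a root and no
  sign class contains a whole line.\<close>

locale fibre_family =
  fixes F :: "('a::euclidean_space \<Rightarrow> real) set" and b :: 'a
  assumes finF: "finite F" and polyF: "f \<in> F \<Longrightarrow> real_polynomial_function f"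
    and closedF: "f \<in> F \<Longrightarrow> dird b f \<in> F" and b: "b \<in> Basis" and coordF: "(\<lambda>x. x \<bullet> b) \<in> F"
begin

definition same :: "'a \<Rightarrow> 'a \<Rightarrow> bool" where
  "same x y \<longleftrightarrow> (\<forall>f\<in>F. sgn (f x) = sgn (f y))"

text \<open>Members vanishing identically on the line are excluded, which keeps the set
  finite.\<close>

definition roots :: "'a \<Rightarrow> real set" where
  "roots x = {t. \<exists>f\<in>F. f (x + t *\<^sub>R b) = 0 \<and> (\<exists>s. f (x + s *\<^sub>R b) \<noteq> 0)}"

lemma same_sym: "same x y \<Longrightarrow> same y x"
  by (simp add: same_def)

lemma same_trans: "same x y \<Longrightarrow> same y z \<Longrightarrow> same x z"
  by (simp add: same_def)

lemma same_zero: "same x y \<Longrightarrow> f \<in> F \<Longrightarrow> f x = 0 \<longleftrightarrow> f y = 0"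
  unfolding same_def by (metis sgn_zero_iff)

lemma funpowF: "f \<in> F \<Longrightarrow> (dird b ^^ i) f \<in> F"
  by (induction i) (auto intro: closedF)

lemma alongE:
  assumes "f \<in> F"
  obtains P where "\<And>x t i. (dird b ^^ i) f (x + t *\<^sub>R b) = poly ((pderiv ^^ i) (P x)) t"
    "\<And>x t. f (x + t *\<^sub>R b) = poly (P x) t"
proof -
  obtain P where P: "\<And>x t. f (x + t *\<^sub>R b) = poly (P x) t"
    using poly_family_along[OF polyF[OF assms]] by blast
  show ?thesis using that[of P] dird_funpow_along[OF polyF[OF assms] P] P by blast
qed

lemma same_between:
  assumes "same (x + t1 *\<^sub>R b) (x + t2 *\<^sub>R b)" "t1 \<le> t" "t \<le> t2"
  shows "same (x + t *\<^sub>R b) (x + t1 *\<^sub>R b)"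
  unfolding same_def
proof
  fix f assume f: "f \<in> F"
  obtain P where P: "\<And>x t i. (dird b ^^ i) f (x + t *\<^sub>R b) = poly ((pderiv ^^ i) (P x)) t"
    "\<And>x t. f (x + t *\<^sub>R b) = poly (P x) t" using alongE[OF f] by metis
  show "sgn (f (x + t *\<^sub>R b)) = sgn (f (x + t1 *\<^sub>R b))"
    unfolding P(2)
  proof (rule thom_sign_between[OF _ assms(2,3)])
    show "sgn (poly ((pderiv ^^ i) (P x)) t1) = sgn (poly ((pderiv ^^ i) (P x)) t2)" for i
      using assms(1) funpowF[OF f, of i] unfolding P(1)[symmetric] same_def by blast
  qed
qed

lemma finite_fibre_zeros:
  assumes "f \<in> F" "f (x + s *\<^sub>R b) \<noteq> 0" shows "finite {t. f (x + t *\<^sub>R b) = 0}"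
proof -
  obtain P where P: "\<And>x t. f (x + t *\<^sub>R b) = poly (P x) t" using alongE[OF assms(1)] by metis
  then have "P x \<noteq> 0" using assms(2) by auto
  then show ?thesis unfolding P by (rule poly_roots_finite)
qed

lemma finite_roots: "finite (roots x)"
proof -
  have "finite (\<Union>f\<in>{f\<in>F. \<exists>s. f (x + s *\<^sub>R b) \<noteq> 0}. {t. f (x + t *\<^sub>R b) = 0})"
    using finF finite_fibre_zeros by auto
  then show ?thesis by (rule rev_finite_subset) (auto simp: roots_def)
qed

lemma roots_nonempty: assumes "x \<bullet> b = 0" shows "0 \<in> roots x"
  unfolding roots_def mem_Collect_eq
  by (rule bexI[OF _ coordF]) (use assms b in \<open>auto simp: inner_add_left intro!: exI[of _ 1]\<close>)

text \<open>By Thom's lemma a root in between would make some member vanish on the whole interval,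
  although it has only finitely many zeros on this line.\<close>

lemma same_no_root_between:
  assumes "same (x + t1 *\<^sub>R b) (x + t2 *\<^sub>R b)" "t1 < t2" "t1 \<le> t" "t \<le> t2"
  shows "t \<notin> roots x"
proof
  assume "t \<in> roots x"
  then obtain f s where f: "f \<in> F" "f (x + t *\<^sub>R b) = 0" "f (x + s *\<^sub>R b) \<noteq> 0" by (auto simp: roots_def)
  have z: "f (x + u *\<^sub>R b) = 0" if "t1 \<le> u" "u \<le> t2" for u
    using same_zero[OF same_between[OF assms(1) that] f(1)] same_zero[OF same_between[OF assms(1,3,4)] f(1)] f(2) by simp
  have "{t1..t2} \<subseteq> {u. f (x + u *\<^sub>R b) = 0}" using z by auto
  then have "finite {t1..t2}" using finite_fibre_zeros[OF f(1,3)] finite_subset by blast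
  then show False using assms(2) by (simp add: infinite_Icc)
qed

lemma same_if_no_root_between:
  assumes "\<And>z. z \<in> roots x \<Longrightarrow> \<not> (t1 \<le> z \<and> z \<le> t2)" "t1 \<le> t2"
  shows "same (x + t1 *\<^sub>R b) (x + t2 *\<^sub>R b)"
  unfolding same_def
proof
  fix f assume f: "f \<in> F"
  show "sgn (f (x + t1 *\<^sub>R b)) = sgn (f (x + t2 *\<^sub>R b))"
  proof (cases "\<exists>s. f (x + s *\<^sub>R b) \<noteq> 0")
    case True
    obtain P where P: "\<And>x t. f (x + t *\<^sub>R b) = poly (P x) t" using alongE[OF f] by metis
    have nz: "poly (P x) t \<noteq> 0" if "t1 \<le> t" "t \<le> t2" for t
    proof
      assume "poly (P x) t = 0"
      then have "t \<in> roots x" unfolding roots_def mem_Collect_eq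
        by (intro bexI[OF _ f] conjI True) (simp add: P)
      then show False using assms(1) that by blast
    qed
    have "\<not> poly (P x) t1 * poly (P x) t2 < 0"
    proof
      assume "poly (P x) t1 * poly (P x) t2 < 0"
      moreover from this have "t1 \<noteq> t2" by (auto simp: mult_less_0_iff)
      ultimately obtain t where "t1 < t" "t < t2" "poly (P x) t = 0" using poly_IVT[of t1 t2 "P x"] assms(2) by auto
      then show False using nz by auto
    qed
    then show ?thesis unfolding P using nz[of t1] nz[of t2] assms(2)
      by (auto simp: sgn_real_def mult_less_0_iff)
  qed simp
qed

text \<open>Differentiate along the fibre until the next derivative no longer vanishes at
  \<open>t\<close>; the closed family contains the result.\<close>

lemma simple_root:
  assumes "t \<in> roots x"
  obtains q where "q \<in> F" "q (x + t *\<^sub>R b) = 0" "dird b q (x + t *\<^sub>R b) \<noteq> 0"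
proof -
  obtain f s where f: "f \<in> F" "f (x + t *\<^sub>R b) = 0" "f (x + s *\<^sub>R b) \<noteq> 0" using assms by (auto simp: roots_def)
  obtain P where P: "\<And>x t i. (dird b ^^ i) f (x + t *\<^sub>R b) = poly ((pderiv ^^ i) (P x)) t"
    "\<And>x t. f (x + t *\<^sub>R b) = poly (P x) t" using alongE[OF f(1)] by metis
  have "P x \<noteq> 0" using f(3) P(2) by auto
  then have "\<exists>i. (dird b ^^ i) f (x + t *\<^sub>R b) \<noteq> 0"
    using poly_all_derivs_0[of "P x" t] by (auto simp: P(1))
  then obtain n where n: "(dird b ^^ n) f (x + t *\<^sub>R b) \<noteq> 0" "\<And>i. i < n \<Longrightarrow> (dird b ^^ i) f (x + t *\<^sub>R b) = 0"
    using exists_least_iff[of "\<lambda>i. (dird b ^^ i) f (x + t *\<^sub>R b) \<noteq> 0"] by auto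
  then obtain j where "n = Suc j" using f(2) by (cases n) auto
  then show ?thesis using that[of "(dird b ^^ j) f"] funpowF[OF f(1)] n by auto
qed

end

text \<open>The cell \<open>D\<close> lies in the hyperplane orthogonal to \<open>b\<close>. The
  condition \<open>equiv\<close> will hold because \<open>D\<close> is sign-invariant for the
  polynomials produced by the elimination.\<close>

locale fibre_cell = fibre_family F b for F :: "('a::euclidean_space \<Rightarrow> real) set" and b +
  fixes B \<phi> \<gamma> \<Omega> D
  assumes ch: "cell_chart B \<phi> \<gamma> \<Omega> D" and Db: "x \<in> D \<Longrightarrow> x \<bullet> b = 0" and bB: "b \<notin> B"
    and equiv: "x \<in> D \<Longrightarrow> y \<in> D \<Longrightarrow> \<exists>\<theta>. strict_mono \<theta> \<and> surj \<theta> \<and>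
      (\<forall>f\<in>F. \<forall>t. sgn (f (x + t *\<^sub>R b)) = sgn (f (y + \<theta> t *\<^sub>R b)))"
begin

lemma equivE:
  assumes "x \<in> D" "y \<in> D"
  obtains \<theta> where "\<And>s t. \<theta> s < \<theta> t \<longleftrightarrow> s < t" "\<And>t. \<exists>s. \<theta> s = t"
    "\<And>t. same (x + t *\<^sub>R b) (y + \<theta> t *\<^sub>R b)"
proof -
  obtain \<theta> where "strict_mono \<theta>" "surj \<theta>"
    "\<forall>f\<in>F. \<forall>t. sgn (f (x + t *\<^sub>R b)) = sgn (f (y + \<theta> t *\<^sub>R b))" using equiv[OF assms] by blast
  then show ?thesis using that[of \<theta>] by (auto simp: strict_mono_less same_def surj_def) metis
qed

lemma nontrivial_transfer:
  assumes "x \<in> D" "y \<in> D" "f \<in> F" "f (x + s *\<^sub>R b) \<noteq> 0" shows "\<exists>t. f (y + t *\<^sub>R b) \<noteq> 0"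
  using equivE[OF assms(1,2)] same_zero assms(3,4) by metis

lemma roots_same:
  assumes "x \<in> D" "y \<in> D" "same (x + s *\<^sub>R b) (y + t *\<^sub>R b)" "s \<in> roots x" shows "t \<in> roots y"
proof -
  obtain f r where "f \<in> F" "f (x + s *\<^sub>R b) = 0" "f (x + r *\<^sub>R b) \<noteq> 0" using assms(4) by (auto simp: roots_def)
  then show ?thesis unfolding roots_def
    using nontrivial_transfer[OF assms(1,2)] same_zero[OF assms(3)] by blast
qed

lemma same_root_unique:
  assumes "same (x + s *\<^sub>R b) (x + t *\<^sub>R b)" "s \<in> roots x" shows "s = t"
proof (rule ccontr)
  assume "s \<noteq> t"
  then consider "s < t" | "t < s" by linarith
  then show False
    by cases (use same_no_root_between[OF assms(1), of s] same_no_root_between[OF same_sym[OF assms(1)], of s] assms(2) in auto)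
qed

text \<open>A member that vanishes identically on one fibre does so on every fibre over
  \<open>D\<close>; any other is nonzero at \<open>t\<close>, and continuity preserves its
  sign.\<close>

lemma eventually_same:
  assumes x: "x \<in> D" and t: "t \<notin> roots x"
  shows "\<forall>\<^sub>F y in at x within D. same (x + t *\<^sub>R b) (y + t *\<^sub>R b)"
  unfolding same_def
proof (rule eventually_ball_finite[OF finF], rule ballI)
  fix h assume h: "h \<in> F"
  show "\<forall>\<^sub>F y in at x within D. sgn (h (x + t *\<^sub>R b)) = sgn (h (y + t *\<^sub>R b))"
  proof (cases "\<exists>s. h (x + s *\<^sub>R b) \<noteq> 0")
    case False
    have "h (y + t *\<^sub>R b) = 0" if "y \<in> D" for y
      using nontrivial_transfer[OF that x h] False by blast
    then show ?thesis using False by (auto simp: eventually_at_filter)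
  next
    case True
    then have nz: "h (x + t *\<^sub>R b) \<noteq> 0" using t h by (auto simp: roots_def)
    have "continuous_on UNIV h" by (rule kdiff_continuous_on[OF kdiff_polynomial[OF polyF[OF h] open_UNIV]])
    then have "continuous_on UNIV (\<lambda>y. h (y + t *\<^sub>R b))"
      by (rule continuous_on_compose2) (auto intro!: continuous_intros)
    then have "((\<lambda>y. h (y + t *\<^sub>R b)) \<longlongrightarrow> h (x + t *\<^sub>R b)) (at x within D)"
      by (meson continuous_on_def tendsto_within_subset UNIV_I subset_UNIV)
    from tendsto_sgn[OF this nz]
    have l: "((\<lambda>y. sgn (h (y + t *\<^sub>R b))) \<longlongrightarrow> sgn (h (x + t *\<^sub>R b))) (at x within D)" .
    have "\<forall>\<^sub>F y in at x within D. dist (sgn (h (y + t *\<^sub>R b))) (sgn (h (x + t *\<^sub>R b))) < 1"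
      using tendstoD[OF l, of 1] by simp
    then show ?thesis
      by (rule eventually_mono) (auto simp: sgn_real_def dist_real_def split: if_splits)
  qed
qed

text \<open>At a point \<open>t\<close> that is not in \<open>roots x\<close> the sign vector persists on nearby fibres. As it sits on the
  same side of the section in every fibre, \<open>t < \<xi> x\<close> implies \<open>t < \<xi> y\<close> for \<open>y\<close> near \<open>x\<close>, whence the
  continuity of \<open>\<xi>\<close>.\<close>

lemma section_exists:
  assumes x0: "x0 \<in> D" and z: "z \<in> roots x0"
  obtains \<xi> where "cell_section B \<gamma> D \<xi>" "\<And>x. x \<in> D \<Longrightarrow> same (x0 + z *\<^sub>R b) (x + \<xi> x *\<^sub>R b)"
    "\<And>x t. x \<in> D \<Longrightarrow> same (x0 + z *\<^sub>R b) (x + t *\<^sub>R b) \<Longrightarrow> t = \<xi> x"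
proof -
  have "\<forall>x\<in>D. \<exists>t. same (x0 + z *\<^sub>R b) (x + t *\<^sub>R b)" using equivE[OF x0] by metis
  then obtain \<xi> where \<xi>: "\<And>x. x \<in> D \<Longrightarrow> same (x0 + z *\<^sub>R b) (x + \<xi> x *\<^sub>R b)" by metis
  have root: "\<xi> x \<in> roots x" if "x \<in> D" for x using roots_same[OF x0 that \<xi>[OF that] z] .
  have uniq: "t = \<xi> x" if "x \<in> D" "same (x0 + z *\<^sub>R b) (x + t *\<^sub>R b)" for x t
    using same_root_unique[OF same_trans[OF same_sym[OF \<xi>[OF that(1)]] that(2)] root[OF that(1)]] by simp
  \<comment> \<open>The matching of the fibres sends \<open>\<xi> x\<close> to
    \<open>\<xi> y\<close> and some \<open>r\<close> to \<open>t\<close>. As \<open>r\<close> and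
    \<open>t\<close> share a sign class on the fibre of \<open>x\<close>, no root separates them, so
    both are on the same side of \<open>\<xi> x\<close>.\<close>
  have order: "(t < \<xi> x \<longrightarrow> t < \<xi> y) \<and> (\<xi> x < t \<longrightarrow> \<xi> y < t)"
    if xy: "x \<in> D" "y \<in> D" and t: "t \<notin> roots x" and s: "same (x + t *\<^sub>R b) (y + t *\<^sub>R b)" for x y t
  proof -
    obtain \<theta> where \<theta>: "\<And>s t. \<theta> s < \<theta> t \<longleftrightarrow> s < t" "\<And>t. \<exists>s. \<theta> s = t"
      "\<And>t. same (x + t *\<^sub>R b) (y + \<theta> t *\<^sub>R b)" using equivE[OF xy] by metis
    obtain r where r: "\<theta> r = t" using \<theta>(2) by blast
    have e: "\<theta> (\<xi> x) = \<xi> y" by (rule uniq[OF xy(2) same_trans[OF \<xi>[OF xy(1)] \<theta>(3)]])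
    have rt: "same (x + r *\<^sub>R b) (x + t *\<^sub>R b)" using same_trans[OF \<theta>(3)[of r] same_sym[OF s[folded r]]] r by simp
    have "\<not> (t \<le> \<xi> x \<and> \<xi> x \<le> r)" "\<not> (r \<le> \<xi> x \<and> \<xi> x \<le> t)"
      using same_no_root_between[OF rt, of "\<xi> x"] same_no_root_between[OF same_sym[OF rt], of "\<xi> x"]
        root[OF xy(1)] t by (metis order.trans order_le_less order_antisym)+
    moreover have "t < \<xi> y \<longleftrightarrow> r < \<xi> x" "\<xi> y < t \<longleftrightarrow> \<xi> x < r" using \<theta>(1) e r by metis+
    ultimately show ?thesis by auto
  qed
  have "continuous_on D \<xi>" unfolding continuous_on_def
  proof (intro ballI order_tendstoI)
    fix x a assume x: "x \<in> D" and "a < \<xi> x"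
    then obtain t where t: "a < t" "t < \<xi> x" "t \<notin> roots x"
      using ex_between_notin_finite[OF _ finite_roots] by blast
    have "\<forall>\<^sub>F y in at x within D. y \<in> D" by (auto simp: eventually_at_filter)
    with eventually_same[OF x t(3)] show "\<forall>\<^sub>F y in at x within D. a < \<xi> y"
    proof eventually_elim
      case (elim y)
      then show ?case using order[OF x elim(2) t(3) elim(1)] t by auto
    qed
  next
    fix x a assume x: "x \<in> D" and "\<xi> x < a"
    then obtain t where t: "\<xi> x < t" "t < a" "t \<notin> roots x"
      using ex_between_notin_finite[OF _ finite_roots] by blast
    have "\<forall>\<^sub>F y in at x within D. y \<in> D" by (auto simp: eventually_at_filter)
    with eventually_same[OF x t(3)] show "\<forall>\<^sub>F y in at x within D. \<xi> y < a"
    proof eventually_elim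
      case (elim y)
      then show ?case using order[OF x elim(2) t(3) elim(1)] t by auto
    qed
  qed
  moreover have "semialgebraic_map_on \<xi> D"
  proof (rule semialgebraic_map_onI)
    \<comment> \<open>Over \<open>D\<close> the graph is cut out by one sign vector, which occurs
      exactly once on each fibre.\<close>
    let ?S = "{y. \<forall>h\<in>F. sgn (h y) \<in> {sgn (h (x0 + z *\<^sub>R b))}}"
    have "semialgebraic ?S" by (intro semialgebraic_Collect_ball finF semialgebraic_sgn polyF)
    then have "semialgebraic {w :: 'a \<times> real. fst w \<in> D \<and> fst w + snd w *\<^sub>R b \<in> ?S}"
      by (intro semialgebraic_Collect_conj semialgebraic_vimage cell_chartD(2)[OF ch] polynomial_intros)
    also have "{w :: 'a \<times> real. fst w \<in> D \<and> fst w + snd w *\<^sub>R b \<in> ?S} = {w. fst w \<in> D \<and> snd w = \<xi> (fst w)}"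
      using \<xi> uniq unfolding same_def by (auto simp: eq_commute)
    finally show "semialgebraic {w. fst w \<in> D \<and> snd w = \<xi> (fst w)}" .
  qed
  moreover obtain q where q: "q \<in> F" "q (x0 + z *\<^sub>R b) = 0" "dird b q (x0 + z *\<^sub>R b) \<noteq> 0"
    using simple_root[OF z] by blast
  ultimately have "cell_section B \<gamma> D \<xi>"
    by (intro cell_sectionI[OF ch _ _ polyF[OF q(1)]])
      (use q \<xi> same_zero closedF in blast)+
  then show ?thesis using that \<xi> uniq by blast
qed

text \<open>If the height of \<open>y0\<close> is a root on its fibre, the class is the graph of a
  section. Otherwise it is the band delimited by the sections through the neighbouring roots,
  unbounded on at most one side.\<close>

lemma sign_cell_chart:
  assumes y0: "drop_coord b y0 \<in> D"
  shows "\<exists>B' f' g' \<Omega>'. B' \<subseteq> insert b B \<and>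
    cell_chart B' f' g' \<Omega>' {y. drop_coord b y \<in> D \<and> same y y0}" (is "\<exists>B' f' g' \<Omega>'. _ \<and> cell_chart B' f' g' \<Omega>' ?K")
proof -
  define x0 where "x0 = drop_coord b y0"
  define t0 where "t0 = y0 \<bullet> b"
  have x0: "x0 \<in> D" using y0 by (simp add: x0_def)
  have y0e: "y0 = x0 + t0 *\<^sub>R b" by (simp add: x0_def t0_def drop_coord_split)
  have K: "y \<in> ?K \<longleftrightarrow> drop_coord b y \<in> D \<and> same (x0 + t0 *\<^sub>R b) (drop_coord b y + (y \<bullet> b) *\<^sub>R b)" for y
    using same_sym y0e by (auto simp: drop_coord_split)
  have sK: "semialgebraic ?K"
  proof -
    have "semialgebraic {y. drop_coord b y \<in> D \<and> (\<forall>h\<in>F. sgn (h y) \<in> {sgn (h y0)})}"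
      by (intro semialgebraic_Collect_conj semialgebraic_Collect_ball finF semialgebraic_sgn polyF
          semialgebraic_vimage cell_chartD(2)[OF ch] polynomial_function_bounded_linear bounded_linear_drop_coord)
    then show ?thesis by (simp add: same_def)
  qed
  show ?thesis
  proof (cases "t0 \<in> roots x0")
    case True
    obtain \<xi> where \<xi>: "cell_section B \<gamma> D \<xi>" "\<And>x. x \<in> D \<Longrightarrow> same (x0 + t0 *\<^sub>R b) (x + \<xi> x *\<^sub>R b)"
      "\<And>x t. x \<in> D \<Longrightarrow> same (x0 + t0 *\<^sub>R b) (x + t *\<^sub>R b) \<Longrightarrow> t = \<xi> x"
      using section_exists[OF x0 True] by metis
    have e: "?K = {y. drop_coord b y \<in> D \<and> y \<bullet> b = \<xi> (drop_coord b y)}"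
      using K \<xi>(2,3) by auto
    obtain f' g' \<Omega>' where "cell_chart B f' g' \<Omega>' ?K"
      unfolding e by (rule cell_chart_graph[OF ch b Db \<xi>(1)])
    then show ?thesis by (intro exI conjI) (rule subset_insertI)
  next
    case False
    let ?A = "{z\<in>roots x0. z < t0}" and ?C = "{z\<in>roots x0. t0 < z}"
    \<comment> \<open>On the fibre of \<open>x0\<close> the class of \<open>t0\<close> is the
      interval between neighbouring roots; \<open>fib\<close> transports this description to all
      fibres by the order-preserving matchings.\<close>
    have I0: "same (x0 + t0 *\<^sub>R b) (x0 + s *\<^sub>R b) \<longleftrightarrow> (\<forall>z\<in>?A. z < s) \<and> (\<forall>z\<in>?C. s < z)" for s
    proof
      assume s: "same (x0 + t0 *\<^sub>R b) (x0 + s *\<^sub>R b)"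
      show "(\<forall>z\<in>?A. z < s) \<and> (\<forall>z\<in>?C. s < z)"
      proof (intro conjI ballI)
        fix z assume "z \<in> ?A"
        then show "z < s" using same_no_root_between[OF same_sym[OF s], of z] by (auto simp: not_less[symmetric]) 
      next
        fix z assume "z \<in> ?C"
        then show "s < z" using same_no_root_between[OF s, of z] by (auto simp: not_less[symmetric])
      qed
    next
      assume r: "(\<forall>z\<in>?A. z < s) \<and> (\<forall>z\<in>?C. s < z)"
      have no: "\<not> (z \<le> t0 \<and> s \<le> z)" "\<not> (z \<le> s \<and> t0 \<le> z)" if "z \<in> roots x0" for z
        using r that False by (auto simp: order_le_less)
      show "same (x0 + t0 *\<^sub>R b) (x0 + s *\<^sub>R b)"
      proof (cases "t0 \<le> s")
        case True
        then show ?thesis using no by (intro same_if_no_root_between) blast+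
      next
        case False
        then show ?thesis using no by (intro same_sym[OF same_if_no_root_between]) auto
      qed
    qed
    have "\<exists>\<xi>. \<forall>z\<in>roots x0. cell_section B \<gamma> D (\<xi> z) \<and> (\<forall>x\<in>D. same (x0 + z *\<^sub>R b) (x + \<xi> z x *\<^sub>R b)) \<and>
      (\<forall>x\<in>D. \<forall>t. same (x0 + z *\<^sub>R b) (x + t *\<^sub>R b) \<longrightarrow> t = \<xi> z x)"
      by (rule bchoice) (meson section_exists[OF x0])
    then obtain \<xi> where \<xi>: "\<And>z. z \<in> roots x0 \<Longrightarrow> cell_section B \<gamma> D (\<xi> z)"
      and \<xi>u: "\<And>z x t. z \<in> roots x0 \<Longrightarrow> x \<in> D \<Longrightarrow> same (x0 + z *\<^sub>R b) (x + t *\<^sub>R b) \<Longrightarrow> t = \<xi> z x" by metis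
    have fib: "same (x0 + t0 *\<^sub>R b) (x + t *\<^sub>R b) \<longleftrightarrow> (\<forall>z\<in>?A. \<xi> z x < t) \<and> (\<forall>z\<in>?C. t < \<xi> z x)"
      and mono: "\<And>z z'. z \<in> roots x0 \<Longrightarrow> z' \<in> roots x0 \<Longrightarrow> z < z' \<Longrightarrow> \<xi> z x < \<xi> z' x" if x: "x \<in> D" for x t
    proof -
      obtain \<theta> where \<theta>: "\<And>s t. \<theta> s < \<theta> t \<longleftrightarrow> s < t" "\<And>t. \<exists>s. \<theta> s = t"
        "\<And>t. same (x0 + t *\<^sub>R b) (x + \<theta> t *\<^sub>R b)" using equivE[OF x0 x] by metis
      have e: "\<theta> z = \<xi> z x" if "z \<in> roots x0" for z by (rule \<xi>u[OF that x \<theta>(3)])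
      show "\<And>z z'. z \<in> roots x0 \<Longrightarrow> z' \<in> roots x0 \<Longrightarrow> z < z' \<Longrightarrow> \<xi> z x < \<xi> z' x" using \<theta>(1) e by metis
      obtain s where s: "\<theta> s = t" using \<theta>(2) by blast
      have "same (x0 + t0 *\<^sub>R b) (x + t *\<^sub>R b) \<longleftrightarrow> same (x0 + t0 *\<^sub>R b) (x0 + s *\<^sub>R b)"
        using \<theta>(3)[of s] s same_trans same_sym by metis
      also have "\<dots> \<longleftrightarrow> (\<forall>z\<in>?A. \<theta> z < \<theta> s) \<and> (\<forall>z\<in>?C. \<theta> s < \<theta> z)" unfolding I0 by (simp only: \<theta>(1))
      also have "\<dots> \<longleftrightarrow> (\<forall>z\<in>?A. \<xi> z x < t) \<and> (\<forall>z\<in>?C. t < \<xi> z x)" using e s by auto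
      finally show "same (x0 + t0 *\<^sub>R b) (x + t *\<^sub>R b) \<longleftrightarrow> (\<forall>z\<in>?A. \<xi> z x < t) \<and> (\<forall>z\<in>?C. t < \<xi> z x)" .
    qed
    have fin: "finite ?A" "finite ?C" using finite_roots[of x0] by auto
    \<comment> \<open>The root \<open>0\<close> of the coordinate function rules out a band that is
      unbounded on both sides.\<close>
    have ne: "?A \<noteq> {} \<or> ?C \<noteq> {}"
    proof -
      have "0 \<in> roots x0" by (rule roots_nonempty[OF Db[OF x0]])
      then show ?thesis using False by (cases "0 < t0") (auto simp: not_less order_le_less)
    qed
    \<comment> \<open>The sections are ordered like the roots of \<open>x0\<close>, so only the
      nearest one on each side bounds the class.\<close>
    define a where "a = Max ?A"
    define c where "c = Min ?C"
    have a: "a \<in> ?A" "\<And>x t. x \<in> D \<Longrightarrow> (\<forall>z\<in>?A. \<xi> z x < t) \<longleftrightarrow> \<xi> a x < t" if "?A \<noteq> {}"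
    proof -
      show aA: "a \<in> ?A" unfolding a_def by (rule Max_in[OF fin(1) that])
      fix x t assume x: "x \<in> D"
      have "\<xi> z x \<le> \<xi> a x" if "z \<in> ?A" for z
        using mono[OF x, of z a] aA that Max_ge[OF fin(1) that] by (cases "z = a") (auto simp: a_def)
      then show "(\<forall>z\<in>?A. \<xi> z x < t) \<longleftrightarrow> \<xi> a x < t" using aA by (meson order_le_less_trans)
    qed
    have c: "c \<in> ?C" "\<And>x t. x \<in> D \<Longrightarrow> (\<forall>z\<in>?C. t < \<xi> z x) \<longleftrightarrow> t < \<xi> c x" if "?C \<noteq> {}"
    proof -
      show cC: "c \<in> ?C" unfolding c_def by (rule Min_in[OF fin(2) that])
      fix x t assume x: "x \<in> D"
      have "\<xi> c x \<le> \<xi> z x" if "z \<in> ?C" for z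
        using mono[OF x, of c z] cC that Min_le[OF fin(2) that] by (cases "z = c") (auto simp: c_def)
      then show "(\<forall>z\<in>?C. t < \<xi> z x) \<longleftrightarrow> t < \<xi> c x" using cC by (meson order_less_le_trans)
    qed
    consider "?A \<noteq> {}" "?C \<noteq> {}" | "?A \<noteq> {}" "?C = {}" | "?A = {}" "?C \<noteq> {}" using ne by blast
    then have "\<exists>f' g' \<Omega>'. cell_chart (insert b B) f' g' \<Omega>' ?K"
    proof cases
      case 1
      have e: "?K = {y. drop_coord b y \<in> D \<and> \<xi> a (drop_coord b y) < y \<bullet> b \<and> y \<bullet> b < \<xi> c (drop_coord b y)}"
        by (rule set_eqI) (unfold K, use fib a(2)[OF 1(1)] c(2)[OF 1(2)] in auto)
      have ac: "a \<in> roots x0" "c \<in> roots x0" "a < c" using a(1)[OF 1(1)] c(1)[OF 1(2)] by auto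
      show ?thesis
        by (rule cell_chart_band_between[OF ch b bB Db \<xi>[OF ac(1)] \<xi>[OF ac(2)] mono[OF _ ac] e sK])
          (assumption | intro exI)+
    next
      case 2
      have "\<forall>z\<in>?C. t < \<xi> z x" for t x using 2(2) by blast
      then have e: "?K = {y. drop_coord b y \<in> D \<and> 0 < 1 * (y \<bullet> b - \<xi> a (drop_coord b y))}"
        by (intro set_eqI) (unfold K, use fib a(2)[OF 2(1)] in auto)
      have ac: "a \<in> roots x0" using a(1)[OF 2(1)] by auto
      show ?thesis
        by (rule cell_chart_band_beyond[OF ch b bB Db \<xi>[OF ac] disjI1[OF refl] e sK]) (assumption | intro exI)+
    next
      case 3
      have "\<forall>z\<in>?A. \<xi> z x < t" for t x using 3(1) by blast
      then have e: "?K = {y. drop_coord b y \<in> D \<and> 0 < (-1) * (y \<bullet> b - \<xi> c (drop_coord b y))}"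
        by (intro set_eqI) (unfold K, use fib c(2)[OF 3(2)] in auto)
      have ac: "c \<in> roots x0" using c(1)[OF 3(2)] by auto
      show ?thesis
        by (rule cell_chart_band_beyond[OF ch b bB Db \<xi>[OF ac] disjI2[OF refl] e sK]) (assumption | intro exI)+
    qed
    then show ?thesis by blast
  qed
qed

end

text \<open>Fibre degrees are bounded, so iterated derivatives are eventually zero and only finitely
  many polynomials are added.\<close>

lemma dird_closure:
  assumes "finite F" "\<forall>f\<in>F. real_polynomial_function (f :: 'a::euclidean_space \<Rightarrow> real)"
  obtains G where "finite G" "F \<subseteq> G" "\<forall>f\<in>G. real_polynomial_function f" "\<forall>f\<in>G. dird b f \<in> G"
proof
  let ?G = "\<Union>f\<in>F. range (\<lambda>i. (dird b ^^ i) f)"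
  have "finite (range (\<lambda>i. (dird b ^^ i) f))" if f: "real_polynomial_function f" for f :: "'a \<Rightarrow> real"
  proof -
    obtain P where P: "poly_family P" "\<And>x t. f (x + t *\<^sub>R b) = poly (P x) t"
      using poly_family_along[OF f] by blast
    obtain d where d: "\<And>x. degree (P x) \<le> d" using P(1) by (auto simp: poly_family_def)
    have "(dird b ^^ i) f = (\<lambda>x. 0)" if "i > d" for i
    proof
      fix x show "(dird b ^^ i) f x = 0"
        using dird_funpow_along[OF f P(2), of i x 0] pderiv_funpow_eq_0[of "P x" i] d[of x] that by simp
    qed
    then have "range (\<lambda>i. (dird b ^^ i) f) \<subseteq> insert (\<lambda>x. 0) ((\<lambda>i. (dird b ^^ i) f) ` {..d})"
      by (auto simp: image_iff not_le[symmetric])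
    then show ?thesis using finite_subset by blast
  qed
  then show "finite ?G" using assms by auto
  show "F \<subseteq> ?G" by (auto intro!: bexI exI[of _ 0] simp: image_iff)
  show "\<forall>f\<in>?G. real_polynomial_function f" using assms(2) dird_funpow_polynomial by auto
  show "\<forall>f\<in>?G. dird b f \<in> ?G"
  proof
    fix h assume "h \<in> ?G"
    then obtain f i where "f \<in> F" "h = (dird b ^^ i) f" by auto
    then show "dird b h \<in> ?G" by (intro UN_I[of f] image_eqI[of _ _ "Suc i"]) auto
  qed
qed

lemma cell_chart_singleton_0: "cell_chart {} (\<lambda>_. 0) (\<lambda>_. 0) UNIV {0 :: 'a::euclidean_space}"
proof -
  have "open_unit_cube {} = {0 :: 'a}" by (auto simp: open_unit_cube_def euclidean_all_zero_iff)
  then show ?thesis unfolding cell_chart_def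
    by (simp add: slab_def kdiff_const semialgebraic_singleton semialgebraic_map_on_const)
qed

text \<open>The decomposed space is the coordinate subspace spanned by \<open>V\<close>, so that
  adding basis vectors one at a time does not change the type.\<close>

definition sign_invariant_cells ::
    "'a::euclidean_space set \<Rightarrow> ('a \<Rightarrow> real) set \<Rightarrow> 'a set set \<Rightarrow> bool" where
  "sign_invariant_cells V F P \<longleftrightarrow> finite P \<and> disjoint P \<and>
     \<Union>P = {x. \<forall>b\<in>Basis - V. x \<bullet> b = 0} \<and>
     (\<forall>T\<in>P. \<exists>B f g \<Omega>. B \<subseteq> V \<and> cell_chart B f g \<Omega> T) \<and>
     (\<forall>T\<in>P. \<forall>f\<in>F. \<forall>x\<in>T. \<forall>y\<in>T. sgn (f x) = sgn (f y))"

lemma sign_invariant_cellsD: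
  assumes "sign_invariant_cells V F P"
  shows "finite P" "disjoint P" "\<Union>P = {x. \<forall>b\<in>Basis - V. x \<bullet> b = 0}"
    "\<And>T. T \<in> P \<Longrightarrow> \<exists>B f g \<Omega>. B \<subseteq> V \<and> cell_chart B f g \<Omega> T"
    "\<And>T f x y. T \<in> P \<Longrightarrow> f \<in> F \<Longrightarrow> x \<in> T \<Longrightarrow> y \<in> T \<Longrightarrow> sgn (f x) = sgn (f y)"
  using assms unfolding sign_invariant_cells_def by blast+

text \<open>The cells over a cell of the base are the sign classes of a family closed under
  differentiation in the fibre direction: by Thom's lemma such a class meets every fibre in a point
  or an open interval.\<close>

theorem cylindrical_decomposition:
  fixes V :: "'a::euclidean_space set"
  assumes "V \<subseteq> Basis" "finite F" "\<forall>f\<in>F. real_polynomial_function f"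
  shows "\<exists>P. sign_invariant_cells V F P"
proof -
  have "finite V" using assms(1) finite_Basis finite_subset by blast
  then show ?thesis using assms
  proof (induction V arbitrary: F rule: finite_induct)
    case empty
    show ?case
      unfolding sign_invariant_cells_def
    proof (intro exI[of _ "{{0}}"] conjI ballI)
      show "\<Union>{{0}} = {x :: 'a. \<forall>b\<in>Basis - {}. x \<bullet> b = 0}" by (auto simp: euclidean_all_zero_iff)
      fix T :: "'a set" assume T: "T \<in> {{0}}"
      show "\<exists>B f g \<Omega>. B \<subseteq> {} \<and> cell_chart B f g \<Omega> T"
      proof -
        have e: "T = {0}" using T by simp
        show ?thesis unfolding e by (intro exI conjI, rule order.refl, rule cell_chart_singleton_0)
      qed
      show "sgn (f x) = sgn (f y)" if "x \<in> T" "y \<in> T" for f x y using that T by simp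
    qed simp_all
  next
    case (insert b V)
    have b: "b \<in> Basis" and V: "V \<subseteq> Basis" and bV: "b \<notin> V" using insert by auto
    have "finite (insert (\<lambda>x. x \<bullet> b) F)" "\<forall>f\<in>insert (\<lambda>x. x \<bullet> b) F. real_polynomial_function f"
      using insert.prems by (auto intro: real_polynomial_inner)
    then obtain G where G: "finite G" "insert (\<lambda>x. x \<bullet> b) F \<subseteq> G" "\<forall>f\<in>G. real_polynomial_function f"
      "\<forall>f\<in>G. dird b f \<in> G" by (rule dird_closure)
    interpret fibre_family G b using G b by unfold_locales auto
    \<comment> \<open>If \<open>K\<close> has constant signs on a base cell, then all fibres over
      this cell have matching sign diagrams for \<open>G\<close>.\<close>
    obtain K where K: "finite K" "\<forall>h\<in>K. real_polynomial_function h"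
      "\<And>x y. \<forall>h\<in>K. sgn (h x) = sgn (h y) \<Longrightarrow> \<exists>\<theta>. strict_mono \<theta> \<and> surj \<theta> \<and>
      (\<forall>f\<in>G. \<forall>t. sgn (f (x + t *\<^sub>R b)) = sgn (f (y + \<theta> t *\<^sub>R b)))"
      using fibre_equiv_determined[OF G(1,3), of b] by metis
    obtain Q where "sign_invariant_cells V K Q" using insert.IH[OF V K(1,2)] by blast
    note Q = sign_invariant_cellsD[OF this]
    define cls where "cls D y0 = {y. drop_coord b y \<in> D \<and> same y y0}" for D y0
    define P where "P = (\<Union>D\<in>Q. cls D ` {y. drop_coord b y \<in> D})"
    have "finite (cls D ` {y. drop_coord b y \<in> D})" for D
    proof -
      let ?C = "\<lambda>\<sigma>. {y. drop_coord b y \<in> D \<and> (\<forall>f\<in>G. sgn (f y) = \<sigma> f)}"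
      have "cls D y0 = ?C (restrict (\<lambda>f. sgn (f y0)) G)" for y0 by (simp add: cls_def same_def)
      moreover have "restrict (\<lambda>f. sgn (f y0)) G \<in> PiE G (\<lambda>_. {-1, 0, 1})" for y0 by (auto simp: sgn_real_def)
      ultimately have "cls D ` {y. drop_coord b y \<in> D} \<subseteq> ?C ` PiE G (\<lambda>_. {-1, 0, 1})" by blast
      moreover have "finite (PiE G (\<lambda>_. {-1, 0, 1 :: real}))" using G(1) by (intro finite_PiE) auto
      ultimately show ?thesis using finite_subset by blast
    qed
    then have "finite P" using Q(1) by (auto simp: P_def)
    moreover have "disjoint P"
    proof (rule disjointI)
      fix S T assume ST: "S \<in> P" "T \<in> P" "S \<noteq> T"
      then obtain D y D' y' where d: "D \<in> Q" "S = cls D y" "D' \<in> Q" "T = cls D' y'" by (auto simp: P_def)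
      show "S \<inter> T = {}"
      proof (rule ccontr)
        assume "S \<inter> T \<noteq> {}"
        then obtain w where w: "drop_coord b w \<in> D" "drop_coord b w \<in> D'" "same w y" "same w y'"
          using d by (auto simp: cls_def)
        then have "D = D'" using Q(2) d by (meson disjoint_iff disjointD)
        moreover have "same z y \<longleftrightarrow> same z y'" for z using w same_trans same_sym by metis
        ultimately show False using ST(3) d by (simp add: cls_def)
      qed
    qed
    moreover have "\<Union>P = {x. \<forall>c\<in>Basis - insert b V. x \<bullet> c = 0}"
    proof -
      have "\<Union>P = {y. drop_coord b y \<in> \<Union>Q}"
        by (auto simp: P_def cls_def same_def)
      also have "\<dots> = {x. \<forall>c\<in>Basis - insert b V. x \<bullet> c = 0}"
        unfolding Q(3) using b bV by (auto simp: drop_coord_inner)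
      finally show ?thesis .
    qed
    moreover have "\<exists>B f g \<Omega>. B \<subseteq> insert b V \<and> cell_chart B f g \<Omega> T" if T: "T \<in> P" for T
    proof -
      obtain D y0 where D: "D \<in> Q" "drop_coord b y0 \<in> D" "T = cls D y0" using T by (auto simp: P_def)
      obtain B \<phi> \<gamma> \<Omega> where c: "B \<subseteq> V" "cell_chart B \<phi> \<gamma> \<Omega> D" using Q(4)[OF D(1)] by blast
      interpret fibre_cell G b B \<phi> \<gamma> \<Omega> D
      proof
        show "cell_chart B \<phi> \<gamma> \<Omega> D" by (rule c(2))
        show "x \<bullet> b = 0" if "x \<in> D" for x using that Q(3) D(1) b bV by blast
        show "b \<notin> B" using c(1) bV by blast
        show "\<exists>\<theta>. strict_mono \<theta> \<and> surj \<theta> \<and> (\<forall>f\<in>G. \<forall>t. sgn (f (x + t *\<^sub>R b)) = sgn (f (y + \<theta> t *\<^sub>R b)))"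
          if "x \<in> D" "y \<in> D" for x y
          by (rule K(3)) (use Q(5)[OF D(1) _ that] in blast)
      qed
      show ?thesis using sign_cell_chart[OF D(2)] c(1) unfolding D(3) cls_def by blast
    qed
    moreover have "sgn (f x) = sgn (f y)" if "T \<in> P" "f \<in> F" "x \<in> T" "y \<in> T" for T f x y
    proof -
      have "f \<in> G" using G(2) that(2) by blast
      then show ?thesis using that(1,3,4) by (auto simp: P_def cls_def same_def)
    qed
    ultimately have "sign_invariant_cells (insert b V) F P" unfolding sign_invariant_cells_def
      by (intro conjI ballI) (assumption | blast)+
    then show ?case by blast
  qed
qed

theorem cell_decomposition_exists:
  fixes S :: "'a::euclidean_space set"
  assumes "semialgebraic S" shows "\<exists>P d. cell_decomposition S P d"
proof -
  obtain H where H: "finite H" "\<forall>h\<in>H. real_polynomial_function h"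
    "\<And>x y. (\<forall>h\<in>H. sgn (h x) = sgn (h y)) \<Longrightarrow> x \<in> S \<Longrightarrow> y \<in> S"
    using assms unfolding semialgebraic_iff_sign by blast
  obtain P where "sign_invariant_cells Basis H P" using cylindrical_decomposition[OF order.refl H(1,2)] by blast
  note P = sign_invariant_cellsD[OF this]
  have cover: "\<Union>P = UNIV" using P(3) by simp
  let ?P = "{T\<in>P. T \<subseteq> S}"
  have "\<exists>k. semialgebraic_cell T k" if "T \<in> P" for T
    using P(4)[OF that] cell_chart_semialgebraic_cell by blast
  then obtain d where d: "\<And>T. T \<in> P \<Longrightarrow> semialgebraic_cell T (d T)" by metis
  have "\<Union>?P = S"
  proof
    show "S \<subseteq> \<Union>?P"
    proof
      fix x assume x: "x \<in> S"
      obtain T where T: "T \<in> P" "x \<in> T" using cover by blast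
      have "T \<subseteq> S"
      proof
        fix y assume "y \<in> T"
        then have "\<forall>h\<in>H. sgn (h x) = sgn (h y)" using P(5)[OF T(1) _ T(2)] by blast
        then show "y \<in> S" using H(3) x by blast
      qed
      then show "x \<in> \<Union>?P" using T by blast
    qed
  qed blast
  moreover have "disjoint ?P" using P(2) by (rule pairwise_subset) auto
  ultimately have "cell_decomposition S ?P d"
    unfolding cell_decomposition_def using P(1) d by auto
  then show ?thesis by blast
qed

section \<open>Dimension\<close>

lemma smooth_map_on_differentiable_on:
  assumes "smooth_map_on f S" shows "f differentiable_on S"
  unfolding differentiable_on_def
proof
  fix x assume x: "x \<in> S"
  obtain U g where U: "open U" "x \<in> U" "smooth_on_open g U" "\<forall>y\<in>S \<inter> U. g y = f y"
    using assms x unfolding smooth_map_on_def by blast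
  have "kdiff (Suc 0) g U" using U(3) unfolding smooth_on_open_def by blast
  then have "g differentiable (at x)" using U(2) by simp
  then have g: "g differentiable (at x within S)" by (rule differentiable_at_withinI)
  obtain d where d: "d > 0" "ball x d \<subseteq> U" using U(1,2) openE by blast
  show "f differentiable (at x within S)"
    by (rule differentiable_transform_within[OF g d(1) x]) (use U(4) d(2) in \<open>auto simp: dist_commute subset_iff\<close>)
qed

lemma open_nonempty_not_negligible:
  fixes S :: "'a::euclidean_space set"
  assumes "open S" "S \<noteq> {}" shows "\<not> negligible S"
  using open_not_negligible assms by blast

lemma slab_nonempty: "B \<subseteq> Basis \<Longrightarrow> slab B \<noteq> {}"
  using open_unit_cube_nonempty cube_subset_slab by blast

text \<open>The map \<open>\<Lambda>\<close> presents the set as part of a differentiable image of a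
  null set of the same space: the coordinates in \<open>B'\<close> are stored injectively among
  those in \<open>B\<close>, leaving \<open>b0\<close> vacant, and the coordinates outside
  \<open>B\<close> are copied.\<close>

lemma negligible_lowdim_preimage:
  fixes h :: "'a::euclidean_space \<Rightarrow> 'a"
  assumes B: "B \<subseteq> Basis" and B': "B' \<subseteq> Basis" and lt: "card B' < card B"
    and E: "\<And>v c. v \<in> E \<Longrightarrow> c \<in> Basis - B' \<Longrightarrow> v \<bullet> c = 0" and h: "h differentiable_on E"
  shows "negligible {u. coord_proj B u \<in> h ` E}"
proof -
  have fB: "finite B" "finite B'" using B B' finite_Basis finite_subset by blast+
  obtain \<iota> where \<iota>: "\<iota> ` B' \<subseteq> B" "inj_on \<iota> B'"
    using card_le_inj[OF fB(2,1)] lt by auto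
  have "card (\<iota> ` B') < card B" using lt card_image[OF \<iota>(2)] by simp
  then obtain b0 where b0: "b0 \<in> B" "b0 \<notin> \<iota> ` B'" using \<iota>(1) by (metis less_irrefl subsetI subset_antisym)
  define \<tau> where "\<tau> u = (\<Sum>c\<in>B'. (u \<bullet> \<iota> c) *\<^sub>R c)" for u :: 'a
  define \<Lambda> where "\<Lambda> u = h (\<tau> u) + coord_proj (Basis - B) u" for u
  define \<Omega> where "\<Omega> = {w. w \<bullet> b0 = 0 \<and> \<tau> w \<in> E}"
  have lin: "bounded_linear \<tau>" unfolding \<tau>_def[abs_def]
    by (intro bounded_linear_sum bounded_linear_scaleR_left[THEN bounded_linear_compose] bounded_linear_inner_left)
  have "negligible {w :: 'a. w \<bullet> b0 = 0}"
    using negligible_standard_hyperplane[of b0 0] b0(1) B by auto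
  then have "negligible \<Omega>" by (rule negligible_subset) (auto simp: \<Omega>_def)
  moreover have "\<Lambda> differentiable_on \<Omega>" unfolding \<Lambda>_def[abs_def]
  proof (rule differentiable_on_add)
    show "(\<lambda>u. h (\<tau> u)) differentiable_on \<Omega>"
      by (rule differentiable_on_compose[OF bounded_linear_imp_differentiable_on[OF lin] differentiable_on_subset[OF h]])
        (auto simp: \<Omega>_def)
    show "coord_proj (Basis - B) differentiable_on \<Omega>"
      by (rule bounded_linear_imp_differentiable_on[OF bounded_linear_coord_proj])
  qed
  ultimately have "negligible (\<Lambda> ` \<Omega>)"
    by (intro negligible_differentiable_image_negligible) auto
  moreover have "{u. coord_proj B u \<in> h ` E} \<subseteq> \<Lambda> ` \<Omega>"
  proof
    fix u assume "u \<in> {u. coord_proj B u \<in> h ` E}"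
    then obtain e where e: "e \<in> E" "coord_proj B u = h e" by auto
    define w where "w = (\<Sum>c\<in>B'. (e \<bullet> c) *\<^sub>R \<iota> c) + coord_proj (Basis - B) u"
    have wi: "w \<bullet> a = (\<Sum>c\<in>B'. if \<iota> c = a then e \<bullet> c else 0)" if a: "a \<in> B" for a
    proof -
      have "w \<bullet> a = (\<Sum>c\<in>B'. (e \<bullet> c) * (\<iota> c \<bullet> a))"
        using a B by (auto simp: w_def inner_add_left inner_sum_left coord_proj_inner)
      also have "\<dots> = (\<Sum>c\<in>B'. if \<iota> c = a then e \<bullet> c else 0)"
        by (intro sum.cong refl) (use a B \<iota>(1) in \<open>auto simp: inner_Basis image_subset_iff subset_iff\<close>)
      finally show ?thesis .
    qed
    have w\<iota>: "w \<bullet> \<iota> c = e \<bullet> c" if c: "c \<in> B'" for c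
    proof -
      have "w \<bullet> \<iota> c = (\<Sum>c'\<in>B'. if c' = c then e \<bullet> c' else 0)"
        by (subst wi) (use c \<iota> in \<open>auto intro!: sum.cong dest: inj_onD\<close>)
      then show ?thesis using c fB by simp
    qed
    have "w \<bullet> b0 = 0" by (subst wi[OF b0(1)]) (use b0(2) in \<open>auto intro!: sum.neutral\<close>)
    moreover have \<tau>w: "\<tau> w = e"
    proof -
      have "\<tau> w = coord_proj B' e" unfolding \<tau>_def coord_proj_def using w\<iota> by simp
      also have "\<dots> = e" by (rule coord_proj_id[OF B' E[OF e(1)]])
      finally show ?thesis .
    qed
    ultimately have "w \<in> \<Omega>" using e(1) by (simp add: \<Omega>_def)
    moreover have "\<Lambda> w = u"
    proof (rule euclidean_eqI)
      fix a :: 'a assume a: "a \<in> Basis"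
      have "(\<Sum>c\<in>B'. (e \<bullet> c) * (\<iota> c \<bullet> a)) = 0" if "a \<notin> B"
        by (rule sum.neutral) (use that a B \<iota>(1) in \<open>auto simp: inner_Basis image_subset_iff subset_iff\<close>)
      then have "w \<bullet> a = u \<bullet> a" if "a \<notin> B"
        using that a B by (simp add: w_def inner_add_left coord_proj_inner inner_sum_left)
      moreover have "\<Lambda> w = coord_proj B u + coord_proj (Basis - B) w" by (simp add: \<Lambda>_def \<tau>w e(2))
      ultimately show "\<Lambda> w \<bullet> a = u \<bullet> a"
        using a B by (auto simp: inner_add_left coord_proj_inner)
    qed
    ultimately show "u \<in> \<Lambda> ` \<Omega>" by blast
  qed
  ultimately show ?thesis using negligible_subset by blast
qed

lemma semialgebraic_cellE:
  fixes T :: "'a::euclidean_space set"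
  assumes "semialgebraic_cell T k"
  obtains B :: "'a set" and f g where "B \<subseteq> Basis" "card B = k" "f ` T \<subseteq> open_unit_cube B" "g ` open_unit_cube B \<subseteq> T"
    "\<forall>x\<in>T. g (f x) = x" "\<forall>u\<in>open_unit_cube B. f (g u) = u"
    "f differentiable_on T" "g differentiable_on open_unit_cube B"
proof -
  obtain B :: "'a set" and f g where c: "B \<subseteq> Basis" "card B = k" "f ` T \<subseteq> open_unit_cube B" "g ` open_unit_cube B \<subseteq> T"
    "\<forall>x\<in>T. g (f x) = x" "\<forall>u\<in>open_unit_cube B. f (g u) = u" "smooth_map_on f T" "smooth_map_on g (open_unit_cube B)"
    using assms unfolding semialgebraic_cell_def semialgebraically_diffeomorphic_def by metis
  show ?thesis
    by (rule that[OF c(1-6)]) (rule smooth_map_on_differentiable_on c(7,8))+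
qed

text \<open>Each cell of dimension below \<open>card B\<close> contributes only a null set to the
  slab. With \<open>f\<close> the chart of a cell of another decomposition this yields uniqueness of
  the dimension; with the identity on a cube inside \<open>S\<close> it yields the lower
  bound.\<close>

lemma cell_decomposition_card_le:
  fixes S X B :: "'a::euclidean_space set" and f :: "'a \<Rightarrow> 'a"
  assumes dec: "cell_decomposition S P d" and le: "\<And>T. T \<in> P \<Longrightarrow> d T \<le> k"
    and X: "X \<subseteq> S" "f differentiable_on X" and B: "B \<subseteq> Basis" "open_unit_cube B \<subseteq> f ` X"
  shows "card B \<le> k"
proof (rule ccontr)
  assume "\<not> card B \<le> k"
  then have lt: "k < card B" by simp
  have P: "finite P" "\<Union>P = S" "\<And>T. T \<in> P \<Longrightarrow> semialgebraic_cell T (d T)"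
    using dec by (auto simp: cell_decomposition_def)
  have neg: "negligible {u. coord_proj B u \<in> f ` (T \<inter> X)}" if T: "T \<in> P" for T
  proof -
    obtain B' :: "'a set" and p g where c: "B' \<subseteq> Basis" "card B' = d T" "p ` T \<subseteq> open_unit_cube B'" "g ` open_unit_cube B' \<subseteq> T"
      "\<forall>x\<in>T. g (p x) = x" "\<forall>u\<in>open_unit_cube B'. p (g u) = u"
      "p differentiable_on T" "g differentiable_on open_unit_cube B'"
      by (rule semialgebraic_cellE[OF P(3)[OF T]])
    let ?E = "{v\<in>open_unit_cube B'. g v \<in> X}"
    have "negligible {u. coord_proj B u \<in> (\<lambda>v. f (g v)) ` ?E}"
    proof (rule negligible_lowdim_preimage[OF B(1) c(1)])
      show "card B' < card B" using c(2) le[OF T] lt by simp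
      show "v \<bullet> c = 0" if "v \<in> ?E" "c \<in> Basis - B'" for v c using that by (auto simp: open_unit_cube_def)
      show "(\<lambda>v. f (g v)) differentiable_on ?E"
        by (rule differentiable_on_compose[OF differentiable_on_subset[OF c(8)] differentiable_on_subset[OF X(2)]]) auto
    qed
    moreover have "f ` (T \<inter> X) \<subseteq> (\<lambda>v. f (g v)) ` ?E"
    proof
      fix y assume "y \<in> f ` (T \<inter> X)"
      then obtain x where x: "x \<in> T" "x \<in> X" "y = f x" by blast
      then show "y \<in> (\<lambda>v. f (g v)) ` ?E" using c(3,5)
        by (intro image_eqI[of _ _ "p x"]) auto
    qed
    ultimately show ?thesis by (elim negligible_subset) blast
  qed
  have "slab B \<subseteq> \<Union>((\<lambda>T. {u. coord_proj B u \<in> f ` (T \<inter> X)}) ` P)"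
  proof
    fix u assume "u \<in> slab B"
    then have "coord_proj B u \<in> f ` X" using coord_proj_slab[OF B(1)] B(2) by blast
    then obtain x where x: "x \<in> X" "coord_proj B u = f x" by blast
    then obtain T where "T \<in> P" "x \<in> T" using X(1) P(2) by blast
    then show "u \<in> \<Union>((\<lambda>T. {u. coord_proj B u \<in> f ` (T \<inter> X)}) ` P)" using x by blast
  qed
  moreover have "negligible (\<Union>((\<lambda>T. {u. coord_proj B u \<in> f ` (T \<inter> X)}) ` P))"
    using P(1) neg by (intro negligible_Union) auto
  ultimately have "negligible (slab B)" using negligible_subset by blast
  then show False using open_nonempty_not_negligible[OF open_slab[OF B(1)] slab_nonempty[OF B(1)]] by blast
qed

lemma semialgebraic_dim_eq:
  fixes S :: "'a::euclidean_space set"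
  assumes dec: "cell_decomposition S P d" and ne: "S \<noteq> {}"
  shows "semialgebraic_dim S = Max (d ` P)"
proof -
  have le: "Max (d ` P) \<le> Max (e ` Q)"
    if dec: "cell_decomposition S P d" "cell_decomposition S Q e" for P Q d e
  proof -
    have P: "finite P" "\<Union>P = S" "\<And>T. T \<in> P \<Longrightarrow> semialgebraic_cell T (d T)"
      using dec(1) by (auto simp: cell_decomposition_def)
    have fQ: "finite Q" using dec(2) by (auto simp: cell_decomposition_def)
    have "d T \<le> Max (e ` Q)" if T: "T \<in> P" for T
    proof -
      obtain B :: "'a set" and f g where c: "B \<subseteq> Basis" "card B = d T" "f ` T \<subseteq> open_unit_cube B" "g ` open_unit_cube B \<subseteq> T"
        "\<forall>x\<in>T. g (f x) = x" "\<forall>u\<in>open_unit_cube B. f (g u) = u"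
        "f differentiable_on T" "g differentiable_on open_unit_cube B"
        by (rule semialgebraic_cellE[OF P(3)[OF T]])
      have "open_unit_cube B \<subseteq> f ` T" using c(4,6) by force
      then have "card B \<le> Max (e ` Q)"
        by (intro cell_decomposition_card_le[OF dec(2) _ _ c(7) c(1)]) (use T P(2) fQ in auto)
      then show ?thesis using c(2) by simp
    qed
    moreover have "P \<noteq> {}" using ne P(2) by blast
    ultimately show ?thesis using P(1) by simp
  qed
  show ?thesis unfolding semialgebraic_dim_def
  proof (rule the_equality)
    show "\<exists>Q e. cell_decomposition S Q e \<and> Max (d ` P) = Max (e ` Q)" using dec by blast
    show "k = Max (d ` P)" if "\<exists>Q e. cell_decomposition S Q e \<and> k = Max (e ` Q)" for k
      using that le dec by (meson order_antisym)
  qed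
qed

lemma semialgebraic_dim_ge:
  fixes S :: "'a::euclidean_space set"
  assumes S: "semialgebraic S" and B: "B \<subseteq> Basis" "open_unit_cube B \<subseteq> S"
  shows "card B \<le> semialgebraic_dim S"
proof -
  obtain P d where dec: "cell_decomposition S P d" using cell_decomposition_exists[OF S] by blast
  have "S \<noteq> {}" using B open_unit_cube_nonempty by blast
  then have e: "semialgebraic_dim S = Max (d ` P)" by (rule semialgebraic_dim_eq[OF dec])
  have "finite P" using dec by (simp add: cell_decomposition_def)
  then show ?thesis unfolding e
    by (intro cell_decomposition_card_le[OF dec _ B(2) _ B(1), of _ "\<lambda>x. x"]) (auto simp: differentiable_on_ident)
qed

text \<open>The chart of a cell of full dimension would carry a null set onto a nonempty open cube,
  whereas differentiable maps between spaces of equal dimension preserve null sets.\<close>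

lemma semialgebraic_dim_negligible:
  fixes S :: "'a::euclidean_space set"
  assumes S: "semialgebraic S" "S \<noteq> {}" and neg: "negligible S"
  shows "semialgebraic_dim S < DIM('a)"
proof -
  obtain P d where dec: "cell_decomposition S P d" using cell_decomposition_exists[OF S(1)] by blast
  have P: "finite P" "\<Union>P = S" "\<And>T. T \<in> P \<Longrightarrow> semialgebraic_cell T (d T)"
    using dec by (auto simp: cell_decomposition_def)
  have "d T < DIM('a)" if T: "T \<in> P" for T
  proof (rule ccontr)
    assume ge: "\<not> d T < DIM('a)"
    obtain B :: "'a set" and f g where c: "B \<subseteq> Basis" "card B = d T" "f ` T \<subseteq> open_unit_cube B" "g ` open_unit_cube B \<subseteq> T"
      "\<forall>x\<in>T. g (f x) = x" "\<forall>u\<in>open_unit_cube B. f (g u) = u"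
      "f differentiable_on T" "g differentiable_on open_unit_cube B"
      by (rule semialgebraic_cellE[OF P(3)[OF T]])
    have "B = Basis" using c(1,2) ge card_mono[OF finite_Basis c(1)] by (intro card_subset_eq) auto
    then have "slab B = open_unit_cube B" by (auto simp: slab_def open_unit_cube_def)
    moreover have "open_unit_cube B \<subseteq> f ` T" using c(4,6) by force
    moreover have "negligible T" using neg by (rule negligible_subset) (use T P(2) in blast)
    then have "negligible (f ` T)" by (intro negligible_differentiable_image_negligible c(7)) auto
    ultimately have "negligible (slab B)" using negligible_subset by metis
    then show False using open_nonempty_not_negligible[OF open_slab[OF c(1)] slab_nonempty[OF c(1)]] by blast
  qed
  moreover have "P \<noteq> {}" using S(2) P(2) by blast
  ultimately show ?thesis using semialgebraic_dim_eq[OF dec S(2)] P(1) by simp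
qed

section \<open>Tensors that are not R0\<close>

text \<open>Order at least two provides a position besides the first, so the product is not
  empty.\<close>

lemma prod_nonfirst_zero:
  fixes x :: "real ^ 'n::finite" and j :: "'m::{finite,linorder} \<Rightarrow> 'n"
  assumes "CARD('m) \<ge> 2" "\<And>k. x $ (j k) = 0"
  shows "(\<Prod>k\<in>UNIV - {first_pos}. x $ (j k)) = 0"
proof -
  have "UNIV - {first_pos :: 'm} \<noteq> {}"
  proof
    assume "UNIV - {first_pos :: 'm} = {}"
    then have "CARD('m) \<le> card {first_pos :: 'm}" by (intro card_mono) auto
    then show False using assms(1) by simp
  qed
  then show ?thesis using assms(2) by (intro prod_zero) auto
qed

text \<open>Order at least two makes \<open>tensor_app A 0\<close> vanish, so \<open>0\<close> is
  always a solution and only a further one can violate the R0 property.\<close>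

lemma non_R0_iff:
  fixes A :: "('m::{finite,linorder}, 'n::finite) tensor"
  assumes "CARD('m) \<ge> 2"
  shows "A \<in> UNIV - R0_tensors \<longleftrightarrow> (\<exists>x. x \<in> TCP_Sol A 0 \<and> x \<noteq> 0)"
proof -
  have "tensor_app A 0 = 0"
    using assms by (simp add: tensor_app_def vec_eq_iff power_0_left)
  then have "0 \<in> TCP_Sol A 0" by (simp add: TCP_Sol_def tensor_form_def)
  then show ?thesis by (auto simp: R0_tensors_def)
qed

section \<open>Semi-algebraicity and lower bound\<close>

lemma real_polynomial_nth: "polynomial_function p \<Longrightarrow> real_polynomial_function (\<lambda>x. p x $ i)"
  for p :: "'a::real_normed_vector \<Rightarrow> real ^ 'k"
  unfolding polynomial_function_def using bounded_linear_vec_nth[of i] by (auto simp: o_def)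

lemma real_polynomial_tensor_app:
  fixes p :: "'a::real_normed_vector \<Rightarrow> ('m::{finite,linorder}, 'n::finite) tensor" and q :: "'a \<Rightarrow> real ^ 'n"
  assumes "polynomial_function p" "polynomial_function q"
  shows "real_polynomial_function (\<lambda>z. tensor_app (p z) (q z) $ i)"
  unfolding tensor_app_def vec_lambda_beta
  by (intro real_polynomial_function_sum real_polynomial_function.intros(4) real_polynomial_function_prod
      real_polynomial_nth assms) auto

lemma semialgebraic_non_R0:
  assumes "CARD('m::{finite,linorder}) \<ge> 2"
  shows "semialgebraic (UNIV - R0_tensors :: ('m, 'n::finite) tensor set)"
proof -
  let ?S = "{z :: ('m, 'n) tensor \<times> (real ^ 'n). (\<forall>i\<in>UNIV. 0 \<le> snd z $ i) \<and>
    (\<forall>i\<in>UNIV. 0 \<le> tensor_app (fst z) (snd z) $ i) \<and>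
    (\<Sum>i\<in>UNIV. snd z $ i * tensor_app (fst z) (snd z) $ i) = 0 \<and> snd z \<in> - {0}}"
  have "semialgebraic ?S"
    by (intro semialgebraic_Collect_conj semialgebraic_Collect_ball semialgebraic_ge0 semialgebraic_eq0
        real_polynomial_tensor_app real_polynomial_nth polynomial_function_fst polynomial_function_snd
        real_polynomial_function_sum real_polynomial_function.intros(4)
        semialgebraic_vimage semialgebraic_Compl semialgebraic_singleton finite_class.finite_UNIV)
  from tarski_seidenberg[OF this]
  have "semialgebraic {A :: ('m, 'n) tensor. \<exists>x. (A, x) \<in> ?S}" .
  also have "{A :: ('m, 'n) tensor. \<exists>x. (A, x) \<in> ?S} = UNIV - R0_tensors"
  proof (rule set_eqI)
    fix A :: "('m, 'n) tensor"
    have "(A, x) \<in> ?S \<longleftrightarrow> x \<in> TCP_Sol A 0 \<and> x \<noteq> 0" for x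
      by (auto simp: TCP_Sol_def tensor_form_def inner_vec_def)
    then show "A \<in> {A. \<exists>x. (A, x) \<in> ?S} \<longleftrightarrow> A \<in> UNIV - R0_tensors"
      by (simp only: non_R0_iff[OF assms] mem_Collect_eq)
  qed
  finally show ?thesis .
qed

lemma open_unit_cube_subset_non_R0:
  fixes i0 :: "'n::finite"
  assumes "CARD('m::{finite,linorder}) \<ge> 2"
  defines "B \<equiv> (\<lambda>j :: 'm \<Rightarrow> 'n. axis j (1::real)) ` {j. \<forall>k. j k \<noteq> i0}"
  shows "B \<subseteq> Basis" "card B = (CARD('n) - 1) ^ CARD('m)" "open_unit_cube B \<subseteq> UNIV - R0_tensors"
proof -
  show "B \<subseteq> Basis" by (auto simp: B_def axis_in_Basis_iff)
  have "inj_on (\<lambda>j :: 'm \<Rightarrow> 'n. axis j (1::real)) {j. \<forall>k. j k \<noteq> i0}"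
    by (auto simp: inj_on_def axis_eq_axis)
  then have "card B = card {j :: 'm \<Rightarrow> 'n. \<forall>k. j k \<noteq> i0}" unfolding B_def by (rule card_image)
  also have "{j :: 'm \<Rightarrow> 'n. \<forall>k. j k \<noteq> i0} = PiE UNIV (\<lambda>_. UNIV - {i0})" by (auto simp: PiE_UNIV_domain)
  also have "card \<dots> = (CARD('n) - 1) ^ CARD('m)" by (simp add: card_PiE)
  finally show "card B = (CARD('n) - 1) ^ CARD('m)" .
  show "open_unit_cube B \<subseteq> UNIV - R0_tensors"
  proof
    fix A assume A: "A \<in> open_unit_cube B"
    have A0: "A $ j = 0" if "j k = i0" for j k
    proof -
      have "axis j 1 \<in> Basis - B" using that by (auto simp: B_def axis_in_Basis_iff axis_eq_axis)
      then have "A \<bullet> axis j 1 = 0" using A by (auto simp: open_unit_cube_def)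
      then show ?thesis by (simp add: inner_axis)
    qed
    let ?x = "axis i0 1 :: real ^ 'n"
    \<comment> \<open>A multi-index containing \<open>i0\<close> has entry zero; any other one picks
      up a zero coordinate of the unit vector outside the first position.\<close>
    have term0: "A $ j * (\<Prod>k\<in>UNIV - {first_pos}. ?x $ (j k)) = 0" for j
    proof (cases "\<exists>k. j k = i0")
      case True
      then show ?thesis using A0 by auto
    next
      case False
      then have "(\<Prod>k\<in>UNIV - {first_pos}. ?x $ (j k)) = 0"
        by (intro prod_nonfirst_zero assms(1)) (auto simp: axis_def)
      then show ?thesis by simp
    qed
    have "tensor_app A ?x $ i = 0" for i
      unfolding tensor_app_def vec_lambda_beta by (rule sum.neutral) (use term0 in blast)
    then have "tensor_app A ?x = 0" by (simp add: vec_eq_iff)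
    then have "?x \<in> TCP_Sol A 0" by (simp add: TCP_Sol_def tensor_form_def) (simp add: axis_def)
    moreover have "?x \<noteq> 0" by (simp add: axis_eq_0_iff)
    ultimately show "A \<in> UNIV - R0_tensors" using non_R0_iff[OF assms(1)] by blast
  qed
qed

lemma tensor_app_scale:
  fixes A :: "('m::{finite,linorder}, 'n::finite) tensor"
  shows "tensor_app A (c *\<^sub>R x) $ i = c ^ card (UNIV - {first_pos :: 'm}) * tensor_app A x $ i"
  by (simp add: tensor_app_def prod.distrib sum_distrib_left mult_ac)

text \<open>If \<open>x\<close> solves the homogeneous problem, has support \<open>\<alpha>\<close> and is scaled to \<open>x\<^sub>p = 1\<close>, then the
  equations \<open>(A x\<^sup>m\<^sup>-\<^sup>1)\<^sub>i = 0\<close> for \<open>i \<in> \<alpha>\<close> can be solved for the entries \<open>a\<^sub>i\<^sub>p\<^sub>\<dots>\<^sub>p\<close>. In the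
  parametrisation below these entries are free to hold the coordinates \<open>x\<^sub>i\<close>, and the one for
  \<open>i = p\<close> is not used.\<close>

lemma negligible_non_R0:
  assumes m: "CARD('m::{finite,linorder}) \<ge> 2"
  shows "negligible (UNIV - R0_tensors :: ('m, 'n::finite) tensor set)"
proof -
  \<comment> \<open>The multi-index \<open>(i, p, ..., p)\<close>.\<close>
  define slot where "slot p i = (\<lambda>k :: 'm. if k = first_pos then i else p)" for p i :: 'n
  have slot_first: "slot p i first_pos = i" for p i by (simp add: slot_def)
  \<comment> \<open>The solution is stored inside \<open>U\<close>: its coordinate at
    \<open>i\<close> sits in slot \<open>(i, p, ..., p)\<close>. The coordinate at \<open>p\<close>
    is normalised to \<open>1\<close>, so its slot is vacant, which is the hyperplane
    \<open>\<Omega> p\<close>.\<close>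
  define x where "x \<alpha> p U = (\<chi> i. if i = p then 1 else if i \<in> \<alpha> then U $ slot p i else 0)"
    for \<alpha> p and U :: "('m, 'n) tensor"
  \<comment> \<open>The entry displaced from slot \<open>(i, p, ..., p)\<close> is recovered from
    row \<open>i\<close> of the equations, where its coefficient is a power of the coordinate at
    \<open>p\<close>, that is \<open>1\<close>.\<close>
  define \<Lambda> where "\<Lambda> \<alpha> p U = (\<chi> j. if j \<in> slot p ` \<alpha>
      then - (\<Sum>j'\<in>{j'. j' first_pos = j first_pos} - {j}. U $ j' * (\<Prod>k\<in>UNIV - {first_pos}. x \<alpha> p U $ (j' k)))
      else U $ j)" for \<alpha> p and U :: "('m, 'n) tensor"
  define \<Omega> where "\<Omega> p = {U :: ('m, 'n) tensor. U $ slot p p = 0}" for p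
  have polyx: "real_polynomial_function (\<lambda>U. x \<alpha> p U $ i)" for \<alpha> p i
    by (cases "i = p"; cases "i \<in> \<alpha>")
      (simp_all add: x_def real_polynomial_function.intros(2) real_polynomial_nth polynomial_function_id)
  have "polynomial_function (\<Lambda> \<alpha> p)" for \<alpha> p
    unfolding polynomial_function_iff_Basis_inner
  proof
    fix e :: "('m, 'n) tensor" assume "e \<in> Basis"
    then obtain j where e: "e = axis j 1" by (auto simp: Basis_vec_def)
    have "real_polynomial_function (\<lambda>U. \<Lambda> \<alpha> p U $ j)"
    proof (cases "j \<in> slot p ` \<alpha>")
      case True
      have "real_polynomial_function (\<lambda>U. - (\<Sum>j'\<in>{j'. j' first_pos = j first_pos} - {j}.
          U $ j' * (\<Prod>k\<in>UNIV - {first_pos}. x \<alpha> p U $ (j' k))))"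
        by (intro real_polynomial_function_minus real_polynomial_function_sum real_polynomial_function.intros(4)
            real_polynomial_function_prod polyx real_polynomial_nth polynomial_function_id) auto
      then show ?thesis using True by (simp add: \<Lambda>_def)
    next
      case False
      then show ?thesis by (simp add: \<Lambda>_def real_polynomial_nth polynomial_function_id)
    qed
    then show "real_polynomial_function (\<lambda>U. \<Lambda> \<alpha> p U \<bullet> e)" by (simp add: e inner_axis)
  qed
  then have diff: "\<Lambda> \<alpha> p differentiable_on S" for \<alpha> p S by (rule differentiable_on_polynomial_function)
  have "negligible (\<Omega> p)" for p
    unfolding \<Omega>_def by (rule negligible_standard_hyperplane_cart)
  then have neg: "negligible (\<Lambda> \<alpha> p ` \<Omega> p)" for \<alpha> p
    by (intro negligible_differentiable_image_negligible diff) auto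
  have "UNIV - R0_tensors \<subseteq> (\<Union>(\<alpha>, p)\<in>UNIV. \<Lambda> \<alpha> p ` \<Omega> p)"
  proof
    fix A :: "('m, 'n) tensor" assume "A \<in> UNIV - R0_tensors"
    then obtain w where w: "w \<in> TCP_Sol A 0" "w \<noteq> 0" using non_R0_iff[OF m] by blast
    then obtain p where p: "w $ p \<noteq> 0" by (metis vec_eq_iff zero_index)
    define \<alpha> where "\<alpha> = {i. w $ i \<noteq> 0}"
    define y where "y = inverse (w $ p) *\<^sub>R w"
    have y: "y $ p = 1" "\<And>i. i \<notin> \<alpha> \<Longrightarrow> y $ i = 0" using p by (auto simp: y_def \<alpha>_def)
    \<comment> \<open>Complementarity: a vanishing sum of nonnegative products has only vanishing
      terms, so the rows indexed by the support are zero.\<close>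
    have "(\<Sum>i\<in>UNIV. w $ i * tensor_app A w $ i) = 0"
      using w(1) by (simp add: TCP_Sol_def tensor_form_def inner_vec_def)
    then have "w $ i * tensor_app A w $ i = 0" for i
      using w(1) by (subst (asm) sum_nonneg_eq_0_iff) (auto simp: TCP_Sol_def)
    then have app: "tensor_app A y $ i = 0" if "i \<in> \<alpha>" for i
      using that unfolding y_def tensor_app_scale by (force simp: \<alpha>_def)
    define U where "U = (\<chi> j. if j \<in> slot p ` \<alpha> then if j = slot p p then 0 else y $ (j first_pos) else A $ j)"
    have "p \<in> \<alpha>" using p by (simp add: \<alpha>_def)
    then have "U \<in> \<Omega> p" by (simp add: U_def \<Omega>_def)
    moreover have xU: "x \<alpha> p U = y"
    proof -
      have "slot p i \<noteq> slot p p" if "i \<noteq> p" for i using that slot_first by metis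
      then show ?thesis using y by (auto simp: vec_eq_iff x_def U_def slot_first)
    qed
    have "\<Lambda> \<alpha> p U $ j = A $ j" for j
    proof (cases "j \<in> slot p ` \<alpha>")
      case True
      then obtain i where i: "i \<in> \<alpha>" "j = slot p i" by blast
      let ?J = "{j'. j' first_pos = j first_pos}" and ?m = "\<lambda>j'. \<Prod>k\<in>UNIV - {first_pos}. y $ (j' k)"
      have one: "?m j = 1" by (rule prod.neutral) (simp add: i(2) slot_def y(1))
      have "U $ j' = A $ j'" if "j' \<in> ?J - {j}" for j'
      proof -
        \<comment> \<open>For fixed \<open>p\<close> each row contains a single slot, so the other
          entries of the row are stored unchanged.\<close>
        have "j' \<notin> slot p ` \<alpha>" using that i(2) slot_first by auto
        then show ?thesis by (simp add: U_def)
      qed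
      then have "\<Lambda> \<alpha> p U $ j = - (\<Sum>j'\<in>?J - {j}. A $ j' * ?m j')" using True by (simp add: \<Lambda>_def xU)
      also have "\<dots> = A $ j * ?m j - (\<Sum>j'\<in>?J. A $ j' * ?m j')" by (simp add: sum_diff1)
      also have "(\<Sum>j'\<in>?J. A $ j' * ?m j') = 0"
        using app[OF i(1)] by (simp add: tensor_app_def i(2) slot_first)
      finally show ?thesis using one by simp
    next
      case False
      then show ?thesis by (simp add: \<Lambda>_def U_def)
    qed
    then have "\<Lambda> \<alpha> p U = A" by (simp add: vec_eq_iff)
    ultimately show "A \<in> (\<Union>(\<alpha>, p)\<in>UNIV. \<Lambda> \<alpha> p ` \<Omega> p)" by (auto simp: image_iff)
  qed
  moreover have "negligible (\<Union>(\<alpha>, p)\<in>UNIV. \<Lambda> \<alpha> p ` \<Omega> p)"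
    by (rule negligible_Union) (auto simp: neg)
  ultimately show ?thesis by (rule negligible_subset[rotated])
qed

theorem theorem3p3:
  fixes C :: "('m::{finite,linorder}, 'n::finite) tensor set"
  assumes "CARD('m) \<ge> 2" and "CARD('n) \<ge> 2"
  defines "C \<equiv> UNIV - R0_tensors"
  shows "semialgebraic C \<and>
    (CARD('n) - 1) ^ CARD('m) \<le> semialgebraic_dim C \<and>
    semialgebraic_dim C \<le> CARD('n) ^ CARD('m) - 1"
proof -
  fix i0 :: 'n
  note cube = open_unit_cube_subset_non_R0[OF assms(1), of i0]
  have sC: "semialgebraic C" unfolding C_def by (rule semialgebraic_non_R0[OF assms(1)])
  have ne: "C \<noteq> {}" using cube(3) open_unit_cube_nonempty[OF cube(1)] by (auto simp: C_def)
  have "(CARD('n) - 1) ^ CARD('m) \<le> semialgebraic_dim C"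
    using semialgebraic_dim_ge[OF sC cube(1)] cube(2,3) by (simp add: C_def)
  moreover have "semialgebraic_dim C < DIM(('m, 'n) tensor)"
    by (rule semialgebraic_dim_negligible[OF sC ne]) (simp add: C_def negligible_non_R0[OF assms(1)])
  then have "semialgebraic_dim C < CARD('n) ^ CARD('m)" by (simp add: card_fun)
  ultimately show ?thesis using sC by auto
qed

end
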